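(* Let $1<p<\infty$. There exist constants $C_p,c_p>0$, depending only on $p$, such that for every $n\ge 1$ $$\mathbb{E}_{\mu_{B_p^n}}\left[-\log q_{B_p^n}\right]\ \geq\ C_p\,n\log n-c_p\,n.$$ Consequently, the sequence $(\mu_{B_p^n})_{n\in\mathbb{N}}$ of uniform measures on the $\ell_p$-balls exhibits a sharp threshold for random convex hulls.
   Context: $B_p^n=\{x\in\mathbb{R}^n:\|x\|_p\leq1\}$ is the unit ball of the $\ell_p$-norm; $\mu_K$ denotes the uniform probability measure on a convex body $K$ (compact convex set with non-empty interior). The Tukey half-space depth of a probability measure $\mu$ is $q_\mu(x)=\inf\{\mu(H):H\text{ a closed half-space containing }x\}$, and $q_K=q_{\mu_K}$. Sharp threshold: given a Borel probability measure $\mu$ on $\mathbb{R}^n$, for a positive integer $N$ let $P_N=\operatorname{conv}\{X_1,\ldots,X_N\}$ with $X_1,\ldots,X_N$ independent with law $\mu$, and let $\mathbb{E}_{\mu^N}$ be the expectation over $(X_1,\ldots,X_N)$. For $\delta>0$ set $$\varrho_1(\mu,\delta)=\sup\{r>0:\mathbb{E}_{\mu^N}[\mu(P_N)]\leq\delta\text{ for every }N\leq e^r\},\qquad \varrho_2(\mu,\delta)=\inf\{r>0:\mathbb{E}_{\mu^N}[\mu(P_N)]\geq1-\delta\text{ for every }N\geq e^r\}.$$ A sequence $(\mu_n)$ of probability measures $\mu_n$ on $\mathbb{R}^n$ exhibits a sharp threshold around a sequence $(T_n)$ of positive numbers if there is a sequence $(\delta_n)$ of positive numbers with $\delta_n\to0$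 such that for every $\varepsilon\in(0,1)$ there is $n_0(\varepsilon)$ with $\varrho_1(\mu_n,\delta_n)\geq(1-\varepsilon)T_n$ and $\varrho_2(\mu_n,\delta_n)\leq(1+\varepsilon)T_n$ for all $n\geq n_0(\varepsilon)$. It exhibits a sharp threshold if it does so around some such sequence $(T_n)$. *)

theory Defs
  imports "HOL-Probability.Probability"
begin

text \<open>
  The dimension varies inside the statement, so it cannot be a type.  A point of
  \<open>\<real>\<^sup>n\<close> is an extensional function on \<open>{..<n}\<close> (it has the value \<^term>\<open>undefined\<close>
  outside that set), so that \<open>\<real>\<^sup>n\<close> is the space of the product measure
  \<^term>\<open>PiM {..<n} (\<lambda>_. lborel)\<close>.
\<close>

abbreviation Rn :: "nat \<Rightarrow> (nat \<Rightarrow> real) set" where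
  "Rn n \<equiv> {..<n} \<rightarrow>\<^sub>E UNIV"

abbreviation lborel_Rn :: "nat \<Rightarrow> (nat \<Rightarrow> real) measure" where
  "lborel_Rn n \<equiv> PiM {..<n} (\<lambda>_. lborel)"

definition convex_Rn :: "nat \<Rightarrow> (nat \<Rightarrow> real) set \<Rightarrow> bool" where
  "convex_Rn n S \<longleftrightarrow> S \<subseteq> Rn n \<and>
     (\<forall>x\<in>S. \<forall>y\<in>S. \<forall>u\<ge>0. \<forall>v\<ge>0. u + v = 1 \<longrightarrow> (\<lambda>i\<in>{..<n}. u * x i + v * y i) \<in> S)"

definition halfspaces :: "nat \<Rightarrow> (nat \<Rightarrow> real) set set" where
  "halfspaces n =
     {{x \<in> Rn n. (\<Sum>i<n. a i * x i) \<le> b} | a b. \<exists>i<n. a i \<noteq> 0}"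

definition tukey_depth :: "nat \<Rightarrow> (nat \<Rightarrow> real) measure \<Rightarrow> (nat \<Rightarrow> real) \<Rightarrow> real" where
  "tukey_depth n \<mu> x = Inf {measure \<mu> H | H. H \<in> halfspaces n \<and> x \<in> H}"

text \<open>\<open>- log t\<close> for \<open>t \<in> [0, 1]\<close>, with \<open>- log 0 = \<infinity>\<close> (whereas \<open>ln 0 = 0\<close> in the library).\<close>

definition neg_log :: "real \<Rightarrow> ennreal" where
  "neg_log t = (if t = 0 then \<infinity> else ennreal (- ln t))"

definition lp_norm :: "real \<Rightarrow> nat \<Rightarrow> (nat \<Rightarrow> real) \<Rightarrow> real" where
  "lp_norm p n x = (\<Sum>i<n. \<bar>x i\<bar> powr p) powr (1 / p)"

definition lp_ball :: "real \<Rightarrow> nat \<Rightarrow> (nat \<Rightarrow> real) set" where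
  "lp_ball p n = {x \<in> Rn n. lp_norm p n x \<le> 1}"

definition lp_unif :: "real \<Rightarrow> nat \<Rightarrow> (nat \<Rightarrow> real) measure" where
  "lp_unif p n = uniform_measure (lborel_Rn n) (lp_ball p n)"

text \<open>\<open>\<bbbE>\<^bsub>\<mu>\<^sup>N\<^esub>[\<mu>(P\<^sub>N)]\<close>; the sample \<open>X\<^sub>1, \<dots>, X\<^sub>N\<close> is indexed by \<open>{..<N}\<close>.\<close>

definition expected_hull_measure :: "nat \<Rightarrow> (nat \<Rightarrow> real) measure \<Rightarrow> nat \<Rightarrow> real" where
  "expected_hull_measure n \<mu> N =
     (\<integral>X. measure \<mu> (convex_Rn n hull (X ` {..<N})) \<partial>(PiM {..<N} (\<lambda>_. \<mu>)))"

text \<open>Extended reals, since the sets below may be unbounded or empty.\<close>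

definition rho1 :: "nat \<Rightarrow> (nat \<Rightarrow> real) measure \<Rightarrow> real \<Rightarrow> ereal" where
  "rho1 n \<mu> \<delta> = Sup (ereal ` {r. 0 < r \<and>
     (\<forall>N\<ge>1. real N \<le> exp r \<longrightarrow> expected_hull_measure n \<mu> N \<le> \<delta>)})"

definition rho2 :: "nat \<Rightarrow> (nat \<Rightarrow> real) measure \<Rightarrow> real \<Rightarrow> ereal" where
  "rho2 n \<mu> \<delta> = Inf (ereal ` {r. 0 < r \<and>
     (\<forall>N\<ge>1. real N \<ge> exp r \<longrightarrow> expected_hull_measure n \<mu> N \<ge> 1 - \<delta>)})"

text \<open>
  The argument is a sequence of Borel probability measures, \<open>\<mu> n\<close> on \<open>\<real>\<^sup>n\<close>; the
  terms with index \<open>0\<close> play no role.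
\<close>

definition sharp_threshold_around ::
  "(nat \<Rightarrow> (nat \<Rightarrow> real) measure) \<Rightarrow> (nat \<Rightarrow> real) \<Rightarrow> bool" where
  "sharp_threshold_around \<mu> T \<longleftrightarrow>
     (\<exists>\<delta>. (\<forall>n. 0 < \<delta> n) \<and> \<delta> \<longlonglongrightarrow> 0 \<and>
       (\<forall>\<epsilon>::real. 0 < \<epsilon> \<and> \<epsilon> < 1 \<longrightarrow>
         (\<exists>n0. \<forall>n\<ge>n0. rho1 n (\<mu> n) (\<delta> n) \<ge> ereal ((1 - \<epsilon>) * T n) \<and>
                       rho2 n (\<mu> n) (\<delta> n) \<le> ereal ((1 + \<epsilon>) * T n))))"

definition sharp_threshold :: "(nat \<Rightarrow> (nat \<Rightarrow> real) measure) \<Rightarrow> bool" where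
  "sharp_threshold \<mu> \<longleftrightarrow> (\<exists>T. (\<forall>n. 0 < T n) \<and> sharp_threshold_around \<mu> T)"

lemma lp_ball_sets: "lp_ball p n \<in> sets (lborel_Rn n)"
proof -
  have "{x \<in> space (lborel_Rn n). lp_norm p n x \<le> 1} \<in> sets (lborel_Rn n)"
    unfolding lp_norm_def by measurable
  then show ?thesis
    by (simp add: lp_ball_def space_PiM)
qed

lemma prob_space_lp_unif:
  assumes p: "1 \<le> p" and n: "1 \<le> n"
  shows "prob_space (lp_unif p n)"
proof -
  interpret product_sigma_finite "\<lambda>_::nat. lborel :: real measure" ..
  define box where "box r = {..<n} \<rightarrow>\<^sub>E {-r..r}" for r :: real
  have box_sets: "box r \<in> sets (lborel_Rn n)" for r
    unfolding box_def by (intro sets_PiM_I_finite) auto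
  have box_vol: "emeasure (lborel_Rn n) (box r) = ennreal (2 * r) ^ n" if "0 \<le> r" for r
    unfolding box_def using that by (subst emeasure_PiM) auto
  have inner: "box (1 / real n) \<subseteq> lp_ball p n"
  proof
    fix x assume x: "x \<in> box (1 / real n)"
    have *: "\<bar>x i\<bar> powr p \<le> 1 / real n" if i: "i < n" for i
    proof -
      have xi: "\<bar>x i\<bar> \<le> 1 / real n"
        using x i by (force simp: box_def PiE_iff abs_le_iff)
      also have "\<dots> \<le> 1" using n by simp
      finally have "\<bar>x i\<bar> powr p \<le> \<bar>x i\<bar> powr 1"
        using p by (intro powr_mono') auto
      with xi show ?thesis by simp
    qed
    have "(\<Sum>i<n. \<bar>x i\<bar> powr p) \<le> (\<Sum>i<n. 1 / real n)"
      using * by (intro sum_mono) auto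
    also have "\<dots> = 1" using n by simp
    finally have "lp_norm p n x \<le> 1 powr (1 / p)"
      using p unfolding lp_norm_def by (intro powr_mono2 sum_nonneg) auto
    with x show "x \<in> lp_ball p n"
      by (auto simp: lp_ball_def box_def PiE_iff)
  qed
  have outer: "lp_ball p n \<subseteq> box 1"
  proof
    fix x assume x: "x \<in> lp_ball p n"
    have "\<bar>x i\<bar> \<le> 1" if i: "i < n" for i
    proof -
      have "\<bar>x i\<bar> powr p \<le> (\<Sum>i<n. \<bar>x i\<bar> powr p)"
        using i by (intro member_le_sum) auto
      then have "(\<bar>x i\<bar> powr p) powr (1 / p) \<le> lp_norm p n x"
        using p unfolding lp_norm_def by (intro powr_mono2) auto
      then show ?thesis
        using x p by (simp add: powr_powr lp_ball_def)
    qed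
    with x show "x \<in> box 1"
      by (auto simp: lp_ball_def box_def PiE_iff abs_le_iff minus_le_iff)
  qed
  have "0 < ennreal (2 * (1 / real n)) ^ n"
    using n by (simp add: ennreal_power)
  also have "\<dots> \<le> emeasure (lborel_Rn n) (lp_ball p n)"
    using emeasure_mono[OF inner lp_ball_sets] by (simp add: box_vol)
  finally have "emeasure (lborel_Rn n) (lp_ball p n) \<noteq> 0" by simp
  moreover have "emeasure (lborel_Rn n) (lp_ball p n) \<noteq> \<infinity>"
  proof -
    have "emeasure (lborel_Rn n) (lp_ball p n) \<le> ennreal (2 * 1) ^ n"
      using emeasure_mono[OF outer box_sets] by (simp only: box_vol)
    also have "\<dots> < \<infinity>" by (simp add: power_less_top_ennreal)
    finally show ?thesis by simp
  qed
  ultimately show ?thesis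
    unfolding lp_unif_def by (rule prob_space_uniform_measure)
qed

end

theory Submission
  imports Defs "HOL-Real_Asymp.Real_Asymp"
begin

text \<open>
  Both assertions come from one two-sided local estimate.  Put \<open>w = n powr (1 / p)\<close>.  A uniform
  random point \<open>x\<close> of the \<open>\<ell>\<^sub>p\<close>-ball has coordinates \<open>w * x i\<close> of order 1, and its norm differs from
  1 by about \<open>1 / n\<close>.  Fix a parameter \<open>K \<ge> 1\<close> and let \<open>typical_set p K n\<close> be the set of the points
  for which this holds up to factors \<open>K\<close> (for the radius) and \<open>exp (O(n))\<close> (for the product of the
  coordinates); its complement has measure at most \<open>exp (- K) + 1 / K + (1 / 2) ^ n\<close>
  (\<open>typical_set_measure\<close>).  For a typical \<open>x\<close> the relevant measures are all \<open>n powr (- n / 2)\<close>, up to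
  factors \<open>exp (O(K n))\<close> and \<open>K ^ n\<close>:

  \<^item> Few points.  Let \<open>H\<close> be the half-space that is tangent at \<open>x\<close> to the level set of the norm
    and does not contain the origin.  For \<open>z\<close> in \<open>H\<close> and in the ball the Bregman divergences
    \<open>\<bar>z i\<bar> powr p - \<bar>x i\<bar> powr p - p * a i * (z i - x i)\<close> of the coordinates add up to at most
    \<open>p * K / n\<close>.  A divergence is quadratic in the relative deviation of \<open>z i\<close> from \<open>x i\<close>, so every
    coordinate is confined to a relative window of size \<open>1 / sqrt n\<close>, and \<open>H\<close> has measure at most
    \<open>n powr (- n / 2) * exp (O(K n))\<close> (\<open>typical_halfspace\<close>).  This bounds the depth, hence
    the expectation of its logarithm.  A point of the hull has a sample point in each half-space that
    contains it, so \<open>x\<close> lies in the hull of \<open>N\<close> points with probability at most \<open>N\<close> times this measure.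

  \<^item> Many points.  Conversely a box around \<open>x\<close> with relative side lengths about \<open>1 / (K * sqrt n)\<close> lies
    in the ball, apart from the first-order term of the norm.  That term is a sum of independent
    centred contributions and is harmless on most of the box by Hoeffding's inequality.
    The part of the box beyond a hyperplane that passes near \<open>x\<close> is still a quarter of it, by symmetry
    (\<open>typical_regions\<close>).  If \<open>x\<close> is not in the hull, then some hyperplane through \<open>x\<close> separates it
    from the sample.  Its normal can be rounded to one of \<open>(17 * n) ^ n\<close> integer vectors, and
    the corresponding part of the box contains no sample point.
    A union bound gives the probability of this (\<open>typical_hull_miss\<close>).

  With \<open>K = sqrt (ln n)\<close> all the error terms are \<open>exp (o(n * ln n))\<close>, whence a sharp threshold around
  \<open>n / 2 * ln n\<close>, for every \<open>p > 1\<close>.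
\<close>

section \<open>One-dimensional estimates\<close>

lemma nn_integral_even:
  fixes g :: "real \<Rightarrow> ennreal"
  assumes [measurable]: "g \<in> borel_measurable borel"
  shows "(\<integral>\<^sup>+t. g \<bar>t\<bar> \<partial>lborel) = 2 * (\<integral>\<^sup>+t. indicator {0..} t * g t \<partial>lborel)"
proof -
  have "(\<integral>\<^sup>+t. g \<bar>t\<bar> \<partial>lborel)
      = (\<integral>\<^sup>+t. indicator {0..} t * g t + indicator {0<..} (- t) * g (- t) \<partial>lborel)"
    by (intro nn_integral_cong) (auto simp: indicator_def)
  also have "\<dots> = (\<integral>\<^sup>+t. indicator {0..} t * g t \<partial>lborel)
      + (\<integral>\<^sup>+t. indicator {0<..} (- t) * g (- t) \<partial>lborel)"
    by (intro nn_integral_add) auto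
  also have "(\<integral>\<^sup>+t. indicator {0<..} (- t) * g (- t) \<partial>lborel)
      = (\<integral>\<^sup>+t. indicator {0<..} t * g t \<partial>lborel)"
    using nn_integral_real_affine[of "\<lambda>t. indicator {0<..} t * g t" "-1" 0] by simp
  also have "\<dots> = (\<integral>\<^sup>+t. indicator {0..} t * g t \<partial>lborel)"
    by (intro nn_integral_cong_AE, rule eventually_mono[OF AE_lborel_singleton[of 0]])
       (auto simp: indicator_def)
  finally show ?thesis by (simp add: mult_2)
qed

lemma nn_integral_abs_powr_exp:
  fixes s :: real
  assumes s: "0 < s"
  shows "(\<integral>\<^sup>+t. ennreal (\<bar>t\<bar> powr (s - 1) * exp (- \<bar>t\<bar>)) \<partial>lborel) = ennreal (2 * Gamma s)"
proof -
  have "(\<integral>\<^sup>+t. indicator {0..} t * ennreal (t powr (s - 1) * exp (- t)) \<partial>lborel)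
     = (\<integral>\<^sup>+t. ennreal (indicator {0..} t * t powr (s - 1) / exp t) \<partial>lborel)"
    by (intro nn_integral_cong) (auto simp: indicator_def exp_minus field_simps)
  also have "\<dots> = ennreal (Gamma s)"
    using Gamma_conv_nn_integral_real[OF s] by simp
  finally show ?thesis
    using nn_integral_even[of "\<lambda>t. ennreal (t powr (s - 1) * exp (- t))"] s
    by (simp add: ennreal_mult' Gamma_real_pos less_imp_le)
qed

lemma nn_integral_exp_abs: "(\<integral>\<^sup>+t. ennreal (exp (- \<bar>t\<bar>)) \<partial>lborel) = 2"
proof -
  have "(\<integral>\<^sup>+t. ennreal (exp (- \<bar>t\<bar>)) \<partial>lborel)
      = (\<integral>\<^sup>+t. ennreal (\<bar>t\<bar> powr (1 - 1) * exp (- \<bar>t\<bar>)) \<partial>lborel)"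
    by (intro nn_integral_cong_AE, rule eventually_mono[OF AE_lborel_singleton[of 0]]) auto
  then show ?thesis using nn_integral_abs_powr_exp[of 1] by simp
qed

text \<open>
  Comparing \<open>h\<close> with \<open>\<bar>t\<bar> - 1\<close> costs only a factor
  \<open>exp 1\<close>, which is harmless because only the dependence on \<open>c\<close>
  matters: constant factors per coordinate are allowed throughout.
\<close>

lemma nn_integral_scaled_exp_le:
  fixes h :: "real \<Rightarrow> real"
  assumes c: "0 < c" and h: "\<And>t. \<bar>t\<bar> - 1 \<le> h t"
  and [measurable]: "h \<in> borel_measurable borel"
  shows "(\<integral>\<^sup>+t. ennreal (exp (- h (c * t))) \<partial>lborel) \<le> ennreal (2 * exp 1 / c)"
proof -
  have "(\<integral>\<^sup>+t. ennreal (exp (- h t)) \<partial>lborel) \<le> (\<integral>\<^sup>+t. ennreal (exp 1) * ennreal (exp (- \<bar>t\<bar>)) \<partial>lborel)"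
    using h by (intro nn_integral_mono) (auto simp flip: ennreal_mult exp_add intro!: ennreal_leI simp: algebra_simps)
  also have "\<dots> = ennreal (2 * exp 1)"
    by (subst nn_integral_cmult) (simp_all add: nn_integral_exp_abs ennreal_mult mult.commute)
  finally have 1: "(\<integral>\<^sup>+t. ennreal (exp (- h t)) \<partial>lborel) \<le> ennreal (2 * exp 1)" .
  have "ennreal c * (\<integral>\<^sup>+t. ennreal (exp (- h (c * t))) \<partial>lborel) = (\<integral>\<^sup>+t. ennreal (exp (- h t)) \<partial>lborel)"
    using nn_integral_real_affine[of "\<lambda>t. ennreal (exp (- h t))" c 0] c by simp
  then have sc: "ennreal c * (\<integral>\<^sup>+t. ennreal (exp (- h (c * t))) \<partial>lborel) = (\<integral>\<^sup>+t. ennreal (exp (- h t)) \<partial>lborel)" .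
  have "(\<integral>\<^sup>+t. ennreal (exp (- h (c * t))) \<partial>lborel)
     = ennreal (1/c) * (\<integral>\<^sup>+t. ennreal (exp (- h t)) \<partial>lborel)"
  proof -
    have "ennreal (1/c) * ennreal c = 1" using c by (simp flip: ennreal_mult)
    then show ?thesis
      unfolding sc[symmetric] by (simp add: mult.assoc[symmetric])
  qed
  also have "\<dots> \<le> ennreal (1/c) * ennreal (2 * exp 1)" by (intro mult_left_mono 1) simp
  finally show ?thesis using c by (simp flip: ennreal_mult)
qed

text \<open>
  The left-hand side and the right-hand side agree at 0, and the derivative of their difference
  has the sign of \<open>t\<close>: by \<open>t / 2 \<le> ln (1 + t)\<close> to the
  right of 0 and by \<open>1 + t \<le> exp t\<close> to the left.
\<close>

lemma bregman_near:
  fixes p t :: real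
  assumes p: "1 < p" and t: "\<bar>t\<bar> \<le> 1/2"
  shows "1 + p * t + (p - 1) / 4 * t\<^sup>2 \<le> (1 + t) powr p"
proof -
  define q where "q = p - 1"
  define g where "g t = (1 + t) powr p - p * t - q / 4 * t\<^sup>2" for t :: real
  have der: "(g has_real_derivative p * ((1 + t) powr q - 1) - q / 2 * t) (at t)"
    if "\<bar>t\<bar> \<le> 1/2" for t
    unfolding g_def q_def using that
    by (auto intro!: derivative_eq_intros simp: field_simps)
  have q: "0 < q" using p by (simp add: q_def)
  have pos: "p * ((1 + t) powr q - 1) - q / 2 * t \<ge> 0" if t: "0 \<le> t" "t \<le> 1/2" for t
  proof -
    have "t\<^sup>2 \<le> t / 2" using mult_left_mono[of t "1/2" t] t by (simp add: power2_eq_square)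
    then have "t / 2 \<le> ln (1 + t)" using ln_one_plus_pos_lower_bound[of t] t by simp
    then have "1 + q * (t / 2) \<le> exp (q * ln (1 + t))"
      using q by (intro order_trans[OF _ exp_ge_add_one_self]) (simp add: algebra_simps)
    also have "\<dots> = (1 + t) powr q" using t by (simp add: powr_def)
    finally have "q / 2 * t \<le> (1 + t) powr q - 1" by simp
    also have "\<dots> \<le> p * ((1 + t) powr q - 1)"
      using p t q ge_one_powr_ge_zero[of "1+t" q] mult_right_mono[of 1 p "(1 + t) powr q - 1"] by simp
    finally show ?thesis by simp
  qed
  have neg: "p * ((1 + t) powr q - 1) - q / 2 * t \<le> 0" if t: "t \<le> 0" "- (1/2) \<le> t" for t
  proof -
    have "1 + t \<le> exp t" by (rule exp_ge_add_one_self)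
    then have "(1 + t) powr q \<le> exp t powr q"
      using q t by (intro powr_mono2) auto
    also have "\<dots> = 1 / exp (q * (- t))" by (simp add: powr_def exp_minus field_simps)
    also have "\<dots> \<le> 1 / (1 + q * (- t))"
      using q t by (intro divide_left_mono exp_ge_add_one_self mult_pos_pos) (use mult_nonneg_nonpos[of q t] in auto)
    finally have a: "(1 + t) powr q - 1 \<le> q * t / (1 - q * t)"
      using q t mult_nonneg_nonpos[of q t] by (simp add: field_simps)
    have "1 - q * t \<le> 2 * p" using t q mult_left_mono[of "-t" "1/2" q] by (simp add: q_def)
    moreover have A: "0 < 1 - q * t" using q t mult_nonneg_nonpos[of q t] by simp
    ultimately have "1 / 2 \<le> p / (1 - q * t)" by (simp add: field_simps)
    then have "p / (1 - q * t) * (q * t) \<le> 1 / 2 * (q * t)"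
      using q t by (intro mult_right_mono_neg) (auto intro: mult_nonneg_nonpos)
    then have "p * (q * t / (1 - q * t)) \<le> q / 2 * t" by simp
    moreover have "p * ((1 + t) powr q - 1) \<le> p * (q * t / (1 - q * t))"
      using p by (intro mult_left_mono a) auto
    ultimately have "p * ((1 + t) powr q - 1) \<le> q / 2 * t" by (rule order_trans[rotated])
    then show ?thesis by simp
  qed
  have "g 0 \<le> g t"
  proof (cases "0 \<le> t")
    case True
    have "\<exists>y. (g has_real_derivative y) (at x) \<and> 0 \<le> y" if "0 \<le> x" "x \<le> t" for x
      using der[of x] pos[of x] that t True by (intro exI[of _ "p * ((1 + x) powr q - 1) - q / 2 * x"]) simp
    then show ?thesis by (rule DERIV_nonneg_imp_nondecreasing[OF True])
  next
    case False
    then have t0: "t \<le> 0" by simp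
    have "\<exists>y. (g has_real_derivative y) (at x) \<and> y \<le> 0" if "t \<le> x" "x \<le> 0" for x
      using der[of x] neg[of x] that t by (intro exI[of _ "p * ((1 + x) powr q - 1) - q / 2 * x"]) simp
    then show ?thesis by (rule DERIV_nonpos_imp_nonincreasing[OF t0])
  qed
  then show ?thesis by (simp add: g_def q_def)
qed


text \<open>
  The Bregman divergence of \<open>t \<mapsto> \<bar>t\<bar> powr p\<close> at 1 grows
  quadratically near 0 and at least linearly far away.  Near 0 this is the previous lemma.  For
  larger \<open>\<bar>t\<bar>\<close> convexity propagates the value at
  \<open>\<plusminus> 1 / 2\<close> linearly, and where \<open>1 + t\<close> is not
  positive already \<open>0 \<le> \<bar>1 + t\<bar> powr p\<close> suffices.  Here
  \<open>p > 1\<close> is essential: for \<open>p = 1\<close> the divergence vanishes near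
  0.
\<close>

lemma bregman_ge:
  fixes p t :: real
  assumes p: "1 < p"
  shows "1 + p * t + (p - 1) / 8 * min (t\<^sup>2) \<bar>t\<bar> \<le> \<bar>1 + t\<bar> powr p"
proof -
  consider "\<bar>t\<bar> \<le> 1/2" | "t \<le> -1" | "\<bar>t\<bar> > 1/2" "t > -1" by linarith
  then show ?thesis
  proof cases
    case 1
    have "(p - 1) / 8 * min (t\<^sup>2) \<bar>t\<bar> \<le> (p - 1) / 4 * t\<^sup>2"
      using p by (intro mult_mono) auto
    then show ?thesis using bregman_near[OF p 1] 1 by simp
  next
    case 2
    have "(p - 1) / 8 * min (t\<^sup>2) \<bar>t\<bar> \<le> (p - 1) * \<bar>t\<bar>"
      using p by (intro mult_mono) auto
    moreover have "1 + p * t + (p - 1) * \<bar>t\<bar> \<le> 0" using 2 by (simp add: algebra_simps)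
    ultimately show ?thesis using powr_ge_zero[of "\<bar>1+t\<bar>" p] by linarith
  next
    case 3
    \<comment> \<open>The point \<open>1 + l * t\<close> is at distance \<open>1 / 2\<close>
      from 1, on the segment from 1 to \<open>1 + t\<close>.\<close>
    define l where "l = 1 / (2 * \<bar>t\<bar>)"
    have l: "0 < l" "l \<le> 1" "l * \<bar>t\<bar> = 1/2" using 3 by (auto simp: l_def field_simps)
    have lt: "\<bar>l * t\<bar> \<le> 1/2" using l by (simp add: abs_mult)
    have "((1 - l) *\<^sub>R 1 + l *\<^sub>R (1 + t)) powr p \<le> (1 - l) * 1 powr p + l * (1 + t) powr p"
      using 3 l p by (intro convex_onD[OF powr_convex[of p]]) auto
    also have "(1 - l) *\<^sub>R 1 + l *\<^sub>R (1 + t) = 1 + l * t" by (simp add: algebra_simps)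
    finally have a: "(1 + l * t) powr p \<le> 1 - l + l * (1 + t) powr p" by simp
    have "1 + p * (l * t) + (p - 1) / 4 * (l * t)\<^sup>2 \<le> (1 + l * t) powr p"
      by (rule bregman_near[OF p lt])
    also have "(l * t)\<^sup>2 = l * \<bar>t\<bar> * (l * \<bar>t\<bar>)" by (simp add: power2_eq_square)
    also have "\<dots> = l * (\<bar>t\<bar> / 2)" using l(3) by simp
    finally have "l * (1 + p * t + (p - 1) / 8 * \<bar>t\<bar>) \<le> l * (1 + t) powr p"
      using a by (simp add: algebra_simps)
    then have "1 + p * t + (p - 1) / 8 * \<bar>t\<bar> \<le> (1 + t) powr p" using l by simp
    moreover have "(p - 1) / 8 * min (t\<^sup>2) \<bar>t\<bar> \<le> (p - 1) / 8 * \<bar>t\<bar>"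
      using p by (intro mult_left_mono) auto
    ultimately show ?thesis using 3 by simp
  qed
qed

text \<open>
  Both \<open>1 + t \<le> exp t\<close> and
  \<open>exp s \<le> 1 + s + s\<^sup>2\<close> for
  \<open>\<bar>s\<bar> \<le> 1\<close> lose only second-order terms.
\<close>

lemma powr_le_quadratic:
  fixes p t :: real
  assumes p: "1 < p" and t: "\<bar>p * t\<bar> \<le> 1"
  shows "\<bar>1 + t\<bar> powr p \<le> 1 + p * t + (p * t)\<^sup>2"
proof -
  have "p * \<bar>t\<bar> \<le> 1" using p t by (simp add: abs_mult)
  then have "\<bar>t\<bar> < 1" using p mult_left_mono[of 1 "\<bar>t\<bar>" p] by linarith
  then have "\<bar>1 + t\<bar> powr p \<le> exp t powr p"
    using p by (intro powr_mono2) (auto simp: abs_if)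
  also have "\<dots> = exp (p * t)" by (simp add: powr_def)
  also have "\<dots> \<le> 1 + p * t + (p * t)\<^sup>2"
    using t exp_bound[of "p*t"] exp_ge_add_one_self[of "-(p*t)"]
  proof (cases "0 \<le> p * t")
    case False
    define x where "x = - (p * t)"
    have x: "0 < x" "x \<le> 1" using False t by (auto simp: x_def)
    have "1 / exp x \<le> 1 / (1 + x)" using x by (intro divide_left_mono exp_ge_add_one_self) (auto simp: add_pos_pos)
    also have "\<dots> \<le> 1 - x + x\<^sup>2" using x by (simp add: field_simps power2_eq_square)
    finally show ?thesis by (simp add: x_def exp_minus field_simps)
  qed (use exp_bound[of "p*t"] t in auto)
  finally show ?thesis .
qed

text \<open>
  The two summands come from the quadratic and from the linear regime of the divergence.  With
  \<open>s\<close> of order \<open>n\<close> the first one dominates and is the source of the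
  factor \<open>1 / sqrt n\<close> per coordinate.
\<close>

lemma nn_integral_bregman:
  fixes p s :: real
  assumes p: "1 < p" and s: "0 < s"
  shows "(\<integral>\<^sup>+t. ennreal (exp (- s * (\<bar>1 + t\<bar> powr p - 1 - p * t))) \<partial>lborel)
    \<le> ennreal (2 * exp 1 / sqrt (s * (p - 1) / 8) + 2 * exp 1 / (s * (p - 1) / 8))"
proof -
  define b where "b = s * (p - 1) / 8"
  have b: "0 < b" using p s by (simp add: b_def)
  have *: "exp (- s * (\<bar>1 + t\<bar> powr p - 1 - p * t)) \<le> exp (- ((sqrt b * t)\<^sup>2)) + exp (- \<bar>b * t\<bar>)" for t
  proof -
    have "b * min (t\<^sup>2) \<bar>t\<bar> = s * ((p - 1) / 8 * min (t\<^sup>2) \<bar>t\<bar>)" by (simp add: b_def)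
    also have "\<dots> \<le> s * (\<bar>1 + t\<bar> powr p - 1 - p * t)"
      using bregman_ge[OF p, of t] s by (intro mult_left_mono) auto
    finally have "exp (- s * (\<bar>1 + t\<bar> powr p - 1 - p * t)) \<le> exp (- (b * min (t\<^sup>2) \<bar>t\<bar>))" by simp
    also have "\<dots> \<le> exp (- (b * t\<^sup>2)) + exp (- (b * \<bar>t\<bar>))"
      by (simp add: min_def)
    finally show ?thesis using b by (simp add: power_mult_distrib abs_mult)
  qed
  have "(\<integral>\<^sup>+t. ennreal (exp (- s * (\<bar>1 + t\<bar> powr p - 1 - p * t))) \<partial>lborel)
     \<le> (\<integral>\<^sup>+t. ennreal (exp (- ((sqrt b * t)\<^sup>2))) + ennreal (exp (- \<bar>b * t\<bar>)) \<partial>lborel)"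
    using * by (intro nn_integral_mono) (simp flip: ennreal_plus)
  also have "\<dots> = (\<integral>\<^sup>+t. ennreal (exp (- ((sqrt b * t)\<^sup>2))) \<partial>lborel) + (\<integral>\<^sup>+t. ennreal (exp (- \<bar>b * t\<bar>)) \<partial>lborel)"
    by (intro nn_integral_add) auto
  also have "\<dots> \<le> ennreal (2 * exp 1 / sqrt b) + ennreal (2 * exp 1 / b)"
  proof (intro add_mono nn_integral_scaled_exp_le)
    fix t :: real
    have "0 \<le> (\<bar>t\<bar> - 1)\<^sup>2" by simp
    then have "2 * \<bar>t\<bar> - 1 \<le> t\<^sup>2" by (simp add: power2_diff)
    then show "\<bar>t\<bar> - 1 \<le> t\<^sup>2" using abs_ge_zero[of t] by linarith
  qed (use b in auto)
  finally show ?thesis using b by (simp add: b_def flip: ennreal_plus)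
qed

section \<open>Product Lebesgue measure and the uniform measure on the cube\<close>

interpretation lborel_product: product_sigma_finite "\<lambda>_::nat. lborel :: real measure" ..

lemma affine_measurable:
  "(\<lambda>u. \<lambda>i\<in>{..<n}. t i + c i * u i) \<in> measurable (lborel_Rn n) (lborel_Rn n)"
  by (rule measurable_restrict) measurable

text \<open>
  The scaled push-forward of the product measure under a coordinatewise affine map has the
  right values on boxes, and these determine a product measure.
\<close>

lemma emeasure_affine:
  assumes c: "\<And>i. i < n \<Longrightarrow> c i \<noteq> 0" and A: "A \<in> sets (lborel_Rn n)"
  shows "emeasure (lborel_Rn n) A = (\<Prod>i<n. ennreal \<bar>c i\<bar>) *
    emeasure (lborel_Rn n) {u \<in> Rn n. (\<lambda>i\<in>{..<n}. t i + c i * u i) \<in> A}"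
proof -
  let ?f = "\<lambda>u. \<lambda>i\<in>{..<n}. t i + c i * u i"
  define C where "C = (\<Prod>i<n. ennreal \<bar>c i\<bar>)"
  have vim: "?f -` B \<inter> space (lborel_Rn n) = {u \<in> Rn n. ?f u \<in> B}" for B
    by (auto simp: space_PiM)
  have "density (distr (lborel_Rn n) (lborel_Rn n) ?f) (\<lambda>_. C) = lborel_Rn n"
  proof (rule lborel_product.PiM_eqI)
    fix E :: "nat \<Rightarrow> real set"
    assume "\<And>i. i \<in> {..<n} \<Longrightarrow> E i \<in> sets lborel"
    then have E: "E i \<in> sets borel" if "i < n" for i using that by auto
    have PE: "PiE {..<n} E \<in> sets (lborel_Rn n)" using E by (intro sets_PiM_I_finite) auto
    have one: "emeasure lborel (E i) = ennreal \<bar>c i\<bar> * emeasure lborel ((\<lambda>x. t i + c i * x) -` E i)"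
      if i: "i < n" for i
    proof -
      have "emeasure lborel (E i) = (\<integral>\<^sup>+x. indicator (E i) x \<partial>lborel)" using E[OF i] by simp
      also have "\<dots> = ennreal \<bar>c i\<bar> * (\<integral>\<^sup>+x. indicator (E i) (t i + c i * x) \<partial>lborel)"
        using E[OF i] c[OF i] by (intro nn_integral_real_affine) auto
      also have "(\<integral>\<^sup>+x. indicator (E i) (t i + c i * x) \<partial>lborel)
        = (\<integral>\<^sup>+x. indicator ((\<lambda>x. t i + c i * x) -` E i) x \<partial>lborel)"
        by (intro nn_integral_cong) (auto simp: indicator_def)
      also have "\<dots> = emeasure lborel ((\<lambda>x. t i + c i * x) -` E i)"
        using measurable_sets_borel[of "\<lambda>x. t i + c i * x" borel "E i"] E[OF i]
        by (intro nn_integral_indicator) auto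
      finally show ?thesis .
    qed
    have "emeasure (density (distr (lborel_Rn n) (lborel_Rn n) ?f) (\<lambda>_. C)) (PiE {..<n} E)
       = C * emeasure (distr (lborel_Rn n) (lborel_Rn n) ?f) (PiE {..<n} E)"
      using PE by (subst emeasure_density) (simp_all add: nn_integral_cmult_indicator)
    also have "emeasure (distr (lborel_Rn n) (lborel_Rn n) ?f) (PiE {..<n} E)
       = emeasure (lborel_Rn n) {u \<in> Rn n. ?f u \<in> PiE {..<n} E}"
      using PE affine_measurable by (subst emeasure_distr) (simp_all add: vim)
    also have "{u \<in> Rn n. ?f u \<in> PiE {..<n} E} = PiE {..<n} (\<lambda>i. (\<lambda>x. t i + c i * x) -` E i)"
    proof (intro set_eqI iffI)
      fix u assume u: "u \<in> {u \<in> Rn n. ?f u \<in> PiE {..<n} E}"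
      then show "u \<in> PiE {..<n} (\<lambda>i. (\<lambda>x. t i + c i * x) -` E i)"
      proof (intro PiE_I)
        fix i assume "i \<in> {..<n}"
        with u show "u i \<in> (\<lambda>x. t i + c i * x) -` E i"
          using PiE_mem[of "?f u" "{..<n}" E i] by simp
      qed (use u PiE_arb[of u "{..<n}" "\<lambda>_. UNIV"] in simp)
    next
      fix u assume u: "u \<in> PiE {..<n} (\<lambda>i. (\<lambda>x. t i + c i * x) -` E i)"
      then have "?f u \<in> PiE {..<n} E" by (intro restrict_PiE_iff[THEN iffD2]) (auto dest: PiE_mem)
      moreover have "u \<in> Rn n" using u by (rule subsetD[OF PiE_mono, rotated]) simp
      ultimately show "u \<in> {u \<in> Rn n. ?f u \<in> PiE {..<n} E}" by simp
    qed
    also have "emeasure (lborel_Rn n) \<dots> = (\<Prod>i<n. emeasure lborel ((\<lambda>x. t i + c i * x) -` E i))"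
    proof (intro lborel_product.emeasure_PiM)
      fix i assume "i \<in> {..<n}"
      then show "(\<lambda>x. t i + c i * x) -` E i \<in> sets lborel"
        using measurable_sets_borel[of "\<lambda>x. t i + c i * x" borel "E i"] E by simp
    qed simp
    also have "C * \<dots> = (\<Prod>i<n. emeasure lborel (E i))"
      unfolding C_def prod.distrib[symmetric] by (intro prod.cong) (auto simp: one)
    finally show "emeasure (density (distr (lborel_Rn n) (lborel_Rn n) ?f) (\<lambda>_. C)) (PiE {..<n} E)
       = (\<Prod>i\<in>{..<n}. emeasure lborel (E i))" .
  qed auto
  then have "emeasure (lborel_Rn n) A = emeasure (density (distr (lborel_Rn n) (lborel_Rn n) ?f) (\<lambda>_. C)) A"
    by simp
  also have "\<dots> = C * emeasure (distr (lborel_Rn n) (lborel_Rn n) ?f) A"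
    using A by (subst emeasure_density) (simp_all add: nn_integral_cmult_indicator)
  also have "emeasure (distr (lborel_Rn n) (lborel_Rn n) ?f) A = emeasure (lborel_Rn n) {u \<in> Rn n. ?f u \<in> A}"
    using A affine_measurable by (subst emeasure_distr) (simp_all add: vim)
  finally show ?thesis by (simp add: C_def)
qed

text \<open>
  Chernoff's bound for Lebesgue measure: an indicator function is dominated by a function of
  product form, whose integral factorises.
\<close>

lemma emeasure_le_prod_nn_integral:
  fixes g :: "nat \<Rightarrow> real \<Rightarrow> ennreal"
  assumes g: "\<And>i. i < n \<Longrightarrow> g i \<in> borel_measurable borel" and A: "A \<in> sets (lborel_Rn n)"
    and ge: "\<And>x. x \<in> A \<Longrightarrow> 1 \<le> C * (\<Prod>i<n. g i (x i))"
  shows "emeasure (lborel_Rn n) A \<le> C * (\<Prod>i<n. \<integral>\<^sup>+t. g i t \<partial>lborel)"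
proof -
  have [measurable]: "g i \<in> borel_measurable borel" if "i \<in> {..<n}" for i using g that by simp
  have "emeasure (lborel_Rn n) A = (\<integral>\<^sup>+x. indicator A x \<partial>lborel_Rn n)" using A by simp
  also have "\<dots> \<le> (\<integral>\<^sup>+x. C * (\<Prod>i<n. g i (x i)) \<partial>lborel_Rn n)"
    using ge by (intro nn_integral_mono) (auto simp: indicator_def)
  also have "\<dots> = C * (\<integral>\<^sup>+x. (\<Prod>i<n. g i (x i)) \<partial>lborel_Rn n)"
    by (intro nn_integral_cmult) measurable
  also have "(\<integral>\<^sup>+x. (\<Prod>i<n. g i (x i)) \<partial>lborel_Rn n) = (\<Prod>i<n. \<integral>\<^sup>+t. g i t \<partial>lborel)"
    by (intro lborel_product.product_nn_integral_prod) auto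
  finally show ?thesis .
qed

abbreviation sym_interval :: "real measure" where
  "sym_interval \<equiv> uniform_measure lborel {-1..1}"

abbreviation cube_measure :: "nat \<Rightarrow> (nat \<Rightarrow> real) measure" where
  "cube_measure n \<equiv> PiM {..<n} (\<lambda>_. sym_interval)"

lemma prob_space_sym_interval: "prob_space sym_interval"
  by (rule prob_space_uniform_measure) auto

interpretation sym_product: product_sigma_finite "\<lambda>_::nat. sym_interval"
  by (rule product_sigma_finite.intro)
     (rule prob_space_imp_sigma_finite[OF prob_space_sym_interval])

lemma sets_cube_measure: "sets (cube_measure n) = sets (lborel_Rn n)"
  by (intro sets_PiM_cong) auto

lemma cube_measure_eq:
  "cube_measure n = uniform_measure (lborel_Rn n) (PiE {..<n} (\<lambda>_. {-1..1}))"
proof (rule sym_product.PiM_eqI[symmetric])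
  let ?Q = "PiE {..<n} (\<lambda>_. {-1..1::real})"
  have Q: "?Q \<in> sets (lborel_Rn n)" by (intro sets_PiM_I_finite) auto
  fix E :: "nat \<Rightarrow> real set"
  assume "\<And>i. i \<in> {..<n} \<Longrightarrow> E i \<in> sets sym_interval"
  then have E: "E i \<in> sets borel" if "i < n" for i using that by auto
  have PE: "PiE {..<n} E \<in> sets (lborel_Rn n)" using E by (intro sets_PiM_I_finite) auto
  have "emeasure (lborel_Rn n) (?Q \<inter> PiE {..<n} E) = (\<Prod>i<n. emeasure lborel ({-1..1} \<inter> E i))"
    using E by (subst PiE_Int) (intro lborel_product.emeasure_PiM, auto)
  moreover have "emeasure (lborel_Rn n) ?Q = (\<Prod>i<n. 2)"
    by (subst lborel_product.emeasure_PiM) auto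
  ultimately show "emeasure (uniform_measure (lborel_Rn n) ?Q) (PiE {..<n} E)
     = (\<Prod>i\<in>{..<n}. emeasure sym_interval (E i))"
    using E by (subst emeasure_uniform_measure[OF Q PE])
      (simp add: divide_ennreal_def prod.distrib ennreal_inverse_power)
qed (auto simp: sets_cube_measure[symmetric])

lemma emeasure_cube:
  assumes A: "A \<in> sets (lborel_Rn n)"
  shows "emeasure (lborel_Rn n) (PiE {..<n} (\<lambda>_. {-1..1}) \<inter> A) = 2 ^ n * emeasure (cube_measure n) A"
proof -
  let ?Q = "PiE {..<n} (\<lambda>_. {-1..1::real})"
  have Q: "?Q \<in> sets (lborel_Rn n)" by (intro sets_PiM_I_finite) auto
  have Q2: "emeasure (lborel_Rn n) ?Q = 2 ^ n"
    by (subst lborel_product.emeasure_PiM) auto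
  have "2 ^ n * emeasure (cube_measure n) A = 2 ^ n * (emeasure (lborel_Rn n) (?Q \<inter> A) / 2 ^ n)"
    unfolding cube_measure_eq using A by (subst emeasure_uniform_measure[OF Q]) (auto simp: Q2)
  also have "\<dots> = emeasure (lborel_Rn n) (?Q \<inter> A)"
    by (simp add: ennreal_times_divide mult.commute[of "2 ^ n"] mult_divide_eq_ennreal power_eq_top_ennreal)
  finally show ?thesis ..
qed

lemma distr_neg_cube: "distr (cube_measure n) (cube_measure n) (\<lambda>u. \<lambda>i\<in>{..<n}. - u i) = cube_measure n"
proof (rule sym_product.PiM_eqI)
  have meas: "(\<lambda>u. \<lambda>i\<in>{..<n}. - u i) \<in> measurable (cube_measure n) (cube_measure n)"
    by (rule measurable_restrict) measurable
  fix E :: "nat \<Rightarrow> real set"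
  assume "\<And>i. i \<in> {..<n} \<Longrightarrow> E i \<in> sets sym_interval"
  then have E: "E i \<in> sets borel" if "i < n" for i using that by auto
  have PE: "PiE {..<n} E \<in> sets (cube_measure n)" using E by (intro sets_PiM_I_finite) auto
  have one: "emeasure sym_interval (uminus -` E i) = emeasure sym_interval (E i)" if i: "i < n" for i
  proof -
    have mE: "uminus -` E i \<in> sets borel"
      using measurable_sets_borel[of "uminus :: real \<Rightarrow> real" borel "E i"] E[OF i] by auto
    have "emeasure lborel ({-1..1} \<inter> uminus -` E i) = (\<integral>\<^sup>+x. indicator ({-1..1} \<inter> uminus -` E i) x \<partial>lborel)"
      using mE by (intro nn_integral_indicator[symmetric]) auto
    also have "\<dots> = (\<integral>\<^sup>+x. indicator ({-1..1} \<inter> E i) (0 + (-1) * x) \<partial>lborel)"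
      by (intro nn_integral_cong) (auto simp: indicator_def)
    also have "\<dots> = emeasure lborel ({-1..1} \<inter> E i)"
      using nn_integral_real_affine[of "indicator ({-1..1} \<inter> E i)" "-1" 0] E[OF i] by simp
    finally show ?thesis using E[OF i] mE by simp
  qed
  have "emeasure (distr (cube_measure n) (cube_measure n) (\<lambda>u. \<lambda>i\<in>{..<n}. - u i)) (PiE {..<n} E)
     = emeasure (cube_measure n) (PiE {..<n} (\<lambda>i. uminus -` E i))"
    using PE meas by (subst emeasure_distr) (auto simp: space_PiM PiE_iff intro!: arg_cong2[where f=emeasure])
  also have "\<dots> = (\<Prod>i<n. emeasure sym_interval (uminus -` E i))"
  proof (intro sym_product.emeasure_PiM)
    fix i assume "i \<in> {..<n}"
    then show "uminus -` E i \<in> sets sym_interval"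
      using measurable_sets_borel[of "uminus :: real \<Rightarrow> real" borel "E i"] E by simp
  qed simp
  also have "\<dots> = (\<Prod>i<n. emeasure sym_interval (E i))"
    by (intro prod.cong) (auto simp: one)
  finally show "emeasure (distr (cube_measure n) (cube_measure n) (\<lambda>u. \<lambda>i\<in>{..<n}. - u i)) (PiE {..<n} E)
     = (\<Prod>i\<in>{..<n}. emeasure sym_interval (E i))" .
qed auto

text \<open>
  The coordinates are independent, and centred because the cube is symmetric, so Hoeffding's
  inequality applies to
  \<open>\<beta> i * u i \<in> {- \<bar>\<beta> i\<bar>..\<bar>\<beta> i\<bar>}\<close>.
\<close>

lemma cube_Hoeffding:
  fixes \<beta> :: "nat \<Rightarrow> real"
  assumes s: "0 \<le> s" and \<beta>: "0 < (\<Sum>i<n. (\<beta> i)\<^sup>2)"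
  shows "measure (cube_measure n) {u \<in> space (cube_measure n). s \<le> \<bar>\<Sum>i<n. \<beta> i * u i\<bar>}
     \<le> 2 * exp (- s\<^sup>2 / (2 * (\<Sum>i<n. (\<beta> i)\<^sup>2)))"
proof -
  interpret prob_space "cube_measure n" by (intro prob_space_PiM prob_space_sym_interval)
  define X where "X i u = \<beta> i * u i" for i :: nat and u :: "nat \<Rightarrow> real"
  have n0: "{..<n} \<noteq> {}" using \<beta> by (cases "n = 0") auto
  have coord[measurable]: "(\<lambda>u. u i) \<in> measurable (cube_measure n) borel" if "i \<in> {..<n}" for i
    using measurable_component_singleton[of i "{..<n}" "\<lambda>_. sym_interval"] that
    by (simp add: measurable_def)
  have rng: "AE u in cube_measure n. u i \<in> {-1..1}" if "i < n" for i
    using that by (intro AE_PiM_component prob_space_sym_interval AE_uniform_measureI) auto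
  have "indep_vars (\<lambda>_. borel) (\<lambda>i u. u i) {..<n}"
  proof (subst indep_vars_iff_distr_eq_PiM'[OF n0])
    have "distr (cube_measure n) (PiM {..<n} (\<lambda>_. borel)) (\<lambda>x. \<lambda>i\<in>{..<n}. x i)
       = distr (cube_measure n) (cube_measure n) (\<lambda>x. x)"
      by (intro distr_cong sets_PiM_cong) (auto simp: space_PiM PiE_def extensional_restrict)
    also have "\<dots> = cube_measure n" by simp
    also have "\<dots> = PiM {..<n} (\<lambda>i. distr (cube_measure n) borel (\<lambda>x. x i))"
    proof (intro PiM_cong refl)
      fix i assume i: "i \<in> {..<n}"
      have "distr (cube_measure n) borel (\<lambda>x. x i) = distr (cube_measure n) sym_interval (\<lambda>x. x i)"
        by (intro distr_cong) auto
      also have "\<dots> = sym_interval"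
        using i by (intro distr_PiM_component prob_space_sym_interval)
      finally show "sym_interval = distr (cube_measure n) borel (\<lambda>x. x i)" ..
    qed
    finally show "distr (cube_measure n) (PiM {..<n} (\<lambda>_. borel)) (\<lambda>x. \<lambda>i\<in>{..<n}. x i)
      = PiM {..<n} (\<lambda>i. distr (cube_measure n) borel (\<lambda>x. x i))" .
  qed (use coord in auto)
  then have ind: "indep_vars (\<lambda>_. borel) X {..<n}"
    unfolding X_def by (rule indep_vars_compose2) measurable
  have E0: "expectation (X i) = 0" if i: "i < n" for i
  proof -
    have m: "X i \<in> borel_measurable (cube_measure n)" unfolding X_def using i by simp
    have "expectation (X i) = (\<integral>u. X i u \<partial>distr (cube_measure n) (cube_measure n) (\<lambda>u. \<lambda>i\<in>{..<n}. - u i))"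
      by (simp only: distr_neg_cube)
    also have "\<dots> = (\<integral>u. X i (\<lambda>i\<in>{..<n}. - u i) \<partial>cube_measure n)"
      by (intro integral_distr m measurable_restrict) measurable
    also have "\<dots> = (\<integral>u. - X i u \<partial>cube_measure n)"
      using i by (intro Bochner_Integration.integral_cong) (simp_all add: X_def)
    also have "\<dots> = - expectation (X i)" by (rule integral_minus)
    finally show ?thesis by simp
  qed
  interpret H: Hoeffding_ineq "cube_measure n" "{..<n}" X "\<lambda>i. - \<bar>\<beta> i\<bar>" "\<lambda>i. \<bar>\<beta> i\<bar>"
     "\<Sum>i\<in>{..<n}. expectation (X i)"
  proof unfold_locales
    fix i assume i: "i \<in> {..<n}"
    show "AE u in cube_measure n. X i u \<in> {- \<bar>\<beta> i\<bar>..\<bar>\<beta> i\<bar>}"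
    proof (rule eventually_mono[OF rng])
      fix u :: "nat \<Rightarrow> real" assume "u i \<in> {-1..1}"
      then have "\<bar>X i u\<bar> \<le> \<bar>\<beta> i\<bar>" by (auto simp: X_def abs_mult intro!: mult_left_le)
      then show "X i u \<in> {- \<bar>\<beta> i\<bar>..\<bar>\<beta> i\<bar>}" by auto
    qed (use i in simp)
  qed (use ind in auto)
  have sq: "(\<Sum>i\<in>{..<n}. (\<bar>\<beta> i\<bar> - - \<bar>\<beta> i\<bar>)\<^sup>2) = 4 * (\<Sum>i<n. (\<beta> i)\<^sup>2)"
    unfolding sum_distrib_left by (intro sum.cong) (simp_all add: power2_eq_square)
  have "prob {u \<in> space (cube_measure n). s \<le> \<bar>(\<Sum>i<n. X i u) - (\<Sum>i<n. expectation (X i))\<bar>}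
     \<le> 2 * exp (-2 * s\<^sup>2 / (\<Sum>i\<in>{..<n}. (\<bar>\<beta> i\<bar> - - \<bar>\<beta> i\<bar>)\<^sup>2))"
    using \<beta> by (intro H.Hoeffding_ineq_abs_ge s) (simp only: sq mult_pos_pos zero_less_numeral)
  then show ?thesis unfolding sq by (simp add: E0 X_def)
qed


text \<open>
  When all other coordinates are fixed, the slab leaves the \<open>j\<close>-th one an interval
  of length \<open>2 * h / \<bar>k j\<bar>\<close>; Fubini gives the rest.
\<close>

lemma cube_slab:
  fixes k :: "nat \<Rightarrow> real"
  assumes j: "j < n" and kj: "k j \<noteq> 0" and h: "0 < h"
  shows "measure (cube_measure n) {u \<in> space (cube_measure n). \<bar>\<Sum>i<n. k i * u i\<bar> < h} \<le> h / \<bar>k j\<bar>"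
proof -
  interpret prob_space "cube_measure n" by (intro prob_space_PiM prob_space_sym_interval)
  define I where "I = {..<n} - {j}"
  have I: "insert j I = {..<n}" "j \<notin> I" "finite I" using j by (auto simp: I_def)
  interpret J: prob_space "PiM I (\<lambda>_. sym_interval)" by (intro prob_space_PiM prob_space_sym_interval)
  define S where "S = {u \<in> space (cube_measure n). \<bar>\<Sum>i<n. k i * u i\<bar> < h}"
  have [measurable]: "(\<lambda>u. u i) \<in> measurable (cube_measure n) borel" if "i \<in> {..<n}" for i
    using measurable_component_singleton[of i "{..<n}" "\<lambda>_. sym_interval"] that
    by (simp add: measurable_def)
  have S[measurable]: "S \<in> sets (cube_measure n)" unfolding S_def by measurable
  have inner: "(\<integral>\<^sup>+y. indicator S (x(j := y)) \<partial>sym_interval) \<le> ennreal (h / \<bar>k j\<bar>)"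
    if x: "x \<in> space (PiM I (\<lambda>_. sym_interval))" for x
  proof -
    define s where "s = (\<Sum>i\<in>I. k i * x i)"
    define T where "T = {- s / k j - h / \<bar>k j\<bar> .. - s / k j + h / \<bar>k j\<bar>}"
    have "(\<integral>\<^sup>+y. indicator S (x(j := y)) \<partial>sym_interval) \<le> (\<integral>\<^sup>+y. indicator T y \<partial>sym_interval)"
    proof (intro nn_integral_mono)
      fix y
      have "y \<in> T" if "x(j := y) \<in> S"
      proof -
        have "(\<Sum>i<n. k i * (x(j := y)) i) = k j * y + s"
          unfolding I(1)[symmetric] using I(2,3) by (simp add: s_def) (intro sum.cong, auto)
        then have "\<bar>k j * y + s\<bar> < h" using that by (simp add: S_def)
        also have "k j * y + s = k j * (y + s / k j)" using kj by (simp add: field_simps)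
        finally have "\<bar>k j\<bar> * \<bar>y + s / k j\<bar> < h" by (simp only: abs_mult)
        then have "\<bar>y + s / k j\<bar> < h / \<bar>k j\<bar>" using kj by (simp add: field_simps)
        then show ?thesis by (auto simp: T_def abs_less_iff)
      qed
      then show "indicator S (x(j := y)) \<le> (indicator T y :: ennreal)" by (auto simp: indicator_def)
    qed
    also have "\<dots> = emeasure sym_interval T" by (simp add: T_def)
    also have "\<dots> = emeasure lborel ({-1..1} \<inter> T) / 2"
      by (subst emeasure_uniform_measure) (auto simp: T_def)
    also have "\<dots> \<le> emeasure lborel T / 2"
      by (intro divide_right_mono_ennreal emeasure_mono) (auto simp: T_def)
    also have "emeasure lborel T = ennreal (2 * (h / \<bar>k j\<bar>))"
      unfolding T_def using h kj by simp
    also have "\<dots> / 2 = ennreal (h / \<bar>k j\<bar>)"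
      using h divide_ennreal[of "2 * (h / \<bar>k j\<bar>)" 2] by simp
    finally show ?thesis .
  qed
  have "emeasure (cube_measure n) S = (\<integral>\<^sup>+u. indicator S u \<partial>PiM (insert j I) (\<lambda>_. sym_interval))"
    using S by (simp add: I(1))
  also have "\<dots> = (\<integral>\<^sup>+x. (\<integral>\<^sup>+y. indicator S (x(j := y)) \<partial>sym_interval) \<partial>PiM I (\<lambda>_. sym_interval))"
    using I by (intro sym_product.product_nn_integral_insert) (simp_all add: I(1))
  also have "\<dots> \<le> (\<integral>\<^sup>+x. ennreal (h / \<bar>k j\<bar>) \<partial>PiM I (\<lambda>_. sym_interval))"
    by (intro nn_integral_mono inner)
  also have "\<dots> = ennreal (h / \<bar>k j\<bar>)" by (simp add: J.emeasure_space_1)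
  finally show ?thesis using h by (simp add: emeasure_eq_measure S_def[symmetric] ennreal_le_iff)
qed

text \<open>
  Reflection in the origin exchanges the two sides of the slab around the hyperplane
  \<open>k \<bullet> u = 0\<close>.  The slab has measure at most \<open>1 / 8\<close>,
  since one entry of \<open>k\<close> is large, and the second condition fails with probability
  at most \<open>1 / 4\<close>; half of the remaining \<open>5 / 8\<close> exceeds
  \<open>1 / 4\<close>.
\<close>

lemma cube_cap_measure_ge:
  fixes k \<beta> :: "nat \<Rightarrow> real"
  assumes h: "0 < h" and k: "\<exists>i<n. 8 * h \<le> \<bar>k i\<bar>" and s: "0 \<le> s"
    and \<beta>0: "0 < (\<Sum>i<n. (\<beta> i)\<^sup>2)" and \<beta>: "6 * (\<Sum>i<n. (\<beta> i)\<^sup>2) \<le> s\<^sup>2"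
  shows "1 / 4 \<le> measure (cube_measure n)
    {u \<in> space (cube_measure n). h \<le> (\<Sum>i<n. k i * u i) \<and> \<bar>\<Sum>i<n. \<beta> i * u i\<bar> \<le> s}"
proof -
  interpret prob_space "cube_measure n" by (intro prob_space_PiM prob_space_sym_interval)
  let ?Q = "cube_measure n"
  have [measurable]: "(\<lambda>u. u i) \<in> measurable ?Q borel" if "i \<in> {..<n}" for i
    using measurable_component_singleton[of i "{..<n}" "\<lambda>_. sym_interval"] that
    by (simp add: measurable_def)
  define A where "A = {u \<in> space ?Q. h \<le> (\<Sum>i<n. k i * u i) \<and> \<bar>\<Sum>i<n. \<beta> i * u i\<bar> \<le> s}"
  define A' where "A' = {u \<in> space ?Q. (\<Sum>i<n. k i * u i) \<le> - h \<and> \<bar>\<Sum>i<n. \<beta> i * u i\<bar> \<le> s}"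
  define W where "W = {u \<in> space ?Q. \<bar>\<Sum>i<n. k i * u i\<bar> < h}"
  define V where "V = {u \<in> space ?Q. s \<le> \<bar>\<Sum>i<n. \<beta> i * u i\<bar>}"
  have Asets[measurable]: "A \<in> sets ?Q" "A' \<in> sets ?Q" "W \<in> sets ?Q" "V \<in> sets ?Q"
    unfolding A_def A'_def W_def V_def by measurable
  have "prob A = measure (distr ?Q ?Q (\<lambda>u. \<lambda>i\<in>{..<n}. - u i)) A" by (simp only: distr_neg_cube)
  also have "\<dots> = prob ((\<lambda>u. \<lambda>i\<in>{..<n}. - u i) -` A \<inter> space ?Q)"
    by (intro measure_distr measurable_restrict) measurable
  also have "(\<lambda>u. \<lambda>i\<in>{..<n}. - u i) -` A \<inter> space ?Q = A'"
  proof -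
    have "(\<lambda>i\<in>{..<n}. - u i) \<in> A \<longleftrightarrow> u \<in> A'" if u: "u \<in> space ?Q" for u
    proof -
      have "(\<lambda>i\<in>{..<n}. - u i) \<in> space ?Q" by (simp add: space_PiM)
      moreover have "(\<Sum>i<n. k i * (\<lambda>i\<in>{..<n}. - u i) i) = - (\<Sum>i<n. k i * u i)" for k
        by (simp add: sum_negf)
      ultimately show ?thesis using u
        by (simp only: A_def A'_def mem_Collect_eq abs_minus_cancel simp_thms) linarith
    qed
    then show ?thesis using sets.sets_into_space[OF Asets(2)] by blast
  qed
  finally have AA': "prob A' = prob A" ..
  have "1 = prob (space ?Q)" by (simp add: prob_space)
  also have "\<dots> \<le> prob (A \<union> A' \<union> W \<union> V)"
  proof (intro finite_measure_mono subsetI)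
    fix u assume "u \<in> space ?Q"
    moreover have "\<bar>\<Sum>i<n. k i * u i\<bar> < h \<or> h \<le> (\<Sum>i<n. k i * u i) \<or> (\<Sum>i<n. k i * u i) \<le> - h" by linarith
    moreover have "s \<le> \<bar>\<Sum>i<n. \<beta> i * u i\<bar> \<or> \<bar>\<Sum>i<n. \<beta> i * u i\<bar> \<le> s" by linarith
    ultimately show "u \<in> A \<union> A' \<union> W \<union> V" unfolding A_def A'_def W_def V_def by blast
  qed (intro sets.Un Asets)
  also have "\<dots> \<le> prob A + prob A' + prob W + prob V"
    by (intro order_trans[OF measure_Un_le] add_mono) auto
  finally have 1: "1 \<le> 2 * prob A + prob W + prob V" using AA' by simp
  from k obtain j where j: "j < n" "8 * h \<le> \<bar>k j\<bar>" by blast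
  have "prob W \<le> h / \<bar>k j\<bar>" unfolding W_def using j h by (intro cube_slab) auto
  also have "\<dots> \<le> 1 / 8" using j h by (simp add: divide_simps)
  finally have 2: "prob W \<le> 1 / 8" .
  have "prob V \<le> 2 * exp (- s\<^sup>2 / (2 * (\<Sum>i<n. (\<beta> i)\<^sup>2)))"
    unfolding V_def by (rule cube_Hoeffding[OF s \<beta>0])
  also have "\<dots> \<le> 2 * exp (-3)"
    using \<beta> \<beta>0 by (intro mult_left_mono) (simp_all add: field_simps)
  also have "\<dots> \<le> 1 / 4"
  proof -
    have "2 ^ 3 \<le> exp (1::real) ^ 3" using exp_ge_add_one_self[of 1] by (intro power_mono) auto
    also have "\<dots> = exp (3::real)" by (simp add: exp_of_nat_mult[symmetric])
    finally show ?thesis by (simp add: exp_minus field_simps)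
  qed
  finally have 3: "prob V \<le> 1 / 4" .
  from 1 2 3 show ?thesis by (simp add: A_def)
qed

section \<open>Convex hulls of finitely many points\<close>

lemma convex_Rn_open_halfspace: "convex_Rn n {z \<in> Rn n. c < (\<Sum>i<n. a i * z i)}"
proof -
  have "c < (\<Sum>i<n. a i * (u * x i + v * y i))"
    if "c < (\<Sum>i<n. a i * x i)" "c < (\<Sum>i<n. a i * y i)" "0 \<le> u" "0 \<le> v" "u + v = 1"
    for x y :: "nat \<Rightarrow> real" and u v :: real
  proof -
    have "c = u * c + v * c" using that by (simp flip: distrib_right)
    also have "\<dots> < u * (\<Sum>i<n. a i * x i) + v * (\<Sum>i<n. a i * y i)"
    proof (cases "u = 0")
      case False
      then show ?thesis using that by (intro add_less_le_mono mult_strict_left_mono mult_left_mono) auto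
    qed (use that in auto)
    also have "\<dots> = (\<Sum>i<n. a i * (u * x i + v * y i))"
      by (simp add: sum_distrib_left sum.distrib algebra_simps)
    finally show ?thesis .
  qed
  then show ?thesis by (auto simp: convex_Rn_def)
qed

lemma hull_subset_Rn: "S \<subseteq> Rn n \<Longrightarrow> convex_Rn n hull S \<subseteq> Rn n"
  by (rule hull_minimal) (auto simp: convex_Rn_def)

text \<open>
  Otherwise the complementary open half-space, which is convex, would contain all the points
  and hence their hull.
\<close>

lemma halfspace_meets_points:
  assumes X: "\<And>j. j < N \<Longrightarrow> X j \<in> Rn n" and y: "y \<in> convex_Rn n hull (X ` {..<N})"
    and ab: "(\<Sum>i<n. a i * y i) \<le> b"
  shows "\<exists>j<N. (\<Sum>i<n. a i * X j i) \<le> b"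
proof (rule ccontr)
  assume "\<not> ?thesis"
  then have "convex_Rn n hull (X ` {..<N}) \<subseteq> {z \<in> Rn n. b < (\<Sum>i<n. a i * z i)}"
    using X by (intro hull_minimal convex_Rn_open_halfspace) (auto simp: not_le)
  with y ab show False by auto
qed

text \<open>
  Jensen's form of convexity, by splitting off one point at a time and renormalising the other
  weights.
\<close>

lemma convex_Rn_sum:
  assumes T: "convex_Rn n T" and "finite J" and "\<And>j. j \<in> J \<Longrightarrow> X j \<in> T"
    and "\<And>j. j \<in> J \<Longrightarrow> 0 \<le> l j" and "sum l J = 1"
  shows "(\<lambda>i\<in>{..<n}. \<Sum>j\<in>J. l j * X j i) \<in> T"
  using assms(2-)
proof (induction J arbitrary: l rule: finite_induct)
  case (insert k J)
  have s: "l k + sum l J = 1" using insert by simp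
  show ?case
  proof (cases "sum l J = 0")
    case True
    then have "l j = 0" if "j \<in> J" for j using insert that by (simp add: sum_nonneg_eq_0_iff)
    moreover have "X k \<in> Rn n" using T insert.prems by (auto simp: convex_Rn_def)
    ultimately have "(\<lambda>i\<in>{..<n}. \<Sum>j\<in>insert k J. l j * X j i) = X k"
      using s True insert.hyps by (auto simp: fun_eq_iff PiE_def extensional_def)
    then show ?thesis using insert by simp
  next
    case False
    define v where "v = sum l J"
    have v: "v > 0" using False sum_nonneg[of J l] insert.prems by (force simp: v_def)
    have z: "(\<lambda>i\<in>{..<n}. \<Sum>j\<in>J. (l j / v) * X j i) \<in> T" (is "?z \<in> T")
      by (rule insert.IH) (use insert.prems v in \<open>auto simp: v_def simp flip: sum_divide_distrib\<close>)
    have "X k \<in> T" "0 \<le> l k" using insert.prems by simp_all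
    moreover have "0 \<le> v" "l k + v = 1" using v s by (simp_all add: v_def)
    ultimately have "(\<lambda>i\<in>{..<n}. l k * X k i + v * ?z i) \<in> T"
      using T z unfolding convex_Rn_def by blast
    also have "(\<lambda>i\<in>{..<n}. l k * X k i + v * ?z i) = (\<lambda>i\<in>{..<n}. \<Sum>j\<in>insert k J. l j * X j i)"
      using v insert.hyps by (intro restrict_ext) (simp add: sum_distrib_left)
    finally show ?thesis .
  qed
qed simp

text \<open>
  The weights beyond \<open>N\<close> are fixed to 0, so that the simplex is a closed subset of
  a product of compact intervals and Tychonoff's theorem applies.
\<close>

lemma compact_simplex:
  "compact {l :: nat \<Rightarrow> real. (\<forall>j. l j \<in> (if j < N then {0..1} else {0})) \<and> (\<Sum>j<N. l j) = 1}"
proof -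
  have "compactin (product_topology (\<lambda>_. euclidean) UNIV)
          (PiE UNIV (\<lambda>j. if j < N then {0..1::real} else {0}))"
    unfolding compactin_PiE by (auto simp: compactin_euclidean_iff)
  then have "compact (PiE UNIV (\<lambda>j. if j < N then {0..1::real} else {0}))"
    by (simp add: euclidean_product_topology compactin_euclidean_iff)
  moreover have "closed {l :: nat \<Rightarrow> real. (\<Sum>j<N. l j) = 1}"
    by (intro closed_Collect_eq continuous_intros) simp_all
  ultimately have "compact (PiE UNIV (\<lambda>j. if j < N then {0..1::real} else {0}) \<inter> {l. (\<Sum>j<N. l j) = 1})"
    by (rule compact_Int_closed)
  also have "PiE UNIV (\<lambda>j. if j < N then {0..1::real} else {0}) \<inter> {l. (\<Sum>j<N. l j) = 1}
     = {l. (\<forall>j. l j \<in> (if j < N then {0..1} else {0})) \<and> (\<Sum>j<N. l j) = 1}"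
    by (intro set_eqI) (simp only: PiE_iff Int_iff mem_Collect_eq extensional_UNIV UNIV_I ball_UNIV simp_thms)
  finally show ?thesis .
qed

text \<open>
  The separating direction points from \<open>y\<close> to its nearest point among the convex
  combinations of the \<open>X j\<close>.  A nearest point exists because the simplex of
  weights is compact, and minimality under small moves towards \<open>X k\<close> gives the
  sign.
\<close>

lemma not_in_hull_separated:
  fixes X :: "nat \<Rightarrow> nat \<Rightarrow> real"
  assumes N: "1 \<le> N" and X: "\<And>j. j < N \<Longrightarrow> X j \<in> Rn n" and y: "y \<in> Rn n"
    and nin: "y \<notin> convex_Rn n hull (X ` {..<N})"
  shows "\<exists>a. \<forall>k<N. 0 < (\<Sum>i<n. a i * (X k i - y i))"
proof -
  define D where "D = {l :: nat \<Rightarrow> real. (\<forall>j. l j \<in> (if j < N then {0..1} else {0})) \<and> (\<Sum>j<N. l j) = 1}"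
  define f where "f l = (\<Sum>i<n. ((\<Sum>j<N. l j * X j i) - y i)\<^sup>2)" for l :: "nat \<Rightarrow> real"
  have "(\<lambda>j. if j = 0 then 1 else 0) \<in> D" using N by (auto simp: D_def)
  then have Dne: "D \<noteq> {}" by blast
  have "compact D" unfolding D_def by (rule compact_simplex)
  moreover have "continuous_on D f"
    unfolding f_def by (intro continuous_intros continuous_on_subset[OF continuous_on_product_coordinates]) simp_all
  ultimately have "\<exists>l\<in>D. \<forall>l'\<in>D. f l \<le> f l'"
    using Dne by (intro continuous_attains_inf)
  then obtain l where l: "l \<in> D" and lmin: "\<And>l'. l' \<in> D \<Longrightarrow> f l \<le> f l'" by auto
  have l0: "0 \<le> l j" "l j \<le> 1" for j using l by (auto simp: D_def split: if_splits dest!: spec[of _ j])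
  define d where "d i = (\<Sum>j<N. l j * X j i) - y i" for i
  have dpos: "0 < (\<Sum>i<n. (d i)\<^sup>2)"
  proof (rule ccontr)
    assume "\<not> ?thesis"
    then have "(\<Sum>i<n. (d i)\<^sup>2) = 0" using sum_nonneg[of "{..<n}" "\<lambda>i. (d i)\<^sup>2"] by simp
    then have "d i = 0" if "i < n" for i using that by (simp add: sum_nonneg_eq_0_iff)
    then have "y = (\<lambda>i\<in>{..<n}. \<Sum>j<N. l j * X j i)"
      using y by (auto simp: d_def fun_eq_iff PiE_def extensional_def)
    moreover have "(\<lambda>i\<in>{..<n}. \<Sum>j<N. l j * X j i) \<in> convex_Rn n hull (X ` {..<N})"
      unfolding hull_def
    proof (intro InterI convex_Rn_sum)
      fix T assume "T \<in> {t. convex_Rn n t \<and> X ` {..<N} \<subseteq> t}"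
      then show "convex_Rn n T" "\<And>j. j \<in> {..<N} \<Longrightarrow> X j \<in> T" by auto
    qed (use l l0 in \<open>auto simp: D_def\<close>)
    ultimately show False using nin by simp
  qed
  \<comment> \<open>The vector \<open>d\<close> leads from \<open>y\<close> to the nearest
    point; \<open>e\<close> leads from the nearest point to \<open>X k\<close>.\<close>
  have "0 < (\<Sum>i<n. d i * (X k i - y i))" if k: "k < N" for k
  proof -
    define e where "e i = X k i - y i - d i" for i
    define E where "E = (\<Sum>i<n. (e i)\<^sup>2)"
    define F where "F = (\<Sum>i<n. d i * e i)"
    have *: "0 \<le> 2 * F + s * E" if s: "0 < s" "s \<le> 1" for s
    proof -
      define l' where "l' j = (1 - s) * l j + s * (if j = k then 1 else 0)" for j
      have sum': "(\<Sum>j<N. l' j * g j) = (1 - s) * (\<Sum>j<N. l j * g j) + s * g k" for g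
      proof -
        have "l' j * g j = (1 - s) * (l j * g j) + (if j = k then s * g k else 0)" for j
          by (simp add: l'_def algebra_simps)
        then show ?thesis using k by (simp add: sum.distrib sum_distrib_left[symmetric])
      qed
      have "l' \<in> D"
      proof -
        have "(\<Sum>j<N. l' j) = 1" using sum'[of "\<lambda>_. 1"] l by (simp add: D_def)
        moreover have "0 \<le> l' j" "l' j \<le> 1" for j
          using s l0[of j] convex_bound_le[of "l j" 1 "if j = k then 1 else 0" "1 - s" s]
          by (auto simp: l'_def)
        moreover have "l' j = 0" if "\<not> j < N" for j
          using l that k by (auto simp: l'_def D_def dest!: spec[of _ j])
        ultimately show ?thesis by (auto simp: D_def)
      qed
      then have "f l \<le> f l'" by (rule lmin)
      also have "f l' = (\<Sum>i<n. (d i + s * e i)\<^sup>2)"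
        unfolding f_def sum' by (intro sum.cong) (auto simp: d_def e_def algebra_simps)
      also have "\<dots> = f l + s * (2 * F + s * E)"
      proof -
        have "(d i + s * e i)\<^sup>2 = (d i)\<^sup>2 + s * (2 * (d i * e i) + s * (e i)\<^sup>2)" for i
          by (simp add: power2_eq_square algebra_simps)
        then show ?thesis
          by (simp add: f_def E_def F_def d_def[symmetric] sum.distrib sum_distrib_left[symmetric])
      qed
      finally show ?thesis using s by (simp add: zero_le_mult_iff)
    qed
    have "0 \<le> F"
    proof (rule ccontr)
      assume F: "\<not> 0 \<le> F"
      have E: "0 \<le> E" by (simp add: E_def sum_nonneg)
      \<comment> \<open>If \<open>F\<close> were negative, a step of this length would decrease
        the distance.\<close>
      have "0 \<le> 2 * F + min 1 (- F / (E + 1)) * E"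
        using F E by (intro *) (simp_all add: divide_neg_pos)
      also have "min 1 (- F / (E + 1)) * E \<le> (- F / (E + 1)) * E"
        using E by (intro mult_right_mono) auto
      also have "\<dots> \<le> - F"
        using F E by (simp add: field_simps)
      finally show False using F by simp
    qed
    moreover have "(\<Sum>i<n. d i * (X k i - y i)) = F + (\<Sum>i<n. (d i)\<^sup>2)"
    proof -
      have "d i * (X k i - y i) = d i * e i + (d i)\<^sup>2" for i
        by (simp add: e_def power2_eq_square algebra_simps)
      then show ?thesis by (simp add: F_def sum.distrib)
    qed
    ultimately show ?thesis using dpos by simp
  qed
  then show ?thesis by blast
qed

text \<open>
  Finitely many strict inequalities survive a small perturbation of the normal.  Rational
  normals form a countable set, which is what makes membership in a random hull measurable.
\<close>

lemma rational_separation: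
  fixes X :: "nat \<Rightarrow> nat \<Rightarrow> real"
  assumes "\<forall>k<N. 0 < (\<Sum>i<n. a i * (X k i - y i :: real))"
  shows "\<exists>b \<in> {..<n} \<rightarrow>\<^sub>E \<rat>. \<forall>k<N. (\<Sum>i<n. b i * y i) < (\<Sum>i<n. b i * X k i)"
proof (cases "N = 0")
  case True
  have "(\<lambda>i\<in>{..<n}. 0) \<in> {..<n} \<rightarrow>\<^sub>E (\<rat> :: real set)" by auto
  then show ?thesis using True by blast
next
  case False
  define s where "s k = (\<Sum>i<n. a i * (X k i - y i))" for k
  define V where "V = 1 + (\<Sum>k<N. \<Sum>i<n. \<bar>X k i - y i\<bar>)"
  define m where "m = Min (s ` {..<N})"
  have m: "0 < m" "\<And>k. k < N \<Longrightarrow> m \<le> s k"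
  proof -
    show "m \<le> s k" if "k < N" for k unfolding m_def using that by (intro Min_le) auto
    have "m \<in> s ` {..<N}" unfolding m_def using False by (intro Min_in) auto
    then show "0 < m" using assms by (auto simp: s_def)
  qed
  have V: "(\<Sum>i<n. \<bar>X k i - y i\<bar>) < V" if "k < N" for k
    using member_le_sum[of k "{..<N}" "\<lambda>k. \<Sum>i<n. \<bar>X k i - y i\<bar>"] that by (auto simp: V_def sum_nonneg)
  have V0: "0 < V" by (simp add: V_def add_pos_nonneg sum_nonneg)
  have "\<exists>q\<in>\<rat>. a i < q \<and> q < a i + m / V" for i
    using m V0 by (intro Rats_dense_in_real) simp
  then obtain q where q: "\<And>i. q i \<in> \<rat>" "\<And>i. a i < q i" "\<And>i. q i < a i + m / V" by metis
  have "(\<Sum>i<n. q i * y i) < (\<Sum>i<n. q i * X k i)" if k: "k < N" for k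
  proof -
    have "\<bar>\<Sum>i<n. (q i - a i) * (X k i - y i)\<bar> \<le> (\<Sum>i<n. (m / V) * \<bar>X k i - y i\<bar>)"
    proof (intro order_trans[OF sum_abs] sum_mono)
      fix i
      have "\<bar>q i - a i\<bar> \<le> m / V" using q(2)[of i] q(3)[of i] by simp
      then show "\<bar>(q i - a i) * (X k i - y i)\<bar> \<le> m / V * \<bar>X k i - y i\<bar>"
        by (simp only: abs_mult) (intro mult_right_mono, auto)
    qed
    also have "\<dots> < (m / V) * V"
      unfolding sum_distrib_left[symmetric] using V[OF k] m V0 by (intro mult_strict_left_mono) auto
    also have "\<dots> = m" using V0 by simp
    finally have "0 < s k + (\<Sum>i<n. (q i - a i) * (X k i - y i))" using m(2)[OF k] by linarith
    also have "\<dots> = (\<Sum>i<n. q i * (X k i - y i))"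
      unfolding s_def sum.distrib[symmetric] by (intro sum.cong) (auto simp: algebra_simps)
    finally show ?thesis by (simp add: right_diff_distrib sum_subtractf)
  qed
  then have "\<forall>k<N. (\<Sum>i<n. (\<lambda>i\<in>{..<n}. q i) i * y i) < (\<Sum>i<n. (\<lambda>i\<in>{..<n}. q i) i * X k i)" by simp
  moreover have "(\<lambda>i\<in>{..<n}. q i) \<in> {..<n} \<rightarrow>\<^sub>E \<rat>" using q by auto
  ultimately show ?thesis by blast
qed

lemma not_in_hull_iff:
  fixes X :: "nat \<Rightarrow> nat \<Rightarrow> real"
  assumes N: "1 \<le> N" and X: "\<And>j. j < N \<Longrightarrow> X j \<in> Rn n" and y: "y \<in> Rn n"
  shows "y \<notin> convex_Rn n hull (X ` {..<N}) \<longleftrightarrow>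
    (\<exists>b \<in> {..<n} \<rightarrow>\<^sub>E \<rat>. \<forall>k<N. (\<Sum>i<n. b i * y i) < (\<Sum>i<n. b i * X k i))"
proof
  assume "y \<notin> convex_Rn n hull (X ` {..<N})"
  from rational_separation[of N] not_in_hull_separated[OF N X y this]
  show "\<exists>b \<in> {..<n} \<rightarrow>\<^sub>E \<rat>. \<forall>k<N. (\<Sum>i<n. b i * y i) < (\<Sum>i<n. b i * X k i)" by blast
next
  assume "\<exists>b \<in> {..<n} \<rightarrow>\<^sub>E \<rat>. \<forall>k<N. (\<Sum>i<n. b i * y i) < (\<Sum>i<n. b i * X k i)"
  then show "y \<notin> convex_Rn n hull (X ` {..<N})"
  proof (elim bexE, intro notI)
    fix b assume b: "\<forall>k<N. (\<Sum>i<n. b i * y i) < (\<Sum>i<n. b i * X k i)"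
      and "y \<in> convex_Rn n hull (X ` {..<N})"
    then have "\<exists>j<N. (\<Sum>i<n. b i * X j i) \<le> (\<Sum>i<n. b i * y i)"
      by (intro halfspace_meets_points X) auto
    with b show False by force
  qed
qed

section \<open>The expected measure of a random hull\<close>

lemma space_Rn_measure:
  assumes "sets \<mu> = sets (lborel_Rn n)"
  shows "space \<mu> = Rn n"
  using sets_eq_imp_space_eq[OF assms] by (simp add: space_PiM)

lemma measurable_coordinate:
  assumes \<mu>: "sets \<mu> = sets (lborel_Rn n)" and i: "i < n"
  shows "(\<lambda>x. x i) \<in> borel_measurable \<mu>"
proof -
  have "(\<lambda>x. x i) \<in> measurable (lborel_Rn n) lborel"
    using i by (intro measurable_component_singleton) auto
  then show ?thesis using measurable_cong_sets[OF \<mu> sets_lborel] by (metis measurable_lborel1 measurable_cong_sets \<mu>)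
qed

lemma halfspace_sets:
  assumes \<mu>: "sets \<mu> = sets (lborel_Rn n)"
  shows "{x \<in> Rn n. (\<Sum>i<n. a i * x i) \<le> b} \<in> sets \<mu>"
proof -
  have [measurable]: "(\<lambda>x. x i) \<in> borel_measurable \<mu>" if "i \<in> {..<n}" for i
    using measurable_coordinate[OF \<mu>] that by simp
  have "{x \<in> space \<mu>. (\<Sum>i<n. a i * x i) \<le> b} \<in> sets \<mu>" by measurable
  then show ?thesis using space_Rn_measure[OF \<mu>] by simp
qed

text \<open>
  The complement is a countable union, over rational normals \<open>b\<close>, of sets
  described by finitely many measurable inequalities.  The Bochner integral of a function that
  is not measurable would be 0, so the lower bound for the expected measure depends on this
  lemma.
\<close>

lemma hull_pairs_measurable:
  fixes N :: nat
  assumes \<mu>: "sets \<mu> = sets (lborel_Rn n)" and N: "1 \<le> N"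
  shows "{\<omega> \<in> space (PiM {..<N} (\<lambda>_. \<mu>) \<Otimes>\<^sub>M \<mu>). snd \<omega> \<in> convex_Rn n hull (fst \<omega> ` {..<N})}
    \<in> sets (PiM {..<N} (\<lambda>_. \<mu>) \<Otimes>\<^sub>M \<mu>)" (is "?S \<in> sets ?P")
proof -
  note sp = space_Rn_measure[OF \<mu>]
  have [measurable]: "(\<lambda>x. x i) \<in> borel_measurable \<mu>" if "i \<in> {..<n}" for i
    using measurable_coordinate[OF \<mu>] that by simp
  have X[measurable]: "(\<lambda>\<omega>. fst \<omega> k i) \<in> borel_measurable ?P" if "i \<in> {..<n}" "k \<in> {..<N}" for i k
  proof -
    have "(\<lambda>\<omega>. fst \<omega> k) \<in> measurable ?P \<mu>" using that by measurable
    from measurable_compose[OF this measurable_coordinate[OF \<mu>, of i]] that show ?thesis by simp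
  qed
  have Y[measurable]: "(\<lambda>\<omega>. snd \<omega> i) \<in> borel_measurable ?P" if "i \<in> {..<n}" for i
    using measurable_compose[OF measurable_snd measurable_coordinate[OF \<mu>, of i]] that by simp
  define B :: "(nat \<Rightarrow> real) set" where "B = ({..<n} \<rightarrow>\<^sub>E \<rat>)"
  have "countable B" unfolding B_def by (intro countable_PiE) (auto intro: countable_rat)
  then have "(\<Union>b\<in>B. {\<omega> \<in> space ?P. \<forall>k\<in>{..<N}. (\<Sum>i<n. b i * snd \<omega> i) < (\<Sum>i<n. b i * fst \<omega> k i)}) \<in> sets ?P"
    by (intro sets.countable_UN' image_subsetI) measurable
  then have "space ?P - (\<Union>b\<in>B. {\<omega> \<in> space ?P. \<forall>k\<in>{..<N}. (\<Sum>i<n. b i * snd \<omega> i) < (\<Sum>i<n. b i * fst \<omega> k i)}) \<in> sets ?P"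
    by (rule sets.compl_sets)
  also have "space ?P - (\<Union>b\<in>B. {\<omega> \<in> space ?P. \<forall>k\<in>{..<N}. (\<Sum>i<n. b i * snd \<omega> i) < (\<Sum>i<n. b i * fst \<omega> k i)}) = ?S"
  proof -
    have "\<omega> \<in> ?S \<longleftrightarrow> \<not> (\<exists>b\<in>B. \<forall>k\<in>{..<N}. (\<Sum>i<n. b i * snd \<omega> i) < (\<Sum>i<n. b i * fst \<omega> k i))"
      if \<omega>: "\<omega> \<in> space ?P" for \<omega>
    proof -
      have "fst \<omega> j \<in> Rn n" if "j < N" for j
        using \<omega> that sp by (auto simp: space_pair_measure space_PiM PiE_def Pi_def)
      moreover have "snd \<omega> \<in> Rn n" using \<omega> sp by (auto simp: space_pair_measure)
      ultimately show ?thesis using not_in_hull_iff[OF N, of "fst \<omega>" n "snd \<omega>"] \<omega> by (auto simp: B_def)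
    qed
    then show ?thesis by blast
  qed
  finally show ?thesis .
qed

text \<open>
  Fubini: the mean measure of the hull is the average over \<open>y\<close> of the probability
  that the hull contains \<open>y\<close>.
\<close>

lemma expected_hull_measure_eq:
  assumes p: "prob_space \<mu>" and \<mu>: "sets \<mu> = sets (lborel_Rn n)" and N: "1 \<le> N"
  shows "ennreal (expected_hull_measure n \<mu> N) =
    (\<integral>\<^sup>+y. emeasure (PiM {..<N} (\<lambda>_. \<mu>))
       {X \<in> space (PiM {..<N} (\<lambda>_. \<mu>)). y \<in> convex_Rn n hull (X ` {..<N})} \<partial>\<mu>)"
proof -
  interpret prob_space \<mu> by fact
  interpret P: prob_space "PiM {..<N} (\<lambda>_. \<mu>)" by (intro prob_space_PiM p)
  interpret PP: product_prob_space "\<lambda>_::nat. \<mu>" "{..<N}" ..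
  interpret PS: pair_sigma_finite "PiM {..<N} (\<lambda>_. \<mu>)" \<mu> ..
  let ?P = "PiM {..<N} (\<lambda>_. \<mu>)"
  define S where "S = {\<omega> \<in> space (?P \<Otimes>\<^sub>M \<mu>). snd \<omega> \<in> convex_Rn n hull (fst \<omega> ` {..<N})}"
  have S: "S \<in> sets (?P \<Otimes>\<^sub>M \<mu>)" unfolding S_def by (rule hull_pairs_measurable[OF \<mu> N])
  have sec: "Pair X -` S = convex_Rn n hull (X ` {..<N})" if X: "X \<in> space ?P" for X
  proof -
    have "X ` {..<N} \<subseteq> Rn n" using X space_Rn_measure[OF \<mu>] by (auto simp: space_PiM PiE_def Pi_def)
    from hull_subset_Rn[OF this] show ?thesis
      using X space_Rn_measure[OF \<mu>] by (auto simp: S_def space_pair_measure)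
  qed
  have m: "(\<lambda>X. measure \<mu> (Pair X -` S)) \<in> borel_measurable ?P"
    unfolding measure_def using measurable_emeasure_Pair[OF S] by measurable
  have "expected_hull_measure n \<mu> N = (\<integral>X. measure \<mu> (Pair X -` S) \<partial>?P)"
    unfolding expected_hull_measure_def by (intro Bochner_Integration.integral_cong) (simp_all add: sec)
  also have "ennreal \<dots> = (\<integral>\<^sup>+X. ennreal (measure \<mu> (Pair X -` S)) \<partial>?P)"
    by (intro nn_integral_eq_integral[symmetric] P.integrable_const_bound[where B=1] m) auto
  also have "\<dots> = (\<integral>\<^sup>+X. emeasure \<mu> (Pair X -` S) \<partial>?P)"
    by (simp add: emeasure_eq_measure)
  also have "\<dots> = emeasure (?P \<Otimes>\<^sub>M \<mu>) S"
    using S by (simp add: emeasure_pair_measure_alt)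
  also have "\<dots> = (\<integral>\<^sup>+y. emeasure ?P ((\<lambda>x. (x, y)) -` S) \<partial>\<mu>)"
    by (rule PS.emeasure_pair_measure_alt2[OF S])
  also have "\<dots> = (\<integral>\<^sup>+y. emeasure ?P {X \<in> space ?P. y \<in> convex_Rn n hull (X ` {..<N})} \<partial>\<mu>)"
    by (intro nn_integral_cong arg_cong2[where f=emeasure]) (auto simp: S_def space_pair_measure)
  finally show ?thesis .
qed

lemma hull_event_measurable:
  fixes N :: nat
  assumes \<mu>: "sets \<mu> = sets (lborel_Rn n)" and N: "1 \<le> N" and y: "y \<in> Rn n"
  shows "{X \<in> space (PiM {..<N} (\<lambda>_. \<mu>)). y \<in> convex_Rn n hull (X ` {..<N})} \<in> sets (PiM {..<N} (\<lambda>_. \<mu>))"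
proof -
  have "(\<lambda>x. (x, y)) -` {\<omega> \<in> space (PiM {..<N} (\<lambda>_. \<mu>) \<Otimes>\<^sub>M \<mu>). snd \<omega> \<in> convex_Rn n hull (fst \<omega> ` {..<N})} \<in> sets (PiM {..<N} (\<lambda>_. \<mu>))"
    by (rule sets_Pair2[OF hull_pairs_measurable[OF \<mu> N]])
  also have "(\<lambda>x. (x, y)) -` {\<omega> \<in> space (PiM {..<N} (\<lambda>_. \<mu>) \<Otimes>\<^sub>M \<mu>). snd \<omega> \<in> convex_Rn n hull (fst \<omega> ` {..<N})}
      = {X \<in> space (PiM {..<N} (\<lambda>_. \<mu>)). y \<in> convex_Rn n hull (X ` {..<N})}"
    using y space_Rn_measure[OF \<mu>] by (auto simp: space_pair_measure)
  finally show ?thesis .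
qed

text \<open>
  If the hull contains \<open>y\<close>, then each half-space around \<open>y\<close> contains
  one of the \<open>N\<close> sample points; take a half-space of small measure and the union
  bound.
\<close>

lemma expected_hull_measure_le:
  assumes p: "prob_space \<mu>" and \<mu>: "sets \<mu> = sets (lborel_Rn n)" and N: "1 \<le> N"
    and G: "G \<in> sets \<mu>" and s: "0 \<le> s"
    and depth: "\<And>y. y \<in> G \<Longrightarrow> \<exists>H\<in>halfspaces n. y \<in> H \<and> measure \<mu> H \<le> s"
  shows "expected_hull_measure n \<mu> N \<le> measure \<mu> (space \<mu> - G) + real N * s"
proof -
  interpret prob_space \<mu> by fact
  interpret P: prob_space "PiM {..<N} (\<lambda>_. \<mu>)" by (intro prob_space_PiM p)
  interpret PP: product_prob_space "\<lambda>_::nat. \<mu>" "{..<N}" ..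
  let ?P = "PiM {..<N} (\<lambda>_. \<mu>)"
  have *: "emeasure ?P {X \<in> space ?P. y \<in> convex_Rn n hull (X ` {..<N})} \<le> ennreal (real N * s)"
    if y: "y \<in> G" for y
  proof -
    from depth[OF y] obtain a b where yH: "(\<Sum>i<n. a i * y i) \<le> b"
      and H: "measure \<mu> {x \<in> Rn n. (\<Sum>i<n. a i * x i) \<le> b} \<le> s"
      by (auto simp: halfspaces_def)
    define H where "H = {x \<in> Rn n. (\<Sum>i<n. a i * x i) \<le> b}"
    have Hs: "H \<in> sets \<mu>" unfolding H_def by (rule halfspace_sets[OF \<mu>])
    have "{X \<in> space ?P. y \<in> convex_Rn n hull (X ` {..<N})} \<subseteq> (\<Union>j\<in>{..<N}. {X \<in> space ?P. X j \<in> H})"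
    proof (intro subsetI)
      fix X assume X: "X \<in> {X \<in> space ?P. y \<in> convex_Rn n hull (X ` {..<N})}"
      then have "X j \<in> Rn n" if "j < N" for j
        using that space_Rn_measure[OF \<mu>] by (auto simp: space_PiM PiE_def Pi_def)
      with halfspace_meets_points[of N X n y a b] X yH
      show "X \<in> (\<Union>j\<in>{..<N}. {X \<in> space ?P. X j \<in> H})" by (auto simp: H_def)
    qed
    moreover have ev: "{X \<in> space ?P. X j \<in> H} \<in> sets ?P" if "j < N" for j
    proof -
      have "(\<lambda>X. X j) \<in> measurable ?P \<mu>" using that by (intro measurable_component_singleton) auto
      from measurable_sets[OF this Hs] show ?thesis by (simp add: vimage_def Int_def conj_commute)
    qed
    ultimately have "emeasure ?P {X \<in> space ?P. y \<in> convex_Rn n hull (X ` {..<N})}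
        \<le> emeasure ?P (\<Union>j\<in>{..<N}. {X \<in> space ?P. X j \<in> H})"
      using ev by (intro emeasure_mono) auto
    also have "\<dots> \<le> (\<Sum>j<N. emeasure ?P {X \<in> space ?P. X j \<in> H})"
      using ev by (intro emeasure_subadditive_finite) auto
    also have "\<dots> = (\<Sum>j<N. emeasure \<mu> H)"
      using Hs by (intro sum.cong PP.emeasure_PiM_Collect_single) auto
    also have "\<dots> = ennreal (real N * measure \<mu> H)"
      by (simp add: emeasure_eq_measure ennreal_mult ennreal_of_nat_eq_real_of_nat)
    also have "\<dots> \<le> ennreal (real N * s)" using H by (intro ennreal_leI mult_left_mono) (auto simp: H_def)
    finally show ?thesis .
  qed
  have "ennreal (expected_hull_measure n \<mu> N)
     \<le> (\<integral>\<^sup>+y. indicator (space \<mu> - G) y + ennreal (real N * s) \<partial>\<mu>)"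
    unfolding expected_hull_measure_eq[OF p \<mu> N]
  proof (intro nn_integral_mono)
    fix y assume y: "y \<in> space \<mu>"
    show "emeasure ?P {X \<in> space ?P. y \<in> convex_Rn n hull (X ` {..<N})}
        \<le> indicator (space \<mu> - G) y + ennreal (real N * s)"
    proof (cases "y \<in> G")
      case False
      then show ?thesis using y P.emeasure_le_1 by (simp add: add_increasing2)
    qed (use * in simp)
  qed
  also have "\<dots> = ennreal (measure \<mu> (space \<mu> - G) + real N * s)"
    using G s by (subst nn_integral_add) (auto simp: emeasure_space_1 emeasure_eq_measure prob_space)
  finally show ?thesis using s by (subst (asm) ennreal_le_iff) auto
qed

lemma expected_hull_measure_ge:
  fixes \<eta> :: real
  assumes p: "prob_space \<mu>" and \<mu>: "sets \<mu> = sets (lborel_Rn n)" and N: "1 \<le> N"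
    and G: "G \<in> sets \<mu>" and \<eta>: "0 \<le> \<eta>"
    and miss: "\<And>y. y \<in> G \<Longrightarrow> measure (PiM {..<N} (\<lambda>_. \<mu>))
       {X \<in> space (PiM {..<N} (\<lambda>_. \<mu>)). y \<notin> convex_Rn n hull (X ` {..<N})} \<le> \<eta>"
  shows "expected_hull_measure n \<mu> N \<ge> measure \<mu> G - \<eta>"
proof -
  interpret prob_space \<mu> by fact
  interpret P: prob_space "PiM {..<N} (\<lambda>_. \<mu>)" by (intro prob_space_PiM p)
  interpret PP: product_prob_space "\<lambda>_::nat. \<mu>" "{..<N}" ..
  let ?P = "PiM {..<N} (\<lambda>_. \<mu>)"
  have *: "emeasure ?P {X \<in> space ?P. y \<in> convex_Rn n hull (X ` {..<N})} \<ge> ennreal (1 - \<eta>)"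
    if y: "y \<in> G" for y
  proof -
    have "y \<in> Rn n" using y G sets.sets_into_space[OF G] space_Rn_measure[OF \<mu>] by auto
    from P.prob_compl[OF hull_event_measurable[OF \<mu> N this]]
    have "measure ?P {X \<in> space ?P. y \<in> convex_Rn n hull (X ` {..<N})}
       = 1 - measure ?P (space ?P - {X \<in> space ?P. y \<in> convex_Rn n hull (X ` {..<N})})" by simp
    also have "space ?P - {X \<in> space ?P. y \<in> convex_Rn n hull (X ` {..<N})}
       = {X \<in> space ?P. y \<notin> convex_Rn n hull (X ` {..<N})}" by auto
    finally show ?thesis using miss[OF y] by (auto simp: P.emeasure_eq_measure intro!: ennreal_leI)
  qed
  have e0: "0 \<le> expected_hull_measure n \<mu> N"
    unfolding expected_hull_measure_def by (intro integral_nonneg_AE) auto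
  have "ennreal (1 - \<eta>) * emeasure \<mu> G = (\<integral>\<^sup>+y. ennreal (1 - \<eta>) * indicator G y \<partial>\<mu>)"
    using G by (simp add: nn_integral_cmult_indicator)
  also have "\<dots> \<le> ennreal (expected_hull_measure n \<mu> N)"
    unfolding expected_hull_measure_eq[OF p \<mu> N]
    by (intro nn_integral_mono) (auto simp: indicator_def *)
  finally have "ennreal (max 0 (1 - \<eta>) * measure \<mu> G) \<le> ennreal (expected_hull_measure n \<mu> N)"
    by (simp add: emeasure_eq_measure ennreal_mult' max_def ennreal_neg split: if_splits)
  then have "max 0 (1 - \<eta>) * measure \<mu> G \<le> expected_hull_measure n \<mu> N"
    using e0 by (simp add: ennreal_le_iff)
  moreover have "measure \<mu> G - \<eta> \<le> (1 - \<eta>) * measure \<mu> G"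
    using \<eta> mult_left_mono[of "measure \<mu> G" 1 \<eta>] by (simp add: algebra_simps)
  moreover have "(1 - \<eta>) * measure \<mu> G \<le> max 0 (1 - \<eta>) * measure \<mu> G"
    by (intro mult_right_mono) auto
  ultimately show ?thesis by linarith
qed

text \<open>
  If \<open>y\<close> is outside the hull, a hyperplane through \<open>y\<close> has all sample
  points strictly on one side.  By \<open>net\<close> one region of the finite family
  \<open>F\<close> lies on the other side and hence contains no sample point.
\<close>

lemma hull_miss_probability_le:
  fixes m :: real
  assumes p: "prob_space \<mu>" and \<mu>: "sets \<mu> = sets (lborel_Rn n)" and N: "1 \<le> N"
    and y: "y \<in> Rn n" and F: "finite F" and m: "m \<le> 1"
    and FR: "\<And>R. R \<in> F \<Longrightarrow> R \<in> sets \<mu> \<and> m \<le> measure \<mu> R"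
    and net: "\<And>a. \<exists>i<n. a i \<noteq> 0 \<Longrightarrow> \<exists>R\<in>F. \<forall>z\<in>R. (\<Sum>i<n. a i * (z i - y i)) \<le> 0"
  shows "measure (PiM {..<N} (\<lambda>_. \<mu>))
       {X \<in> space (PiM {..<N} (\<lambda>_. \<mu>)). y \<notin> convex_Rn n hull (X ` {..<N})} \<le> real (card F) * (1 - m) ^ N"
proof -
  interpret prob_space \<mu> by fact
  interpret P: prob_space "PiM {..<N} (\<lambda>_. \<mu>)" by (intro prob_space_PiM p)
  interpret PP: product_prob_space "\<lambda>_::nat. \<mu>" "{..<N}" ..
  let ?P = "PiM {..<N} (\<lambda>_. \<mu>)"
  have box: "PiE {..<N} (\<lambda>_. space \<mu> - R) \<in> sets ?P" if "R \<in> F" for R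
    using FR[OF that] by (intro sets_PiM_I_finite) auto
  have "{X \<in> space ?P. y \<notin> convex_Rn n hull (X ` {..<N})} \<subseteq> (\<Union>R\<in>F. PiE {..<N} (\<lambda>_. space \<mu> - R))"
  proof (intro subsetI)
    fix X assume X: "X \<in> {X \<in> space ?P. y \<notin> convex_Rn n hull (X ` {..<N})}"
    then have Xj: "X j \<in> Rn n" if "j < N" for j
      using that space_Rn_measure[OF \<mu>] by (auto simp: space_PiM PiE_def Pi_def)
    from not_in_hull_separated[of N X n y] N Xj y X obtain a where a: "\<And>k. k < N \<Longrightarrow> 0 < (\<Sum>i<n. a i * (X k i - y i))" by blast
    have "\<exists>i<n. a i \<noteq> 0"
    proof (rule ccontr)
      assume "\<not> ?thesis"
      then have "(\<Sum>i<n. a i * (X 0 i - y i)) = 0" by (intro sum.neutral) auto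
      with a[of 0] N show False by simp
    qed
    from net[OF this] obtain R where R: "R \<in> F" "\<And>z. z \<in> R \<Longrightarrow> (\<Sum>i<n. a i * (z i - y i)) \<le> 0" by blast
    have "X k \<notin> R" if "k < N" for k using a[OF that] R(2)[of "X k"] by auto
    then have "X \<in> PiE {..<N} (\<lambda>_. space \<mu> - R)"
      using X by (auto simp: space_PiM PiE_def Pi_def)
    then show "X \<in> (\<Union>R\<in>F. PiE {..<N} (\<lambda>_. space \<mu> - R))" using R by blast
  qed
  then have "measure ?P {X \<in> space ?P. y \<notin> convex_Rn n hull (X ` {..<N})}
     \<le> measure ?P (\<Union>R\<in>F. PiE {..<N} (\<lambda>_. space \<mu> - R))"
    using F box by (intro P.finite_measure_mono) auto
  also have "\<dots> \<le> (\<Sum>R\<in>F. measure ?P (PiE {..<N} (\<lambda>_. space \<mu> - R)))"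
    using F box by (intro P.finite_measure_subadditive_finite) auto
  also have "\<dots> \<le> (\<Sum>R\<in>F. (1 - m) ^ N)"
  proof (intro sum_mono)
    fix R assume R: "R \<in> F"
    have "measure ?P (PiE {..<N} (\<lambda>_. space \<mu> - R)) = (\<Prod>j<N. measure \<mu> (space \<mu> - R))"
    proof -
      have "emeasure ?P (PiE {..<N} (\<lambda>_. space \<mu> - R)) = (\<Prod>j<N. emeasure \<mu> (space \<mu> - R))"
        using FR[OF R] by (intro PP.emeasure_PiM) auto
      then show ?thesis by (simp add: emeasure_eq_measure P.emeasure_eq_measure ennreal_power)
    qed
    also have "\<dots> = (1 - measure \<mu> R) ^ N" using FR[OF R] by (simp add: prob_compl)
    also have "\<dots> \<le> (1 - m) ^ N" using FR[OF R] by (intro power_mono) auto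
    finally show "measure ?P (PiE {..<N} (\<lambda>_. space \<mu> - R)) \<le> (1 - m) ^ N" .
  qed
  finally show ?thesis by simp
qed

section \<open>Typical points of the ball\<close>

definition psum :: "real \<Rightarrow> nat \<Rightarrow> (nat \<Rightarrow> real) \<Rightarrow> real" where
  "psum p n x = (\<Sum>i<n. \<bar>x i\<bar> powr p)"

lemma psum_nonneg: "0 \<le> psum p n x"
  by (simp add: psum_def sum_nonneg)

lemma psum_measurable [measurable]: "psum p n \<in> borel_measurable (lborel_Rn n)"
  unfolding psum_def by measurable

lemma lp_ball_eq_psum:
  assumes p: "0 < p"
  shows "lp_ball p n = {x \<in> Rn n. psum p n x \<le> 1}"
proof -
  have "lp_norm p n x \<le> 1 \<longleftrightarrow> psum p n x \<le> 1" for x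
  proof -
    have "psum p n x powr (1 / p) \<le> 1" if "psum p n x \<le> 1"
      using powr_mono2[of "1 / p" "psum p n x" 1] p psum_nonneg[of p n x] that by simp
    moreover have "1 < psum p n x powr (1 / p)" if "1 < psum p n x"
      using powr_less_mono2[of "1 / p" 1 "psum p n x"] p that by simp
    ultimately have "psum p n x powr (1 / p) \<le> 1 \<longleftrightarrow> psum p n x \<le> 1"
      by (meson not_le)
    then show ?thesis by (simp add: lp_norm_def psum_def)
  qed
  then show ?thesis by (simp add: lp_ball_def)
qed

text \<open>
  The reciprocal of the order of magnitude of a coordinate of a random point of the ball.
\<close>

definition typical_scale :: "real \<Rightarrow> nat \<Rightarrow> real" where
  "typical_scale p n = real n powr (1 / p)"

lemma typical_scale_pos: "1 \<le> n \<Longrightarrow> 0 < typical_scale p n"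
  by (simp add: typical_scale_def)

lemma typical_scale_powr:
  assumes "0 < p" "1 \<le> n"
  shows "\<bar>typical_scale p n * t\<bar> powr p = real n * \<bar>t\<bar> powr p"
  using assms by (simp add: typical_scale_def abs_mult powr_mult powr_powr)

lemma abs_le_powr_plus_one:
  fixes t p :: real
  assumes "1 < p"
  shows "\<bar>t\<bar> - 1 \<le> \<bar>t\<bar> powr p"
proof (cases "\<bar>t\<bar> \<le> 1")
  case False
  then have "\<bar>t\<bar> powr 1 \<le> \<bar>t\<bar> powr p" using assms by (intro powr_mono) auto
  then show ?thesis using False by simp
qed (use powr_ge_zero[of "\<bar>t\<bar>" p] in linarith)

text \<open>
  On the ball \<open>1 \<le> exp (n - n * psum p n x)\<close>, and the right-hand
  side is a product over the coordinates.  In this way the uniform distribution on the ball is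
  dominated by \<open>n\<close> independent variables of scale
  \<open>1 / typical_scale p n\<close>, up to a factor \<open>exp (O(n))\<close>.
\<close>

lemma emeasure_subset_ball_le:
  fixes \<phi> :: "real \<Rightarrow> ennreal" and C :: ennreal
  assumes p: "1 < p" and n: "1 \<le> n" and \<phi>[measurable]: "\<phi> \<in> borel_measurable borel"
    and A: "A \<in> sets (lborel_Rn n)" "A \<subseteq> lp_ball p n"
    and ge: "\<And>x. x \<in> A \<Longrightarrow> 1 \<le> C * (\<Prod>i<n. \<phi> (typical_scale p n * x i))"
  shows "emeasure (lborel_Rn n) A \<le>
    C * (ennreal (exp 2 / typical_scale p n) * (\<integral>\<^sup>+t. \<phi> t * ennreal (exp (- \<bar>t\<bar>)) \<partial>lborel)) ^ n"
proof -
  define w where "w = typical_scale p n"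
  have w: "0 < w" unfolding w_def by (rule typical_scale_pos[OF n])
  define g where "g t = \<phi> t * ennreal (exp (- (\<bar>t\<bar> powr p)))" for t :: real
  have [measurable]: "g \<in> borel_measurable borel" unfolding g_def by measurable
  have ge': "1 \<le> C * (ennreal (exp (real n)) * (\<Prod>i<n. g (w * x i)))" if x: "x \<in> A" for x
  proof -
    have "(\<Sum>i<n. \<bar>w * x i\<bar> powr p) = real n * psum p n x"
      using p n by (simp add: w_def typical_scale_powr psum_def sum_distrib_left)
    also have "\<dots> \<le> real n"
      using A(2) x p by (auto simp: lp_ball_eq_psum intro!: mult_left_le)
    finally have "1 \<le> exp (real n) * (\<Prod>i<n. exp (- (\<bar>w * x i\<bar> powr p)))"
      by (simp add: exp_sum[symmetric] sum_negf exp_add[symmetric])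
    then have "1 \<le> ennreal (exp (real n)) * (\<Prod>i<n. ennreal (exp (- (\<bar>w * x i\<bar> powr p))))"
      by (simp add: prod_ennreal ennreal_mult[symmetric] prod_nonneg)
    with ge[OF x] have "1 * 1 \<le> (C * (\<Prod>i<n. \<phi> (w * x i))) * (ennreal (exp (real n)) * (\<Prod>i<n. ennreal (exp (- (\<bar>w * x i\<bar> powr p)))))"
      unfolding w_def by (intro mult_mono) auto
    then show ?thesis by (simp add: g_def prod.distrib mult_ac)
  qed
  have "emeasure (lborel_Rn n) A \<le> (C * ennreal (exp (real n))) * (\<Prod>i<n. \<integral>\<^sup>+t. g (w * t) \<partial>lborel)"
    using ge' by (intro emeasure_le_prod_nn_integral A) (auto simp: mult.assoc)
  also have "(\<integral>\<^sup>+t. g (w * t) \<partial>lborel) = ennreal (1 / w) * (\<integral>\<^sup>+t. g t \<partial>lborel)"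
  proof -
    have "(\<integral>\<^sup>+t. g t \<partial>lborel) = ennreal w * (\<integral>\<^sup>+t. g (w * t) \<partial>lborel)"
      using nn_integral_real_affine[of g w 0] w by simp
    moreover have "ennreal (1 / w) * ennreal w = 1" using w by (simp flip: ennreal_mult)
    ultimately show ?thesis by (simp add: mult.assoc[symmetric])
  qed
  also have "(\<integral>\<^sup>+t. g t \<partial>lborel) \<le> (\<integral>\<^sup>+t. ennreal (exp 1) * (\<phi> t * ennreal (exp (- \<bar>t\<bar>))) \<partial>lborel)"
  proof (intro nn_integral_mono)
    fix t
    have "ennreal (exp (- (\<bar>t\<bar> powr p))) \<le> ennreal (exp 1 * exp (- \<bar>t\<bar>))"
      using abs_le_powr_plus_one[OF p, of t] by (intro ennreal_leI) (simp flip: exp_add)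
    then have "\<phi> t * ennreal (exp (- (\<bar>t\<bar> powr p))) \<le> \<phi> t * ennreal (exp 1 * exp (- \<bar>t\<bar>))"
      by (intro mult_left_mono) auto
    then show "g t \<le> ennreal (exp 1) * (\<phi> t * ennreal (exp (- \<bar>t\<bar>)))"
      by (simp add: g_def ennreal_mult mult_ac)
  qed
  also have "\<dots> = ennreal (exp 1) * (\<integral>\<^sup>+t. \<phi> t * ennreal (exp (- \<bar>t\<bar>)) \<partial>lborel)"
    by (intro nn_integral_cmult) measurable
  finally have "emeasure (lborel_Rn n) A \<le> (C * ennreal (exp (real n))) *
    (\<Prod>i<n. ennreal (1 / w) * (ennreal (exp 1) * (\<integral>\<^sup>+t. \<phi> t * ennreal (exp (- \<bar>t\<bar>)) \<partial>lborel)))"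
    by (simp add: mult_left_mono power_mono)
  also have "\<dots> = C * (ennreal (exp 1) * ennreal (1 / w) * ennreal (exp 1) * (\<integral>\<^sup>+t. \<phi> t * ennreal (exp (- \<bar>t\<bar>)) \<partial>lborel)) ^ n"
  proof -
    have "ennreal (exp (real n)) = ennreal (exp 1) ^ n"
      using exp_of_nat_mult[of n "1::real"] by (simp add: ennreal_power)
    then show ?thesis by (simp add: power_mult_distrib mult_ac)
  qed
  also have "ennreal (exp 1) * ennreal (1 / w) * ennreal (exp 1) = ennreal (exp 2 / w)"
    using w by (simp add: exp_add[symmetric] flip: ennreal_mult)
  finally show ?thesis by (simp add: w_def)
qed

definition ball_volume :: "real \<Rightarrow> nat \<Rightarrow> real" where
  "ball_volume p n = measure (lborel_Rn n) (lp_ball p n)"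

text \<open>
  The lower bound is the volume of the inscribed cube
  \<open>\<bar>x i\<bar> \<le> 1 / typical_scale p n\<close>, the upper one comes from
  \<open>emeasure_subset_ball_le\<close>.  They differ only by a factor
  \<open>exp (2 * n)\<close>.
\<close>

lemma ball_volume:
  assumes p: "1 < p" and n: "1 \<le> n"
  shows "emeasure (lborel_Rn n) (lp_ball p n) = ennreal (ball_volume p n)" (is ?e)
    and "(2 / typical_scale p n) ^ n \<le> ball_volume p n" (is ?l)
    and "ball_volume p n \<le> (2 * exp 2 / typical_scale p n) ^ n" (is ?u)
proof -
  define w where "w = typical_scale p n"
  have w: "0 < w" unfolding w_def by (rule typical_scale_pos[OF n])
  have "emeasure (lborel_Rn n) (lp_ball p n) \<le>
     1 * (ennreal (exp 2 / w) * (\<integral>\<^sup>+t. 1 * ennreal (exp (- \<bar>t\<bar>)) \<partial>lborel)) ^ n"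
    unfolding w_def using lp_ball_sets by (intro emeasure_subset_ball_le[OF p n]) auto
  also have "\<dots> = ennreal ((2 * exp 2 / w) ^ n)"
    using w by (simp add: nn_integral_exp_abs ennreal_mult[symmetric] ennreal_power mult.commute
        flip: ennreal_numeral)
  finally have u: "emeasure (lborel_Rn n) (lp_ball p n) \<le> ennreal ((2 * exp 2 / w) ^ n)" .
  then show e: ?e
    unfolding ball_volume_def
    by (intro emeasure_eq_ennreal_measure) (auto simp: top_unique)
  have "(1 / w) powr p = 1 / real n"
    using typical_scale_powr[of p n "1 / w"] p n w
    by (simp add: w_def[symmetric] field_simps)
  then have "PiE {..<n} (\<lambda>_. {- (1 / w)..1 / w}) \<subseteq> lp_ball p n"
  proof (intro subsetI)
    fix x assume x: "x \<in> PiE {..<n} (\<lambda>_. {- (1 / w)..1 / w})"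
    have "psum p n x \<le> (\<Sum>i<n. (1 / w) powr p)"
      unfolding psum_def using x p by (intro sum_mono powr_mono2) (auto simp: PiE_iff abs_le_iff minus_le_iff)
    also have "\<dots> = 1" using \<open>(1 / w) powr p = 1 / real n\<close> n by simp
    finally show "x \<in> lp_ball p n" using x p by (auto simp: lp_ball_eq_psum PiE_iff)
  qed
  then have "emeasure (lborel_Rn n) (PiE {..<n} (\<lambda>_. {- (1 / w)..1 / w})) \<le> ennreal (ball_volume p n)"
    unfolding e[symmetric] by (intro emeasure_mono lp_ball_sets)
  also have "emeasure (lborel_Rn n) (PiE {..<n} (\<lambda>_. {- (1 / w)..1 / w})) = ennreal ((2 / w) ^ n)"
    using w by (subst lborel_product.emeasure_PiM) (auto simp: ennreal_power)
  finally show ?l using w by (simp add: w_def[symmetric] ball_volume_def ennreal_le_iff)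
  show ?u using u w unfolding e by (subst (asm) ennreal_le_iff) (auto simp: w_def)
qed

lemma ball_volume_pos:
  assumes "1 < p" "1 \<le> n"
  shows "0 < ball_volume p n"
proof -
  have "0 < (2 / typical_scale p n) ^ n" using typical_scale_pos[OF assms(2)] by simp
  then show ?thesis using ball_volume(2)[OF assms] by linarith
qed

lemma measure_lp_unif:
  assumes p: "1 < p" and n: "1 \<le> n" and A: "A \<in> sets (lborel_Rn n)"
  shows "measure (lp_unif p n) A = measure (lborel_Rn n) (lp_ball p n \<inter> A) / ball_volume p n"
proof -
  have "emeasure (lborel_Rn n) (lp_ball p n) \<noteq> 0" "emeasure (lborel_Rn n) (lp_ball p n) \<noteq> \<infinity>"
    using ball_volume_pos[OF p n] by (simp_all add: ball_volume(1)[OF p n])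
  then show ?thesis
    unfolding lp_unif_def ball_volume_def using A by (rule measure_uniform_measure)
qed

lemma measure_lp_unif_le:
  assumes p: "1 < p" and n: "1 \<le> n" and A: "A \<in> sets (lborel_Rn n)" and c: "0 \<le> c"
    and le: "emeasure (lborel_Rn n) (lp_ball p n \<inter> A) \<le> ennreal c"
  shows "measure (lp_unif p n) A \<le> c * (typical_scale p n / 2) ^ n"
proof -
  have w: "0 < typical_scale p n" by (rule typical_scale_pos[OF n])
  have "measure (lborel_Rn n) (lp_ball p n \<inter> A) \<le> c"
    using le c by (simp add: measure_def enn2real_leI)
  then have "measure (lp_unif p n) A \<le> c / (2 / typical_scale p n) ^ n"
    unfolding measure_lp_unif[OF p n A]
    using ball_volume(2)[OF p n] w c by (intro frac_le) auto
  then show ?thesis by (simp add: power_divide field_simps)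
qed

lemma sets_lp_unif: "sets (lp_unif p n) = sets (lborel_Rn n)"
  by (simp add: lp_unif_def)

text \<open>
  Homogeneity: the set in question is the image of the ball under scaling by \<open>r\<close>.
\<close>

lemma lp_unif_radial:
  assumes p: "1 < p" and n: "1 \<le> n" and r: "0 < r" "r \<le> 1"
  shows "measure (lp_unif p n) {x \<in> Rn n. psum p n x \<le> r powr p} = r ^ n"
proof -
  let ?L = "lborel_Rn n"
  define A where "A = {x \<in> Rn n. psum p n x \<le> r powr p}"
  have "{x \<in> space ?L. psum p n x \<le> r powr p} \<in> sets ?L" by measurable
  then have A: "A \<in> sets ?L" by (simp add: A_def space_PiM)
  have "r powr p \<le> 1" using r p powr_mono2[of p r 1] by simp
  then have "A \<subseteq> lp_ball p n"
    using p unfolding A_def lp_ball_eq_psum[OF less_trans[OF zero_less_one p]]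
    by (intro Collect_mono) simp
  then have AB: "lp_ball p n \<inter> A = A" by (rule Int_absorb1)
  have "emeasure ?L A = (\<Prod>i<n. ennreal \<bar>r\<bar>) * emeasure ?L {u \<in> Rn n. (\<lambda>i\<in>{..<n}. 0 + r * u i) \<in> A}"
    using r by (intro emeasure_affine A) auto
  also have "{u \<in> Rn n. (\<lambda>i\<in>{..<n}. 0 + r * u i) \<in> A} = lp_ball p n"
  proof -
    have "psum p n (\<lambda>i\<in>{..<n}. 0 + r * u i) = r powr p * psum p n u" for u
      using r by (simp add: psum_def abs_mult powr_mult sum_distrib_left)
    moreover have "r powr p * s \<le> r powr p \<longleftrightarrow> s \<le> 1" for s
      using r mult_le_cancel_left_pos[of "r powr p" s 1] by simp
    ultimately show ?thesis using p by (simp add: A_def lp_ball_eq_psum)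
  qed
  finally have "emeasure ?L A = ennreal (r ^ n * ball_volume p n)"
    using r by (simp add: ball_volume(1)[OF p n] ennreal_mult' ennreal_power)
  then have "measure ?L A = r ^ n * ball_volume p n"
    using r ball_volume_pos[OF p n] by (simp add: measure_def)
  then show ?thesis
    unfolding A_def[symmetric] measure_lp_unif[OF p n A] AB using ball_volume_pos[OF p n] by simp
qed

text \<open>
  Twice \<open>exp 2\<close> times half the integral of
  \<open>\<bar>t\<bar> powr (- 1 / 2) * exp (- \<bar>t\<bar>)\<close>; the factor 2
  makes the exceptional probability in \<open>lp_unif_small_product\<close> equal to
  \<open>(1 / 2) ^ n\<close>.
\<close>

definition spread_const :: real where
  "spread_const = 2 * exp 2 * sqrt pi"

lemma spread_const_ge_1: "1 \<le> spread_const"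
proof -
  have "1 * 1 \<le> exp (2::real) * sqrt pi" using pi_gt3 by (intro mult_mono) auto
  then show ?thesis by (simp add: spread_const_def)
qed

lemma null_coordinate_hyperplanes:
  assumes "i < n"
  shows "{x \<in> Rn n. x i = 0} \<in> null_sets (lborel_Rn n)"
proof -
  have eq: "{x \<in> Rn n. x i = 0} = PiE {..<n} (\<lambda>j. if j = i then {0} else UNIV)"
    using assms by (simp add: PiE_iff set_eq_iff) (metis (full_types) UNIV_I singletonD singletonI lessThan_iff)
  have "emeasure (lborel_Rn n) (PiE {..<n} (\<lambda>j. if j = i then {0} else UNIV))
     = (\<Prod>j<n. emeasure lborel (if j = i then {0} else UNIV :: real set))"
    by (intro lborel_product.emeasure_PiM) auto
  also have "\<dots> = 0" using assms by (intro prod_zero) (auto intro!: bexI[of _ i])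
  finally show ?thesis unfolding eq by (intro null_setsI sets_PiM_I_finite) auto
qed

text \<open>
  Markov's inequality for the product of
  \<open>(w * \<bar>x i\<bar>) powr (- 1 / 2)\<close> with
  \<open>w = typical_scale p n\<close>.  Its mean is at most
  \<open>(spread_const / 2) ^ n\<close>, since the singularity at 0 is integrable.  As
  \<open>0 powr a = 0\<close>, points with a vanishing coordinate are treated separately,
  as a null set.
\<close>

lemma lp_unif_small_product:
  assumes p: "1 < p" and n: "1 \<le> n"
  shows "measure (lp_unif p n) {x \<in> Rn n. (\<exists>i<n. x i = 0) \<or>
      (\<Prod>i<n. sqrt (typical_scale p n * \<bar>x i\<bar>)) < (1 / spread_const) ^ n} \<le> (1 / 2) ^ n"
proof -
  let ?L = "lborel_Rn n"
  define w where "w = typical_scale p n"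
  have w: "0 < w" unfolding w_def by (rule typical_scale_pos[OF n])
  have sc: "0 < spread_const" using spread_const_ge_1 by simp
  define S where "S = {x \<in> Rn n. (\<exists>i<n. x i = 0) \<or> (\<Prod>i<n. sqrt (w * \<bar>x i\<bar>)) < (1 / spread_const) ^ n}"
  define A where "A = {x \<in> lp_ball p n. (\<forall>i<n. x i \<noteq> 0) \<and> (\<Prod>i<n. sqrt (w * \<bar>x i\<bar>)) < (1 / spread_const) ^ n}"
  have "{x \<in> space ?L. (\<exists>i\<in>{..<n}. x i = 0) \<or> (\<Prod>i<n. sqrt (w * \<bar>x i\<bar>)) < (1 / spread_const) ^ n} \<in> sets ?L"
    by measurable
  then have S: "S \<in> sets ?L" by (simp add: S_def space_PiM)
  have "lp_ball p n \<inter> {x \<in> space ?L. (\<forall>i\<in>{..<n}. x i \<noteq> 0) \<and> (\<Prod>i<n. sqrt (w * \<bar>x i\<bar>)) < (1 / spread_const) ^ n} \<in> sets ?L"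
    by (intro sets.Int lp_ball_sets) measurable
  also have "lp_ball p n \<inter> {x \<in> space ?L. (\<forall>i\<in>{..<n}. x i \<noteq> 0) \<and> (\<Prod>i<n. sqrt (w * \<bar>x i\<bar>)) < (1 / spread_const) ^ n} = A"
    by (auto simp: A_def lp_ball_def space_PiM)
  finally have A: "A \<in> sets ?L" .
  \<comment> \<open>On \<open>Z\<close> the product of the powers is 0 by convention, so that
    Markov's inequality says nothing there.\<close>
  define Z where "Z = (\<Union>i<n. {x \<in> Rn n. x i = 0})"
  have Z: "Z \<in> null_sets ?L"
    unfolding Z_def by (intro null_sets_UN' null_coordinate_hyperplanes) auto
  have "emeasure ?L A \<le> ennreal ((1 / spread_const) ^ n) *
     (ennreal (exp 2 / w) * (\<integral>\<^sup>+t. ennreal (\<bar>t\<bar> powr (1 / 2 - 1)) * ennreal (exp (- \<bar>t\<bar>)) \<partial>lborel)) ^ n"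
    unfolding w_def
  proof (intro emeasure_subset_ball_le[OF p n _ A])
    fix x assume x: "x \<in> A"
    have pos: "0 < sqrt (w * \<bar>x i\<bar>)" if "i < n" for i using x that w by (auto simp: A_def)
    define P where "P = (\<Prod>i<n. sqrt (w * \<bar>x i\<bar>))"
    have P: "0 < P" unfolding P_def using pos by (intro prod_pos) auto
    have "(\<Prod>i<n. \<bar>w * x i\<bar> powr (1 / 2 - 1)) = (\<Prod>i<n. 1 / sqrt (w * \<bar>x i\<bar>))"
      using x w by (intro prod.cong) (auto simp: A_def powr_minus powr_half_sqrt abs_mult field_simps)
    also have "\<dots> = 1 / P" by (simp add: P_def prod_dividef)
    finally have prodP: "(\<Prod>i<n. \<bar>w * x i\<bar> powr (1 / 2 - 1)) = 1 / P" .
    have "1 \<le> (1 / spread_const) ^ n * (\<Prod>i<n. \<bar>w * x i\<bar> powr (1 / 2 - 1))"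
    proof -
      have "P < (1 / spread_const) ^ n" using x by (simp add: A_def P_def)
      then show ?thesis unfolding prodP using P by simp
    qed
    then show "1 \<le> ennreal ((1 / spread_const) ^ n) * (\<Prod>i<n. ennreal (\<bar>typical_scale p n * x i\<bar> powr (1 / 2 - 1)))"
      using sc by (simp add: w_def prod_ennreal ennreal_mult[symmetric] prod_nonneg)
  qed (auto simp: A_def)
  also have "(\<integral>\<^sup>+t. ennreal (\<bar>t\<bar> powr (1 / 2 - 1)) * ennreal (exp (- \<bar>t\<bar>)) \<partial>lborel) = ennreal (2 * sqrt pi)"
    using nn_integral_abs_powr_exp[of "1 / 2"] by (simp add: ennreal_mult Gamma_one_half_real)
  also have "ennreal ((1 / spread_const) ^ n) * (ennreal (exp 2 / w) * ennreal (2 * sqrt pi)) ^ n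
     = ennreal ((1 / w) ^ n)"
    using w sc by (simp add: ennreal_mult[symmetric] ennreal_power power_mult_distrib[symmetric])
      (simp add: spread_const_def)
  finally have eA: "emeasure ?L A \<le> ennreal ((1 / w) ^ n)" .
  have "emeasure ?L (lp_ball p n \<inter> S) \<le> emeasure ?L (A \<union> Z)"
  proof (intro emeasure_mono subsetI)
    fix x assume x: "x \<in> lp_ball p n \<inter> S"
    then have xR: "x \<in> Rn n" unfolding S_def by blast
    show "x \<in> A \<union> Z"
    proof (cases "\<exists>i<n. x i = 0")
      case True
      then show ?thesis unfolding Z_def using xR by blast
    next
      case False
      then show ?thesis unfolding A_def using x unfolding S_def by blast
    qed
  next
    show "A \<union> Z \<in> sets ?L" by (rule sets.Un[OF A null_setsD2[OF Z]])
  qed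
  also have "\<dots> = emeasure ?L A" using A Z by (rule emeasure_Un_null_set)
  finally have "measure (lp_unif p n) S \<le> (1 / w) ^ n * (typical_scale p n / 2) ^ n"
    using eA w by (intro measure_lp_unif_le[OF p n S]) auto
  also have "\<dots> = (1 / 2) ^ n" using w by (simp add: w_def power_mult_distrib[symmetric])
  finally show ?thesis by (simp add: S_def w_def)
qed

text \<open>
  The first two conditions say that the distance of the norm from 1 is at least of order
  \<open>1 / (n * K)\<close> and at most of order \<open>K / n\<close>.  The square roots
  have no significance beyond matching the moment of order \<open>- 1 / 2\<close> by which
  the last condition is verified.
\<close>

definition typical_set :: "real \<Rightarrow> real \<Rightarrow> nat \<Rightarrow> (nat \<Rightarrow> real) set" where
  "typical_set p K n = {x \<in> Rn n. 1 - p * K / n \<le> psum p n x \<and> psum p n x \<le> 1 - 1 / (n * K) \<and>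
     (\<forall>i<n. x i \<noteq> 0) \<and> (1 / spread_const) ^ n \<le> (\<Prod>i<n. sqrt (typical_scale p n * \<bar>x i\<bar>))}"

lemma typical_set_sets: "typical_set p K n \<in> sets (lborel_Rn n)"
proof -
  have "{x \<in> space (lborel_Rn n). 1 - p * K / n \<le> psum p n x \<and> psum p n x \<le> 1 - 1 / (n * K) \<and>
     (\<forall>i\<in>{..<n}. x i \<noteq> 0) \<and> (1 / spread_const) ^ n \<le> (\<Prod>i<n. sqrt (typical_scale p n * \<bar>x i\<bar>))}
     \<in> sets (lborel_Rn n)" by measurable
  then show ?thesis by (simp add: typical_set_def space_PiM)
qed

text \<open>
  The three summands are the probabilities that \<open>x\<close> lies too deep in the ball, too
  close to its boundary, or has too small a product of coordinates.  The first two follow from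
  the radial law \<open>r ^ n\<close> at \<open>r = 1 - K / n\<close> and
  \<open>r = 1 - 1 / (n * K)\<close>.
\<close>

lemma typical_set_measure:
  assumes p: "1 < p" and n: "2 \<le> n" and K: "1 \<le> K" "K < real n"
  shows "measure (lp_unif p n) (space (lp_unif p n) - typical_set p K n) \<le> exp (- K) + 1 / K + (1 / 2) ^ n"
proof -
  have n1: "1 \<le> n" using n by simp
  interpret prob_space "lp_unif p n" using p n1 by (intro prob_space_lp_unif) auto
  have sp: "space (lp_unif p n) = Rn n" by (simp add: lp_unif_def space_PiM)
  define A where "A r = {x \<in> Rn n. psum p n x \<le> r powr p}" for r
  define S where "S = {x \<in> Rn n. (\<exists>i<n. x i = 0) \<or>
      (\<Prod>i<n. sqrt (typical_scale p n * \<bar>x i\<bar>)) < (1 / spread_const) ^ n}"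
  \<comment> \<open>Since \<open>r1 powr p \<le> r1\<close> and \<open>1 - p * K / n \<le> r2
    powr p\<close>, these radii give the two bounds on \<open>psum\<close>.\<close>
  define r1 where "r1 = 1 - 1 / (n * K)"
  define r2 where "r2 = 1 - K / n"
  have nK: "2 \<le> n * K" using mult_mono[of 2 "real n" 1 K] n K by simp
  have r1: "0 < r1" "r1 \<le> 1" using nK by (auto simp: r1_def field_simps)
  have r2: "0 < r2" "r2 \<le> 1" using n K by (auto simp: r2_def field_simps)
  have Asets: "A r \<in> events" for r
  proof -
    have "{x \<in> space (lborel_Rn n). psum p n x \<le> r powr p} \<in> sets (lborel_Rn n)" by measurable
    then show ?thesis by (simp add: A_def space_PiM sets_lp_unif)
  qed
  have Ssets: "S \<in> events"
  proof -
    have "{x \<in> space (lborel_Rn n). (\<exists>i\<in>{..<n}. x i = 0) \<or>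
      (\<Prod>i<n. sqrt (typical_scale p n * \<bar>x i\<bar>)) < (1 / spread_const) ^ n} \<in> sets (lborel_Rn n)" by measurable
    then show ?thesis by (simp add: S_def space_PiM sets_lp_unif)
  qed
  have sub: "space (lp_unif p n) - typical_set p K n \<subseteq> A r2 \<union> (space (lp_unif p n) - A r1) \<union> S"
  proof
    fix x assume "x \<in> space (lp_unif p n) - typical_set p K n"
    then have x: "x \<in> Rn n" "x \<notin> typical_set p K n" by (auto simp: sp)
    have "1 - p * K / n \<le> psum p n x" if "x \<notin> A r2"
    proof -
      have "1 + p * (- K / n) \<le> \<bar>1 + (- K / n)\<bar> powr p"
        using bregman_ge[OF p, of "- K / n"] p by (smt (verit) mult_nonneg_nonneg divide_nonneg_nonneg zero_le_power2)
      also have "\<dots> = r2 powr p" using r2 by (simp add: r2_def)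
      also have "\<dots> \<le> psum p n x" using that x by (simp add: A_def)
      finally show ?thesis by simp
    qed
    moreover have "psum p n x \<le> 1 - 1 / (n * K)" if "x \<in> A r1"
    proof -
      have "psum p n x \<le> r1 powr p" using that by (simp add: A_def)
      also have "\<dots> \<le> r1 powr 1" using r1 p by (intro powr_mono') auto
      finally show ?thesis using r1 by (simp add: r1_def)
    qed
    ultimately show "x \<in> A r2 \<union> (space (lp_unif p n) - A r1) \<union> S"
      using x by (auto simp: typical_set_def S_def sp not_le)
  qed
  have "prob (space (lp_unif p n) - typical_set p K n) \<le> prob (A r2 \<union> (space (lp_unif p n) - A r1) \<union> S)"
    using sub Asets Ssets by (intro finite_measure_mono) auto
  also have "\<dots> \<le> prob (A r2) + prob (space (lp_unif p n) - A r1) + prob S"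
    using Asets Ssets by (intro order_trans[OF measure_Un_le] add_mono) auto
  also have "prob (space (lp_unif p n) - A r1) = 1 - r1 ^ n"
    unfolding prob_compl[OF Asets] unfolding A_def lp_unif_radial[OF p n1 r1] by (rule refl)
  also have "\<dots> \<le> 1 / K"
    using Bernoulli_inequality[of "- (1 / (n * K))" n] nK n by (simp add: r1_def)
  also have "prob (A r2) = r2 ^ n" unfolding A_def by (rule lp_unif_radial[OF p n1 r2])
  also have "\<dots> \<le> exp (- K)"
    using exp_ge_one_minus_x_over_n_power_n[of K n] n K by (simp add: r2_def)
  also have "prob S \<le> (1 / 2) ^ n" unfolding S_def by (rule lp_unif_small_product[OF p n1])
  finally show ?thesis by simp
qed

section \<open>The tangent half-space at a typical point\<close>

lemma prod_powr_real:
  fixes f :: "'a \<Rightarrow> real"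
  assumes "\<And>i. i \<in> A \<Longrightarrow> 0 \<le> f i"
  shows "(\<Prod>i\<in>A. f i powr p) = (\<Prod>i\<in>A. f i) powr p"
  using assms by (induction A rule: infinite_finite_induct) (auto simp: powr_mult prod_nonneg)

text \<open>
  The upper bounds hold for all points of the ball because
  \<open>psum p n x \<le> 1\<close> and \<open>y \<le> exp (y powr p)\<close>; the
  lower bound is part of the definition of a typical point.
\<close>

lemma typical_product:
  assumes p: "1 < p" and n: "1 \<le> n" and x: "x \<in> typical_set p K n" and K: "1 \<le> K"
  defines "w \<equiv> typical_scale p n"
  shows "(1 / spread_const\<^sup>2) ^ n \<le> (\<Prod>i<n. w * \<bar>x i\<bar>)"
    and "(\<Prod>i<n. w * \<bar>x i\<bar>) \<le> exp (real n)"
    and "(\<Sum>i<n. real n * \<bar>x i\<bar> powr p) \<le> real n"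
proof -
  have w: "0 < w" unfolding w_def by (rule typical_scale_pos[OF n])
  have sc: "0 < spread_const" using spread_const_ge_1 by simp
  have "((1 / spread_const) ^ n)\<^sup>2 \<le> (\<Prod>i<n. sqrt (w * \<bar>x i\<bar>))\<^sup>2"
    using x sc by (intro power_mono) (simp_all add: typical_set_def w_def)
  also have "\<dots> = (\<Prod>i<n. w * \<bar>x i\<bar>)"
    unfolding prod_power_distrib using w by (intro prod.cong) auto
  finally show "(1 / spread_const\<^sup>2) ^ n \<le> (\<Prod>i<n. w * \<bar>x i\<bar>)"
    by (simp add: power_divide power_mult[symmetric] mult.commute)
  have "psum p n x \<le> 1 - 1 / (n * K)" using x by (simp add: typical_set_def)
  also have "\<dots> \<le> 1" using K by simp
  finally show S: "(\<Sum>i<n. real n * \<bar>x i\<bar> powr p) \<le> real n"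
    by (simp add: psum_def sum_distrib_left[symmetric] mult_left_le)
  have "(\<Prod>i<n. w * \<bar>x i\<bar>) \<le> (\<Prod>i<n. exp (real n * \<bar>x i\<bar> powr p))"
  proof (intro prod_mono conjI)
    fix i
    have "w * \<bar>x i\<bar> = \<bar>w * x i\<bar>" using w by (simp add: abs_mult)
    also have "\<dots> \<le> 1 + \<bar>w * x i\<bar> powr p" using abs_le_powr_plus_one[OF p, of "w * x i"] by simp
    also have "\<bar>w * x i\<bar> powr p = real n * \<bar>x i\<bar> powr p"
      unfolding w_def using p n by (intro typical_scale_powr) auto
    also have "1 + \<dots> \<le> exp \<dots>" by (rule exp_ge_add_one_self)
    finally show "w * \<bar>x i\<bar> \<le> exp (real n * \<bar>x i\<bar> powr p)" .
  qed (use w in simp)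
  also have "\<dots> = exp (\<Sum>i<n. real n * \<bar>x i\<bar> powr p)" by (rule exp_sum[symmetric]) simp
  also have "\<dots> \<le> exp (real n)" using S by simp
  finally show "(\<Prod>i<n. w * \<bar>x i\<bar>) \<le> exp (real n)" .
qed

definition cap_const :: "real \<Rightarrow> real" where
  "cap_const p = 2 * exp 3 * spread_const powr (2 * p) / min 1 ((p - 1) / 8)"

lemma cap_const_pos: "1 < p \<Longrightarrow> 0 < cap_const p"
  using spread_const_ge_1 by (simp add: cap_const_def)

text \<open>
  Here \<open>Y\<close> stands for \<open>n * \<bar>x i\<bar> powr p\<close>.  The
  dependence on \<open>Y\<close> is put into the form \<open>exp Y / Y\<close> because the
  product of these factors over all coordinates is under control at a typical point.
\<close>

lemma bregman_factor_le:
  fixes Y b c :: real and n :: nat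
  assumes Y: "0 < Y" and n: "1 \<le> n" and c: "0 < c" and b: "b = min 1 c"
  shows "2 * exp 1 / sqrt (n * Y * c) + 2 * exp 1 / (n * Y * c) \<le> 4 * exp 1 / b / sqrt n * (exp Y / Y)"
proof -
  have b1: "0 < b" "b \<le> 1" "b \<le> c" using c b by auto
  have sn: "1 \<le> sqrt n" "sqrt n * sqrt n = n" using n by auto
  have e: "1 + Y \<le> exp Y" by (rule exp_ge_add_one_self)
  have "sqrt Y \<le> exp Y"
  proof (cases "Y \<le> 1")
    case False
    then have "sqrt Y \<le> Y" by (simp add: real_sqrt_le_iff real_le_lsqrt power2_eq_square)
    then show ?thesis using e by linarith
  next
    case True
    then have "sqrt Y \<le> 1" by simp
    also have "\<dots> \<le> exp Y" using Y by simp
    finally show ?thesis .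
  qed
  then have "sqrt Y / Y \<le> exp Y / Y" using Y by (intro divide_right_mono) auto
  then have sY: "1 / sqrt Y \<le> exp Y / Y" using Y by (simp add: real_div_sqrt field_simps)
  have "b * b \<le> 1 * c" using b1 by (intro mult_mono) auto
  then have sc: "b \<le> sqrt c" using b1 by (intro real_le_rsqrt) (simp add: power2_eq_square)
  have cb: "1 / sqrt c \<le> 1 / b" "1 / c \<le> 1 / b"
    using sc b1 c by (auto intro!: divide_left_mono)
  have Y1: "1 / Y \<le> exp Y / Y" using Y by (intro divide_right_mono) auto
  have "1 / sqrt (n * Y * c) = 1 / sqrt n * (1 / sqrt Y) * (1 / sqrt c)"
    by (simp add: real_sqrt_mult)
  also have "\<dots> \<le> 1 / sqrt n * (exp Y / Y) * (1 / b)"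
    using sY cb b1 c Y by (intro mult_mono) auto
  finally have 1: "1 / sqrt (n * Y * c) \<le> 1 / sqrt n * (exp Y / Y) * (1 / b)" .
  have "sqrt n * 1 \<le> sqrt n * sqrt n" using sn by (intro mult_left_mono) auto
  then have n2: "1 / real n \<le> 1 / sqrt n" using n sn by (intro divide_left_mono) auto
  have "1 / (n * Y * c) = 1 / n * (1 / Y) * (1 / c)" by simp
  also have "\<dots> \<le> 1 / sqrt n * (exp Y / Y) * (1 / b)"
    using n2 Y1 cb b1 c Y by (intro mult_mono) auto
  finally have 2: "1 / (n * Y * c) \<le> 1 / sqrt n * (exp Y / Y) * (1 / b)" .
  have "2 * exp 1 / sqrt (n * Y * c) + 2 * exp 1 / (n * Y * c) = 2 * exp 1 * (1 / sqrt (n * Y * c) + 1 / (n * Y * c))"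
    by (simp add: distrib_left)
  also have "\<dots> \<le> 2 * exp 1 * (2 * (1 / sqrt n * (exp Y / Y) * (1 / b)))"
    using add_mono[OF 1 2] by (intro mult_left_mono) (simp_all only: mult_2, simp)
  also have "\<dots> = 4 * exp 1 / b / sqrt n * (exp Y / Y)" by (simp add: mult_ac)
  finally show ?thesis .
qed

text \<open>
  Substitute \<open>z = \<xi> * (1 + t)\<close>: the divergence is homogeneous of degree
  \<open>p\<close>, which reduces the integral to \<open>nn_integral_bregman\<close>.
\<close>

lemma tangent_factor_le:
  fixes \<xi> p :: real and n :: nat
  assumes p: "1 < p" and n: "1 \<le> n" and \<xi>: "\<xi> \<noteq> 0"
  defines "a \<equiv> \<bar>\<xi>\<bar> powr (p - 1) * sgn \<xi>" and "Y \<equiv> real n * \<bar>\<xi>\<bar> powr p"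
  shows "(\<integral>\<^sup>+z. ennreal (exp (- (real n)\<^sup>2 * (\<bar>z\<bar> powr p - \<bar>\<xi>\<bar> powr p - p * a * (z - \<xi>)))) \<partial>lborel)
    \<le> ennreal (\<bar>\<xi>\<bar> * (4 * exp 1 / min 1 ((p - 1) / 8) / sqrt n * (exp Y / Y)))"
proof -
  have Y: "0 < Y" using n \<xi> by (simp add: Y_def)
  define g where "g z = ennreal (exp (- (real n)\<^sup>2 * (\<bar>z\<bar> powr p - \<bar>\<xi>\<bar> powr p - p * a * (z - \<xi>))))" for z
  have gm: "g \<in> borel_measurable borel" unfolding g_def by measurable
  have a\<xi>: "a * \<xi> = \<bar>\<xi>\<bar> powr p"
  proof -
    have "a * \<xi> = \<bar>\<xi>\<bar> powr (p - 1) * \<bar>\<xi>\<bar> powr 1"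
      using \<xi> by (simp add: a_def sgn_if)
    also have "\<dots> = \<bar>\<xi>\<bar> powr p" by (simp only: powr_add[symmetric]) simp
    finally show ?thesis .
  qed
  have gt: "g (\<xi> + \<xi> * t) = ennreal (exp (- (real n * Y) * (\<bar>1 + t\<bar> powr p - 1 - p * t)))" for t
  proof -
    have "\<bar>\<xi> + \<xi> * t\<bar> powr p = \<bar>\<xi>\<bar> powr p * \<bar>1 + t\<bar> powr p"
    proof -
      have "\<xi> + \<xi> * t = \<xi> * (1 + t)" by (simp add: distrib_left)
      then show ?thesis by (simp add: abs_mult powr_mult)
    qed
    moreover have "p * a * (\<xi> + \<xi> * t - \<xi>) = \<bar>\<xi>\<bar> powr p * (p * t)"
      by (simp add: a\<xi>[symmetric])
    ultimately have "(real n)\<^sup>2 * (\<bar>\<xi> + \<xi> * t\<bar> powr p - \<bar>\<xi>\<bar> powr p - p * a * (\<xi> + \<xi> * t - \<xi>))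
       = (real n)\<^sup>2 * (\<bar>\<xi>\<bar> powr p * \<bar>1 + t\<bar> powr p - \<bar>\<xi>\<bar> powr p - \<bar>\<xi>\<bar> powr p * (p * t))"
      by (simp only:)
    also have "\<dots> = real n * Y * (\<bar>1 + t\<bar> powr p - 1 - p * t)"
      by (simp add: Y_def power2_eq_square algebra_simps)
    finally show ?thesis by (simp only: g_def mult_minus_left)
  qed
  have "(\<integral>\<^sup>+z. g z \<partial>lborel) = ennreal \<bar>\<xi>\<bar> * (\<integral>\<^sup>+t. g (\<xi> + \<xi> * t) \<partial>lborel)"
    by (rule nn_integral_real_affine[OF gm \<xi>])
  also have "(\<integral>\<^sup>+t. g (\<xi> + \<xi> * t) \<partial>lborel)
    \<le> ennreal (2 * exp 1 / sqrt (real n * Y * (p - 1) / 8) + 2 * exp 1 / (real n * Y * (p - 1) / 8))"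
    unfolding gt using Y n by (intro nn_integral_bregman p) auto
  also have "\<dots> \<le> ennreal (4 * exp 1 / min 1 ((p - 1) / 8) / sqrt n * (exp Y / Y))"
    using bregman_factor_le[OF Y n, of "(p - 1) / 8"] p by (intro ennreal_leI) simp
  finally show ?thesis
    by (simp only: g_def ennreal_mult'[OF abs_ge_zero]) (simp add: mult_left_mono)
qed

text \<open>
  The half-space is bounded by the hyperplane through \<open>x\<close> whose normal
  \<open>a\<close> is the gradient direction of \<open>psum p n\<close> at \<open>x\<close>.
  On its part in the ball the linear term of \<open>psum\<close> is at least its value at
  \<open>x\<close>, so the sum of the Bregman divergences is at most
  \<open>psum p n z - psum p n x \<le> p * K / n\<close>.  The Chernoff bound
  with exponential rate \<open>n\<^sup>2\<close> then costs only
  \<open>exp (p * K * n)\<close>, while every coordinate contributes a factor of order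
  \<open>1 / sqrt n\<close>.
\<close>

lemma typical_halfspace:
  assumes p: "1 < p" and n: "1 \<le> n" and K: "1 \<le> K" and x: "x \<in> typical_set p K n"
  shows "\<exists>H\<in>halfspaces n. x \<in> H \<and>
    measure (lp_unif p n) H \<le> exp (p * K * n) * (cap_const p / sqrt n) ^ n"
proof -
  let ?L = "lborel_Rn n"
  define a where "a i = \<bar>x i\<bar> powr (p - 1) * sgn (x i)" for i
  define w where "w = typical_scale p n"
  define b where "b = min 1 ((p - 1) / 8)"
  have w: "0 < w" unfolding w_def by (rule typical_scale_pos[OF n])
  have b: "0 < b" using p by (simp add: b_def)
  have sc: "0 < spread_const" using spread_const_ge_1 by simp
  have xR: "x \<in> Rn n" and x0: "\<And>i. i < n \<Longrightarrow> x i \<noteq> 0"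
    and ps: "1 - p * K / n \<le> psum p n x" using x by (simp_all add: typical_set_def)
  define H where "H = {z \<in> Rn n. (\<Sum>i<n. - a i * z i) \<le> (\<Sum>i<n. - a i * x i)}"
  have Hs: "H \<in> sets ?L" unfolding H_def by (rule halfspace_sets) simp
  have "a 0 \<noteq> 0" using x0[of 0] n by (simp add: a_def sgn_zero_iff)
  then have Hh: "H \<in> halfspaces n"
    unfolding H_def halfspaces_def using n
    by (intro CollectI exI[of _ "\<lambda>i. - a i"] exI[of _ "\<Sum>i<n. - a i * x i"] exI[of _ 0] conjI refl) auto
  have xH: "x \<in> H" using xR by (simp add: H_def)
  define Y where "Y i = real n * \<bar>x i\<bar> powr p" for i
  have Y: "0 < Y i" if "i < n" for i using x0[OF that] n by (simp add: Y_def)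
  define q where "q = 4 * exp 1 / b / sqrt n"
  have q: "0 \<le> q" using b by (simp add: q_def)
  have nn: "0 \<le> \<bar>x i\<bar> * (q * (exp (Y i) / Y i))" if "i < n" for i
    using q Y[OF that] by (intro mult_nonneg_nonneg divide_nonneg_nonneg) auto
  have pY: "0 < (\<Prod>i<n. Y i)" using Y by (intro prod_pos) auto
  have pE: "0 \<le> (\<Prod>i<n. exp (Y i))" by (intro prod_nonneg) auto
  have "emeasure ?L (lp_ball p n \<inter> H) \<le> ennreal (exp (p * K * n)) *
     (\<Prod>i<n. \<integral>\<^sup>+z. ennreal (exp (- (real n)\<^sup>2 * (\<bar>z\<bar> powr p - \<bar>x i\<bar> powr p - p * a i * (z - x i)))) \<partial>lborel)"
  proof (intro emeasure_le_prod_nn_integral sets.Int lp_ball_sets Hs)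
    fix z assume z: "z \<in> lp_ball p n \<inter> H"
    then have z1: "psum p n z \<le> 1" using p by (simp add: lp_ball_eq_psum)
    have z2: "(\<Sum>i<n. a i * x i) \<le> (\<Sum>i<n. a i * z i)" using z by (simp add: H_def sum_negf)
    have "(\<Sum>i<n. \<bar>z i\<bar> powr p - \<bar>x i\<bar> powr p - p * a i * (z i - x i))
       = psum p n z - psum p n x - p * ((\<Sum>i<n. a i * z i) - (\<Sum>i<n. a i * x i))"
      by (simp add: psum_def sum_subtractf right_diff_distrib sum_distrib_left mult.assoc)
    also have "\<dots> \<le> psum p n z - psum p n x" using z2 p by simp
    also have "\<dots> \<le> p * K / n" using z1 ps by simp
    finally have "(real n)\<^sup>2 * (\<Sum>i<n. \<bar>z i\<bar> powr p - \<bar>x i\<bar> powr p - p * a i * (z i - x i)) \<le> (real n)\<^sup>2 * (p * K / n)"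
      by (intro mult_left_mono) auto
    also have "\<dots> = p * K * n" using n by (simp add: power2_eq_square)
    finally have "1 \<le> exp (p * K * n + - (real n)\<^sup>2 * (\<Sum>i<n. \<bar>z i\<bar> powr p - \<bar>x i\<bar> powr p - p * a i * (z i - x i)))"
      by simp
    also have "\<dots> = exp (p * K * n) * (\<Prod>i<n. exp (- (real n)\<^sup>2 * (\<bar>z i\<bar> powr p - \<bar>x i\<bar> powr p - p * a i * (z i - x i))))"
      unfolding exp_add sum_distrib_left by (subst exp_sum) simp_all
    finally have "1 \<le> exp (p * K * n) * (\<Prod>i<n. exp (- (real n)\<^sup>2 * (\<bar>z i\<bar> powr p - \<bar>x i\<bar> powr p - p * a i * (z i - x i))))" .
    then show "1 \<le> ennreal (exp (p * K * n)) * (\<Prod>i<n. ennreal (exp (- (real n)\<^sup>2 * (\<bar>z i\<bar> powr p - \<bar>x i\<bar> powr p - p * a i * (z i - x i)))))"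
      by (subst prod_ennreal) (simp_all add: ennreal_mult[symmetric] prod_nonneg)
  qed measurable
  also have "\<dots> \<le> ennreal (exp (p * K * n)) * (\<Prod>i<n. ennreal (\<bar>x i\<bar> * (q * (exp (Y i) / Y i))))"
    using tangent_factor_le[OF p n x0] unfolding a_def q_def b_def Y_def
    by (intro mult_left_mono prod_mono_ennreal) auto
  also have "\<dots> = ennreal (exp (p * K * n) * (\<Prod>i<n. \<bar>x i\<bar> * (q * (exp (Y i) / Y i))))"
    using nn by (subst prod_ennreal) (auto simp: ennreal_mult' simp del: times_divide_eq_right)
  finally have "measure (lp_unif p n) H
      \<le> exp (p * K * n) * (\<Prod>i<n. \<bar>x i\<bar> * (q * (exp (Y i) / Y i))) * (w / 2) ^ n"
    unfolding w_def using nn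
    by (intro measure_lp_unif_le[OF p n Hs]) (auto intro!: mult_nonneg_nonneg prod_nonneg)
  also have "\<dots> = exp (p * K * n) * ((\<Prod>i<n. w * \<bar>x i\<bar>) * (\<Prod>i<n. exp (Y i)) * (1 / (\<Prod>i<n. Y i)) * (q / 2) ^ n)"
    by (simp add: prod.distrib prod_dividef power_divide power_mult_distrib)
  also have "\<dots> \<le> exp (p * K * n) * (exp (real n) * exp (real n) * (spread_const powr (2 * p)) ^ n * (q / 2) ^ n)"
  proof (intro mult_left_mono mult_mono)
    note tp = typical_product[OF p n x K, folded w_def]
    show "(\<Prod>i<n. w * \<bar>x i\<bar>) \<le> exp (real n)" by (rule tp(2))
    show "(\<Prod>i<n. exp (Y i)) \<le> exp (real n)"
      using tp(3) by (simp add: Y_def exp_sum[symmetric])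
    have "(\<Prod>i<n. Y i) = (\<Prod>i<n. w * \<bar>x i\<bar>) powr p"
    proof -
      have "Y i = (w * \<bar>x i\<bar>) powr p" for i
        using typical_scale_powr[of p n "x i"] p n w by (simp add: Y_def w_def abs_mult)
      then show ?thesis using w by (simp add: prod_powr_real)
    qed
    also have "\<dots> \<ge> ((1 / spread_const\<^sup>2) ^ n) powr p"
      using tp(1) p sc by (intro powr_mono2) auto
    finally have "1 / (\<Prod>i<n. Y i) \<le> 1 / ((1 / spread_const\<^sup>2) ^ n) powr p"
      using sc pY by (intro divide_left_mono) (auto intro!: mult_pos_pos)
    also have "\<dots> = (spread_const powr (2 * p)) ^ n"
    proof -
      have "1 / spread_const\<^sup>2 = spread_const powr - 2"
        using sc by (simp add: powr_minus_divide)
      then have "(1 / spread_const\<^sup>2) ^ n = (spread_const powr - 2) powr n"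
        using sc by (simp add: powr_realpow)
      then have "((1 / spread_const\<^sup>2) ^ n) powr p = spread_const powr (- (2 * p * n))"
        by (simp only: powr_powr) (simp add: mult_ac)
      also have "\<dots> = 1 / (spread_const powr (2 * p)) powr n"
        by (simp only: powr_powr powr_minus_divide)
      finally show ?thesis using sc by (simp add: powr_realpow)
    qed
    finally show "1 / (\<Prod>i<n. Y i) \<le> (spread_const powr (2 * p)) ^ n" .
  qed (use q w pY pE in \<open>auto intro!: prod_nonneg mult_nonneg_nonneg\<close>)
  also have "\<dots> = exp (p * K * n) * (cap_const p / sqrt n) ^ n"
  proof -
    have e: "exp (real n) = exp 1 ^ n" using exp_of_nat_mult[of n "1::real"] by simp
    have "exp (1::real) * (exp 1 * exp 1) = exp 3" using exp_add[of 1 "2::real"] exp_add[of 1 "1::real"] by simp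
    then have "exp 1 * exp 1 * spread_const powr (2 * p) * (q / 2) = cap_const p / sqrt n"
      by (simp add: cap_const_def q_def b_def mult_ac)
    then show ?thesis unfolding e by (simp add: power_mult_distrib[symmetric])
  qed
  finally show ?thesis using Hh xH by blast
qed

section \<open>Regions around a typical point\<close>

text \<open>
  Normalise \<open>a\<close> to have largest entry \<open>8 * n\<close> in modulus and round
  down.  For \<open>u\<close> in the cube rounding changes the inner product by at most
  \<open>n\<close>, which is the margin in the assumption on \<open>k\<close>.
\<close>

lemma integer_direction_net:
  fixes a :: "nat \<Rightarrow> real" and n :: nat
  assumes a: "\<exists>i<n. a i \<noteq> 0"
  shows "\<exists>k \<in> {..<n} \<rightarrow>\<^sub>E {- 8 * int n..8 * int n}. (\<exists>i<n. 8 * real n \<le> \<bar>real_of_int (k i)\<bar>) \<and>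
    (\<forall>u. (\<forall>i<n. \<bar>u i\<bar> \<le> 1) \<longrightarrow> real n \<le> (\<Sum>i<n. real_of_int (k i) * u i) \<longrightarrow> 0 \<le> (\<Sum>i<n. a i * u i))"
proof -
  define M where "M = Max ((\<lambda>i. \<bar>a i\<bar>) ` {..<n})"
  have fin: "finite ((\<lambda>i. \<bar>a i\<bar>) ` {..<n})" "(\<lambda>i. \<bar>a i\<bar>) ` {..<n} \<noteq> {}" using a by auto
  have le: "\<bar>a i\<bar> \<le> M" if "i < n" for i unfolding M_def using that fin by (intro Max_ge) auto
  have "M \<in> (\<lambda>i. \<bar>a i\<bar>) ` {..<n}" unfolding M_def by (rule Max_in[OF fin])
  then obtain j where j: "j < n" "\<bar>a j\<bar> = M" by auto
  have M: "0 < M" using a le by (meson less_le_trans zero_less_abs_iff)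
  define L where "L = 8 * real n"
  define c where "c i = L / M * a i" for i
  have L: "0 \<le> L" "L = real_of_int (8 * int n)" by (simp_all add: L_def)
  have c: "\<bar>c i\<bar> \<le> L" if "i < n" for i
  proof -
    have "\<bar>c i\<bar> = L / M * \<bar>a i\<bar>" using L M by (simp add: c_def abs_mult)
    also have "\<dots> \<le> L / M * M" using L M le[OF that] by (intro mult_left_mono) auto
    finally show ?thesis using M by simp
  qed
  define k where "k = (\<lambda>i\<in>{..<n}. \<lfloor>c i\<rfloor>)"
  have "k \<in> {..<n} \<rightarrow>\<^sub>E {- 8 * int n..8 * int n}"
  proof (unfold k_def, intro restrict_PiE_iff[THEN iffD2] ballI)
    fix i assume "i \<in> {..<n}"
    then have "- L \<le> c i" "c i \<le> L" using c[of i] by auto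
    then show "\<lfloor>c i\<rfloor> \<in> {- 8 * int n..8 * int n}"
      by (auto simp: L_def le_floor_iff floor_le_iff)
  qed
  moreover have "8 * real n \<le> \<bar>real_of_int (k j)\<bar>"
  proof -
    have "c j = L \<or> c j = - L" using j M by (auto simp: c_def abs_if split: if_splits)
    then have "c j = real_of_int (8 * int n) \<or> c j = real_of_int (- 8 * int n)" using L(2) by auto
    then have "\<lfloor>c j\<rfloor> = 8 * int n \<or> \<lfloor>c j\<rfloor> = - 8 * int n" by (metis floor_of_int)
    then show ?thesis using j by (auto simp: k_def)
  qed
  moreover have "0 \<le> (\<Sum>i<n. a i * u i)"
    if u: "\<forall>i<n. \<bar>u i\<bar> \<le> 1" and ku: "real n \<le> (\<Sum>i<n. real_of_int (k i) * u i)" for u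
  proof -
    have "real n - real n \<le> (\<Sum>i<n. real_of_int (k i) * u i) + (\<Sum>i<n. (c i - real_of_int (k i)) * u i)"
    proof -
      have "\<bar>\<Sum>i<n. (c i - real_of_int (k i)) * u i\<bar> \<le> (\<Sum>i<n. 1)"
      proof (intro order_trans[OF sum_abs] sum_mono)
        fix i assume i: "i \<in> {..<n}"
        then have "\<bar>c i - real_of_int (k i)\<bar> \<le> 1" by (simp add: k_def) linarith
        then have "\<bar>c i - real_of_int (k i)\<bar> * \<bar>u i\<bar> \<le> 1 * 1" using u i by (intro mult_mono) auto
        then show "\<bar>(c i - real_of_int (k i)) * u i\<bar> \<le> 1" by (simp only: abs_mult)
      qed
      then show ?thesis using ku by simp
    qed
    also have "\<dots> = (\<Sum>i<n. c i * u i)" by (simp add: sum.distrib[symmetric] left_diff_distrib)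
    also have "\<dots> = L / M * (\<Sum>i<n. a i * u i)" by (simp add: c_def sum_distrib_left mult.assoc)
    finally have "0 \<le> L / M * (\<Sum>i<n. a i * u i)" by simp
    moreover have "0 < L / M" using M j by (simp add: L_def)
    ultimately show ?thesis using zero_le_mult_iff[of "L / M"] by auto
  qed
  ultimately show ?thesis using j(1) by blast
qed

definition region_const :: "real \<Rightarrow> real" where
  "region_const p = 5 * p * exp 3 * spread_const\<^sup>2"

lemma region_const_pos: "1 < p \<Longrightarrow> 0 < region_const p"
  using spread_const_ge_1 by (simp add: region_const_def)

lemma region_scale_ge_1:
  assumes p: "1 < p" and n: "1 \<le> n" and K: "1 \<le> K"
  shows "1 \<le> region_const p * K * sqrt (real n)"
proof -
  have "1 * 1 * 1 * 1 \<le> 5 * p * exp 3 * spread_const\<^sup>2"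
    using p spread_const_ge_1 by (intro mult_mono one_le_power) auto
  then have "1 * 1 * 1 \<le> region_const p * K * sqrt n"
    using K n unfolding region_const_def by (intro mult_mono) auto
  then show ?thesis by simp
qed

text \<open>
  Expand \<open>psum\<close> to second order.  The relative deviations are at most
  \<open>1 / (5 * p * K * sqrt n)\<close>, so the quadratic term uses at most half of
  the distance \<open>1 / (n * K)\<close> of \<open>psum p n x\<close> from 1; by
  assumption the linear term uses at most the other half.
\<close>

lemma local_box_in_ball:
  fixes K p :: real and u x :: "nat \<Rightarrow> real"
  assumes p: "1 < p" and n: "1 \<le> n" and K: "1 \<le> K" and ps: "psum p n x \<le> 1 - 1 / (n * K)"
  defines "\<tau> \<equiv> \<lambda>i. exp (- (real n * \<bar>x i\<bar> powr p)) / (5 * p * K * sqrt n)"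
  assumes u: "\<And>i. i < n \<Longrightarrow> \<bar>u i\<bar> \<le> 1"
    and lin: "\<bar>\<Sum>i<n. p * \<bar>x i\<bar> powr p * \<tau> i * u i\<bar> \<le> 1 / (2 * n * K)"
  shows "psum p n (\<lambda>i\<in>{..<n}. x i + x i * \<tau> i * u i) \<le> 1"
proof -
  have ps1: "psum p n x \<le> 1" using ps K n by (smt (verit) divide_nonneg_nonneg mult_nonneg_nonneg of_nat_0_le_iff)
  have sn: "1 \<le> sqrt n" "sqrt n * sqrt n = n" using n by auto
  \<comment> \<open>A common bound for all \<open>\<bar>p * (\<tau> i * u i)\<bar>\<close>; its
    square is at most half of \<open>1 / (n * K)\<close>.\<close>
  define e where "e = 1 / (5 * K * sqrt n)"
  have e: "0 < e" "e \<le> 1" "e\<^sup>2 \<le> 1 / (2 * n * K)"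
  proof -
    have "1 * 1 * 1 \<le> 5 * K * sqrt n" using sn K by (intro mult_mono) auto
    then show "0 < e" "e \<le> 1" by (auto simp: e_def divide_simps)
    have "K * 1 \<le> K * K" using K by (intro mult_left_mono) auto
    then have "real n * K \<le> real n * (K * K)" by (intro mult_left_mono) auto
    moreover have "0 \<le> real n * (K * K)" by simp
    ultimately have "2 * n * K \<le> 25 * (n * (K * K))" by (simp only: mult.assoc)
    also have "\<dots> = (5 * K * sqrt n)\<^sup>2" by (simp add: power_mult_distrib power2_eq_square)
    finally show "e\<^sup>2 \<le> 1 / (2 * n * K)"
      using K n by (simp add: e_def power_divide frac_le)
  qed
  have pt: "\<bar>p * (\<tau> i * u i)\<bar> \<le> e" if i: "i < n" for i
  proof -
    have "\<bar>p * (\<tau> i * u i)\<bar> = e * (exp (- (real n * \<bar>x i\<bar> powr p)) * \<bar>u i\<bar>)"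
      using p K by (simp add: \<tau>_def e_def abs_mult)
    also have "\<dots> \<le> e * (1 * 1)" using e u[OF i] by (intro mult_left_mono mult_mono) auto
    finally show ?thesis by simp
  qed
  have "psum p n (\<lambda>i\<in>{..<n}. x i + x i * \<tau> i * u i) \<le>
     (\<Sum>i<n. \<bar>x i\<bar> powr p + p * \<bar>x i\<bar> powr p * \<tau> i * u i + e\<^sup>2 * \<bar>x i\<bar> powr p)"
    unfolding psum_def
  proof (intro sum_mono)
    fix i assume i: "i \<in> {..<n}"
    have "\<bar>x i + x i * \<tau> i * u i\<bar> powr p = \<bar>x i\<bar> powr p * \<bar>1 + \<tau> i * u i\<bar> powr p"
    proof -
      have "x i + x i * \<tau> i * u i = x i * (1 + \<tau> i * u i)" by (simp add: distrib_left mult.assoc)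
      then show ?thesis by (simp add: abs_mult powr_mult)
    qed
    also have "\<dots> \<le> \<bar>x i\<bar> powr p * (1 + p * (\<tau> i * u i) + (p * (\<tau> i * u i))\<^sup>2)"
      using pt[of i] e i by (intro mult_left_mono powr_le_quadratic p) auto
    also have "\<dots> \<le> \<bar>x i\<bar> powr p * (1 + p * (\<tau> i * u i) + e\<^sup>2)"
      using pt[of i] e i by (intro mult_left_mono add_mono order_refl) (auto simp: abs_le_square_iff[symmetric])
    finally show "\<bar>(\<lambda>i\<in>{..<n}. x i + x i * \<tau> i * u i) i\<bar> powr p \<le>
       \<bar>x i\<bar> powr p + p * \<bar>x i\<bar> powr p * \<tau> i * u i + e\<^sup>2 * \<bar>x i\<bar> powr p"
      using i by (simp add: algebra_simps)
  qed
  also have "\<dots> = psum p n x + (\<Sum>i<n. p * \<bar>x i\<bar> powr p * \<tau> i * u i) + e\<^sup>2 * psum p n x"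
    by (simp add: psum_def sum.distrib sum_distrib_left)
  also have "\<dots> \<le> (1 - 1 / (n * K)) + 1 / (2 * n * K) + 1 / (2 * n * K) * 1"
    using lin ps ps1 e psum_nonneg[of p n x] K n by (intro add_mono mult_mono) auto
  also have "\<dots> = 1" using K n by (simp add: field_simps)
  finally show ?thesis .
qed

text \<open>
  The factors \<open>exp (- (n * \<bar>x i\<bar> powr p))\<close> in the side lengths
  make every coefficient of the linear term at most of order
  \<open>1 / (K * n * sqrt n)\<close>, since \<open>Y * exp (- Y) \<le> 1\<close>,
  so that Hoeffding's inequality applies uniformly in \<open>x\<close>.  They shrink the volume
  only by \<open>exp (- (n * psum p n x)) \<ge> exp (- n)\<close>.
\<close>

lemma typical_regions:
  fixes K p :: real and k :: "nat \<Rightarrow> real"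
  assumes p: "1 < p" and n: "1 \<le> n" and K: "1 \<le> K" and x: "x \<in> typical_set p K n"
    and k: "\<exists>i<n. 8 * real n \<le> \<bar>k i\<bar>"
  defines "\<rho> \<equiv> \<lambda>i. x i * (exp (- (real n * \<bar>x i\<bar> powr p)) / (5 * p * K * sqrt n))"
  shows "\<exists>R \<in> sets (lborel_Rn n). 1 / 4 * (1 / (region_const p * K * sqrt n)) ^ n \<le> measure (lp_unif p n) R \<and>
     (\<forall>z\<in>R. (\<forall>i<n. \<bar>(z i - x i) / \<rho> i\<bar> \<le> 1) \<and> real n \<le> (\<Sum>i<n. k i * ((z i - x i) / \<rho> i)))"
proof -
  let ?L = "lborel_Rn n"
  define \<tau> where "\<tau> i = exp (- (real n * \<bar>x i\<bar> powr p)) / (5 * p * K * sqrt n)" for i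
  have \<rho>: "\<rho> i = x i * \<tau> i" for i by (simp add: \<rho>_def \<tau>_def)
  have xR: "x \<in> Rn n" and x0: "\<And>i. i < n \<Longrightarrow> x i \<noteq> 0" and ps: "psum p n x \<le> 1 - 1 / (n * K)"
    using x by (simp_all add: typical_set_def)
  have pK: "0 < 5 * p * K * sqrt n" using p K n by simp
  have \<tau>: "0 < \<tau> i" for i using pK by (simp add: \<tau>_def)
  have \<rho>0: "\<rho> i \<noteq> 0" if "i < n" for i using x0[OF that] \<tau>[of i] by (simp add: \<rho>)
  define \<beta> where "\<beta> i = p * \<bar>x i\<bar> powr p * \<tau> i" for i
  define s where "s = 1 / (2 * n * K)"
  define A where "A = {u \<in> space (cube_measure n). real n \<le> (\<Sum>i<n. k i * u i) \<and> \<bar>\<Sum>i<n. \<beta> i * u i\<bar> \<le> s}"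
  define R where "R = {z \<in> Rn n. (\<forall>i<n. \<bar>(z i - x i) / \<rho> i\<bar> \<le> 1) \<and>
      real n \<le> (\<Sum>i<n. k i * ((z i - x i) / \<rho> i)) \<and> \<bar>\<Sum>i<n. \<beta> i * ((z i - x i) / \<rho> i)\<bar> \<le> s}"
  have spc: "space (cube_measure n) = Rn n" by (simp add: space_PiM)
  have "{z \<in> space ?L. (\<forall>i\<in>{..<n}. \<bar>(z i - x i) / \<rho> i\<bar> \<le> 1) \<and>
      real n \<le> (\<Sum>i<n. k i * ((z i - x i) / \<rho> i)) \<and> \<bar>\<Sum>i<n. \<beta> i * ((z i - x i) / \<rho> i)\<bar> \<le> s} \<in> sets ?L"
    by measurable
  then have Rs: "R \<in> sets ?L" by (simp add: R_def space_PiM)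
  have "{u \<in> space ?L. real n \<le> (\<Sum>i<n. k i * u i) \<and> \<bar>\<Sum>i<n. \<beta> i * u i\<bar> \<le> s} \<in> sets ?L" by measurable
  then have As: "A \<in> sets ?L" by (simp add: A_def space_PiM)
  \<comment> \<open>In the coordinates \<open>u i = (z i - x i) / \<rho> i\<close> the box is
    the cube and the region is the set of \<open>cube_cap_measure_ge\<close>.\<close>
  have pre: "{u \<in> Rn n. (\<lambda>i\<in>{..<n}. x i + \<rho> i * u i) \<in> R} = PiE {..<n} (\<lambda>_. {-1..1}) \<inter> A"
  proof -
    have rw: "((\<lambda>i\<in>{..<n}. x i + \<rho> i * u i) i - x i) / \<rho> i = u i" if "i < n" for u i
      using \<rho>0[OF that] that by simp
    have "(\<lambda>i\<in>{..<n}. x i + \<rho> i * u i) \<in> R \<longleftrightarrow>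
       (\<forall>i<n. \<bar>u i\<bar> \<le> 1) \<and> real n \<le> (\<Sum>i<n. k i * u i) \<and> \<bar>\<Sum>i<n. \<beta> i * u i\<bar> \<le> s" for u
    proof -
      have "(\<Sum>i<n. c i * (((\<lambda>i\<in>{..<n}. x i + \<rho> i * u i) i - x i) / \<rho> i)) = (\<Sum>i<n. c i * u i)" for c
        by (intro sum.cong refl) (simp only: rw lessThan_iff)
      moreover have "(\<forall>i<n. \<bar>((\<lambda>i\<in>{..<n}. x i + \<rho> i * u i) i - x i) / \<rho> i\<bar> \<le> 1) = (\<forall>i<n. \<bar>u i\<bar> \<le> 1)"
        by (intro all_cong) (simp only: rw)
      moreover have "(\<lambda>i\<in>{..<n}. x i + \<rho> i * u i) \<in> Rn n" by simp
      ultimately show ?thesis by (simp only: R_def mem_Collect_eq simp_thms)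
    qed
    moreover have "u \<in> PiE {..<n} (\<lambda>_. {-1..1}) \<longleftrightarrow> u \<in> Rn n \<and> (\<forall>i<n. \<bar>u i\<bar> \<le> 1)" for u :: "nat \<Rightarrow> real"
      by (simp add: PiE_iff abs_le_iff Ball_def) (smt (verit))
    ultimately show ?thesis by (intro set_eqI) (simp only: Int_iff mem_Collect_eq A_def spc simp_thms, blast)
  qed
  have RB: "R \<subseteq> lp_ball p n"
  proof
    fix z assume z: "z \<in> R"
    define u where "u i = (z i - x i) / \<rho> i" for i
    have zu: "z = (\<lambda>i\<in>{..<n}. x i + x i * \<tau> i * u i)"
    proof
      fix i
      show "z i = (\<lambda>i\<in>{..<n}. x i + x i * \<tau> i * u i) i"
      proof (cases "i < n")
        case True
        then show ?thesis using \<rho>0[OF True] by (simp add: u_def \<rho>[symmetric])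
      next
        case False
        have "z \<in> Rn n" using z unfolding R_def by blast
        from PiE_arb[OF this, of i] have "z i = undefined" using False by simp
        then show ?thesis using False by simp
      qed
    qed
    have u1: "\<bar>u i\<bar> \<le> 1" if "i < n" for i using z that unfolding R_def u_def by blast
    have u2: "\<bar>\<Sum>i<n. \<beta> i * u i\<bar> \<le> s" using z unfolding R_def u_def by blast
    have "psum p n (\<lambda>i\<in>{..<n}. x i + x i * \<tau> i * u i) \<le> 1"
      unfolding \<tau>_def
      by (rule local_box_in_ball[where u = u, OF p n K ps]) (erule u1, use u2 in \<open>simp add: \<beta>_def \<tau>_def s_def\<close>)
    then have "psum p n z \<le> 1" by (simp only: zu[symmetric])
    moreover have "z \<in> Rn n" using z unfolding R_def by blast
    ultimately show "z \<in> lp_ball p n" using p by (simp add: lp_ball_eq_psum)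
  qed
  have half: "1 / 4 \<le> measure (cube_measure n) A"
    unfolding A_def
  proof (rule cube_cap_measure_ge)
    have \<beta>pos: "0 < \<beta> i" if "i < n" for i using x0[OF that] p \<tau>[of i] by (simp add: \<beta>_def)
    then show "0 < (\<Sum>i<n. (\<beta> i)\<^sup>2)" using n by (intro sum_pos) (use n in \<open>auto simp: lessThan_empty_iff dest: less_imp_neq[OF \<beta>pos, symmetric]\<close>)
    have bl: "\<beta> i \<le> 1 / (5 * K * n * sqrt n)" for i
    proof -
      define Y where "Y = real n * \<bar>x i\<bar> powr p"
      have "Y \<le> exp Y" using exp_ge_add_one_self[of Y] by linarith
      then have Y1: "Y * exp (- Y) \<le> 1" by (simp add: exp_minus field_simps)
      have "\<beta> i = Y * exp (- Y) / (5 * K * n * sqrt n)"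
        using p n by (simp add: \<beta>_def \<tau>_def Y_def field_simps)
      also have "\<dots> \<le> 1 / (5 * K * n * sqrt n)" using Y1 K by (intro divide_right_mono) auto
      finally show ?thesis .
    qed
    have "(\<Sum>i<n. (\<beta> i)\<^sup>2) \<le> (\<Sum>i<n. (1 / (5 * K * n * sqrt n))\<^sup>2)"
      using bl \<beta>pos by (intro sum_mono power_mono) (auto intro: less_imp_le)
    also have "\<dots> = 1 / (25 * K\<^sup>2 * n\<^sup>2)"
      using n by (simp add: power_divide power_mult_distrib power2_eq_square)
    finally have "6 * (\<Sum>i<n. (\<beta> i)\<^sup>2) \<le> 6 * (1 / (25 * K\<^sup>2 * n\<^sup>2))" by simp
    also have "\<dots> \<le> s\<^sup>2" using K n by (simp add: s_def power_divide power_mult_distrib field_simps)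
    finally show "6 * (\<Sum>i<n. (\<beta> i)\<^sup>2) \<le> s\<^sup>2" .
  qed (use n K k in \<open>auto simp: s_def\<close>)
  interpret Q: prob_space "cube_measure n" by (intro prob_space_PiM prob_space_sym_interval)
  define Pr where "Pr = (\<Prod>i<n. \<bar>\<rho> i\<bar>)"
  have Pr0: "0 \<le> Pr" unfolding Pr_def by (intro prod_nonneg) auto
  have "emeasure ?L R = ennreal Pr * (2 ^ n * emeasure (cube_measure n) A)"
    using emeasure_affine[of n \<rho> R x] \<rho>0 Rs pre emeasure_cube[OF As] by (simp add: prod_ennreal Pr_def)
  also have "\<dots> = ennreal (Pr * (2 ^ n * measure (cube_measure n) A))"
    using Pr0 by (simp add: Q.emeasure_eq_measure ennreal_mult ennreal_power flip: ennreal_numeral)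
  finally have LR_eq: "measure ?L R = Pr * (2 ^ n * measure (cube_measure n) A)"
    using Pr0 by (simp add: measure_def)
  then have LR: "Pr * (2 ^ n * (1 / 4)) \<le> measure ?L R"
    unfolding LR_eq using half Pr0 by (intro mult_left_mono) auto
  define w where "w = typical_scale p n"
  have w: "0 < w" unfolding w_def by (rule typical_scale_pos[OF n])
  note tp = typical_product[OF p n x K, folded w_def]
  have Prw: "(1 / (exp 1 * spread_const\<^sup>2 * (5 * p * K * sqrt n))) ^ n \<le> w ^ n * Pr"
  proof -
    have "w ^ n * Pr = (\<Prod>i<n. w * \<bar>x i\<bar>) * (\<Prod>i<n. exp (- (real n * \<bar>x i\<bar> powr p))) * (1 / (5 * p * K * sqrt n)) ^ n"
      using p K by (simp add: Pr_def \<rho> \<tau>_def abs_mult prod.distrib prod_dividef power_divide)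
    moreover have "exp (- real n) \<le> (\<Prod>i<n. exp (- (real n * \<bar>x i\<bar> powr p)))"
      using tp(3) by (simp add: exp_sum[symmetric] sum_negf)
    ultimately have "(1 / spread_const\<^sup>2) ^ n * exp (- real n) * (1 / (5 * p * K * sqrt n)) ^ n \<le> w ^ n * Pr"
      using tp(1) pK w by (auto intro!: mult_mono mult_nonneg_nonneg prod_nonneg)
    also have "exp (- real n) = (1 / exp 1) ^ n"
      using exp_of_nat_mult[of n "-1::real"] by (simp add: exp_minus field_simps)
    finally show ?thesis by (simp add: power_mult_distrib[symmetric] mult_ac)
  qed
  have "1 / 4 * (1 / (region_const p * K * sqrt n)) ^ n
      = 1 / 4 * ((1 / (exp 1 * spread_const\<^sup>2 * (5 * p * K * sqrt n))) ^ n * (1 / exp 2) ^ n)"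
    using exp_add[of 1 "2::real"] by (simp add: region_const_def power_mult_distrib[symmetric] mult_ac)
  also have "\<dots> \<le> 1 / 4 * (w ^ n * Pr * (1 / exp 2) ^ n)"
    using Prw by (intro mult_left_mono mult_right_mono) auto
  also have "\<dots> = Pr * (2 ^ n * (1 / 4)) / (2 * exp 2 / w) ^ n"
    using w by (simp add: power_divide power_mult_distrib field_simps)
  also have "\<dots> \<le> measure ?L R / ball_volume p n"
    using LR ball_volume(3)[OF p n] ball_volume_pos[OF p n] Pr0 unfolding w_def by (intro frac_le) auto
  also have "\<dots> = measure (lp_unif p n) R"
    using measure_lp_unif[OF p n Rs] RB by (simp add: Int_absorb1)
  finally have "1 / 4 * (1 / (region_const p * K * sqrt n)) ^ n \<le> measure (lp_unif p n) R" .
  moreover have "\<forall>z\<in>R. (\<forall>i<n. \<bar>(z i - x i) / \<rho> i\<bar> \<le> 1) \<and> real n \<le> (\<Sum>i<n. k i * ((z i - x i) / \<rho> i))"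
    unfolding R_def by blast
  ultimately show ?thesis using Rs by blast
qed

text \<open>
  The regions of \<open>typical_regions\<close> belonging to the integer vectors
  \<open>k\<close> of \<open>integer_direction_net\<close> form the finite family needed for
  \<open>hull_miss_probability_le\<close>.
\<close>

lemma typical_hull_miss:
  fixes K p :: real
  assumes p: "1 < p" and n: "1 \<le> n" and K: "1 \<le> K" and x: "x \<in> typical_set p K n" and N: "1 \<le> N"
  shows "measure (PiM {..<N} (\<lambda>_. lp_unif p n))
      {X \<in> space (PiM {..<N} (\<lambda>_. lp_unif p n)). x \<notin> convex_Rn n hull (X ` {..<N})}
    \<le> (17 * real n) ^ n * (1 - 1 / 4 * (1 / (region_const p * K * sqrt n)) ^ n) ^ N"
proof -
  define m where "m = 1 / 4 * (1 / (region_const p * K * sqrt n)) ^ n"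
  define \<rho> where "\<rho> i = x i * (exp (- (real n * \<bar>x i\<bar> powr p)) / (5 * p * K * sqrt n))" for i
  have xR: "x \<in> Rn n" and x0: "\<And>i. i < n \<Longrightarrow> x i \<noteq> 0" using x by (simp_all add: typical_set_def)
  have \<rho>0: "\<rho> i \<noteq> 0" if "i < n" for i using x0[OF that] p K n by (simp add: \<rho>_def)
  define D where "D = {k \<in> {..<n} \<rightarrow>\<^sub>E {- 8 * int n..8 * int n}. \<exists>i<n. 8 * real n \<le> \<bar>real_of_int (k i)\<bar>}"
  have finD: "finite ({..<n} \<rightarrow>\<^sub>E {- 8 * int n..8 * int n})" by (intro finite_PiE) auto
  have D: "finite D" unfolding D_def using finD by simp
  have "\<forall>k\<in>D. \<exists>R. R \<in> sets (lborel_Rn n) \<and> m \<le> measure (lp_unif p n) R \<and>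
     (\<forall>z\<in>R. (\<forall>i<n. \<bar>(z i - x i) / \<rho> i\<bar> \<le> 1) \<and> real n \<le> (\<Sum>i<n. real_of_int (k i) * ((z i - x i) / \<rho> i)))"
  proof
    fix k assume "k \<in> D"
    then have "\<exists>i<n. 8 * real n \<le> \<bar>real_of_int (k i)\<bar>" by (simp add: D_def)
    from typical_regions[OF p n K x this]
    show "\<exists>R. R \<in> sets (lborel_Rn n) \<and> m \<le> measure (lp_unif p n) R \<and>
     (\<forall>z\<in>R. (\<forall>i<n. \<bar>(z i - x i) / \<rho> i\<bar> \<le> 1) \<and> real n \<le> (\<Sum>i<n. real_of_int (k i) * ((z i - x i) / \<rho> i)))"
      unfolding m_def \<rho>_def by blast
  qed
  then obtain R where R: "\<And>k. k \<in> D \<Longrightarrow> R k \<in> sets (lborel_Rn n)" "\<And>k. k \<in> D \<Longrightarrow> m \<le> measure (lp_unif p n) (R k)"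
    "\<And>k z. k \<in> D \<Longrightarrow> z \<in> R k \<Longrightarrow> (\<forall>i<n. \<bar>(z i - x i) / \<rho> i\<bar> \<le> 1) \<and> real n \<le> (\<Sum>i<n. real_of_int (k i) * ((z i - x i) / \<rho> i))"
    unfolding bchoice_iff by blast
  have prob: "prob_space (lp_unif p n)" using p n by (intro prob_space_lp_unif) auto
  have sl: "sets (lp_unif p n) = sets (lborel_Rn n)" by (rule sets_lp_unif)
  note rc = region_scale_ge_1[OF p n K]
  have m: "0 \<le> m" "m \<le> 1"
  proof -
    show "0 \<le> m" using rc by (simp add: m_def)
    have "(1 / (region_const p * K * sqrt n)) ^ n \<le> 1" using rc by (intro power_le_one) auto
    then show "m \<le> 1" by (simp add: m_def)
  qed
  have "measure (PiM {..<N} (\<lambda>_. lp_unif p n))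
      {X \<in> space (PiM {..<N} (\<lambda>_. lp_unif p n)). x \<notin> convex_Rn n hull (X ` {..<N})}
    \<le> real (card (R ` D)) * (1 - m) ^ N"
  proof (rule hull_miss_probability_le[OF prob sl N xR _ m(2)])
    show "finite (R ` D)" using D by simp
    show "\<And>S. S \<in> R ` D \<Longrightarrow> S \<in> sets (lp_unif p n) \<and> m \<le> measure (lp_unif p n) S"
      using R(1,2) by (auto simp: sl)
    fix a :: "nat \<Rightarrow> real" assume a: "\<exists>i<n. a i \<noteq> 0"
    then have "\<exists>i<n. - (a i * \<rho> i) \<noteq> 0" using \<rho>0 by auto
    from integer_direction_net[OF this] obtain k where k: "k \<in> D"
      and ku: "\<And>u. (\<forall>i<n. \<bar>u i\<bar> \<le> 1) \<Longrightarrow> real n \<le> (\<Sum>i<n. real_of_int (k i) * u i) \<Longrightarrow> 0 \<le> (\<Sum>i<n. - (a i * \<rho> i) * u i)"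
      unfolding D_def by blast
    have "(\<Sum>i<n. a i * (z i - x i)) \<le> 0" if z: "z \<in> R k" for z
    proof -
      have "0 \<le> (\<Sum>i<n. - (a i * \<rho> i) * ((z i - x i) / \<rho> i))"
        using R(3)[OF k z] by (intro ku) auto
      also have "\<dots> = (\<Sum>i<n. - (a i * (z i - x i)))"
        using \<rho>0 by (intro sum.cong) auto
      finally show ?thesis by (simp add: sum_negf)
    qed
    then show "\<exists>S\<in>R ` D. \<forall>z\<in>S. (\<Sum>i<n. a i * (z i - x i)) \<le> 0" using k by blast
  qed
  also have "\<dots> \<le> (17 * real n) ^ n * (1 - m) ^ N"
  proof (intro mult_right_mono)
    have "card (R ` D) \<le> card D" by (rule card_image_le[OF D])
    also have "\<dots> \<le> card ({..<n} \<rightarrow>\<^sub>E {- 8 * int n..8 * int n})"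
      unfolding D_def using finD by (intro card_mono) auto
    also have "\<dots> = (16 * n + 1) ^ n" by (subst card_PiE) (auto simp: nat_add_distrib nat_mult_distrib)
    also have "\<dots> \<le> (17 * n) ^ n" using n by (intro power_mono) auto
    finally have "real (card (R ` D)) \<le> real ((17 * n) ^ n)" by (rule of_nat_mono)
    then show "real (card (R ` D)) \<le> (17 * real n) ^ n" by simp
  qed (use m in simp)
  finally show ?thesis by (simp only: m_def)
qed

section \<open>Expected logarithmic depth and sharp threshold\<close>

definition atypical_bound :: "real \<Rightarrow> nat \<Rightarrow> real" where
  "atypical_bound K n = exp (- K) + 1 / K + (1 / 2) ^ n"

lemma typical_probability:
  assumes p: "1 < p" and n: "2 \<le> n" and K: "1 \<le> K" "K < real n"
  shows "1 - atypical_bound K n \<le> measure (lp_unif p n) (typical_set p K n)"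
proof -
  interpret prob_space "lp_unif p n" using p n by (intro prob_space_lp_unif) auto
  have "typical_set p K n \<in> events" by (simp add: sets_lp_unif typical_set_sets)
  from prob_compl[OF this] typical_set_measure[OF p n K] show ?thesis by (simp add: atypical_bound_def)
qed

lemma tukey_depth_le:
  assumes "H \<in> halfspaces n" "x \<in> H"
  shows "tukey_depth n \<mu> x \<le> measure \<mu> H"
  unfolding tukey_depth_def using assms
  by (intro cInf_lower bdd_belowI[of _ 0]) auto

lemma tukey_depth_nonneg:
  assumes "H \<in> halfspaces n" "x \<in> H"
  shows "0 \<le> tukey_depth n \<mu> x"
  unfolding tukey_depth_def using assms
  by (intro cInf_greatest) auto

lemma depth_bound_exp:
  assumes p: "1 < p" and n: "1 \<le> n"
  shows "exp (p * K * n) * (cap_const p / sqrt n) ^ n = exp (- (n / 2 * ln n - (p * K + ln (cap_const p)) * n))"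
proof -
  have c: "0 < cap_const p" by (rule cap_const_pos[OF p])
  have "(cap_const p / sqrt n) ^ n = exp (ln (cap_const p / sqrt n)) ^ n" using c n by simp
  also have "\<dots> = exp (n * ln (cap_const p / sqrt n))" by (rule exp_of_nat_mult[symmetric])
  also have "ln (cap_const p / sqrt n) = ln (cap_const p) - ln n / 2"
    using c n by (simp add: ln_div ln_sqrt)
  finally show ?thesis by (simp add: exp_add[symmetric] algebra_simps)
qed

lemma ereal_le_enn2ereal:
  assumes "ennreal r \<le> X"
  shows "ereal r \<le> enn2ereal X"
proof (cases "0 \<le> r")
  case True
  then have "ereal r = enn2ereal (ennreal r)" by (simp add: enn2ereal_ennreal)
  also have "\<dots> \<le> enn2ereal X" using assms by (simp add: less_eq_ennreal.rep_eq)
  finally show ?thesis .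
next
  case False
  then have "ereal r \<le> 0" by simp
  also have "0 \<le> enn2ereal X" by simp
  finally show ?thesis .
qed

text \<open>
  For \<open>K = 4\<close> the typical set has measure at least \<open>1 / 4\<close> as
  soon as \<open>n \<ge> 5\<close>, and on it the depth is at most
  \<open>exp (- (n / 2 * ln n - O(n)))\<close>.  For smaller \<open>n\<close> the
  constant \<open>c\<close> makes the lower bound nonpositive.
\<close>

lemma expected_neg_log_depth:
  assumes p: "1 < p"
  shows "\<exists>C>0. \<exists>c>0. \<forall>n\<ge>1.
            enn2ereal (\<integral>\<^sup>+x. neg_log (tukey_depth n (lp_unif p n) x) \<partial>(lp_unif p n))
              \<ge> ereal (C * real n * ln (real n) - c * real n)"
proof -
  define A where "A = p * 4 + ln (cap_const p)"
  define c where "c = 1 + \<bar>A\<bar>"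
  have "enn2ereal (\<integral>\<^sup>+x. neg_log (tukey_depth n (lp_unif p n) x) \<partial>(lp_unif p n))
              \<ge> ereal (1 / 8 * real n * ln (real n) - c * real n)" if n: "1 \<le> n" for n
  proof (rule ereal_le_enn2ereal, cases "5 \<le> n")
    case False
    have "ln (real n) \<le> real n - 1" using n by (intro ln_le_minus_one) auto
    also have "\<dots> \<le> 8 * 1" using False by simp
    also have "\<dots> \<le> 8 * c" by (simp add: c_def)
    finally have "real n * ln (real n) \<le> real n * (8 * c)" by (intro mult_left_mono) auto
    then have "1 / 8 * real n * ln (real n) - c * real n \<le> 0" by (simp add: mult_ac)
    then show "ennreal (1 / 8 * real n * ln (real n) - c * real n)
      \<le> (\<integral>\<^sup>+x. neg_log (tukey_depth n (lp_unif p n) x) \<partial>(lp_unif p n))" by (simp add: ennreal_neg)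
  next
    case True
    interpret prob_space "lp_unif p n" using p n by (intro prob_space_lp_unif) auto
    define L where "L = n / 2 * ln n - A * n"
    define G where "G = typical_set p 4 n"
    have G: "G \<in> events" by (simp add: G_def sets_lp_unif typical_set_sets)
    have "1 - atypical_bound 4 n \<le> prob G"
      unfolding G_def using True by (intro typical_probability p) auto
    moreover have "atypical_bound 4 n \<le> 3 / 4"
    proof -
      have "1 + 4 \<le> exp (4::real)" by (rule exp_ge_add_one_self)
      then have "exp (- 4::real) \<le> 1 / 4" by (simp add: exp_minus field_simps)
      moreover have "(1 / 2::real) ^ n \<le> (1 / 2) ^ 2" using True by (intro power_decreasing) auto
      ultimately show ?thesis by (simp add: atypical_bound_def power2_eq_square)
    qed
    ultimately have PG: "1 / 4 \<le> prob G" by linarith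
    have "ennreal (1 / 8 * real n * ln (real n) - c * real n) \<le> ennreal (L * (1 / 4))"
    proof (intro ennreal_leI)
      have "A * real n \<le> \<bar>A\<bar> * real n" by (intro mult_right_mono) auto
      then have "A * real n / 4 \<le> c * real n"
        using mult_nonneg_nonneg[OF abs_ge_zero[of A] of_nat_0_le_iff[of n]]
        unfolding c_def distrib_right by linarith
      then show "1 / 8 * real n * ln (real n) - c * real n \<le> L * (1 / 4)"
        by (simp add: L_def left_diff_distrib)
    qed
    also have "\<dots> = ennreal L * ennreal (1 / 4)" by (rule ennreal_mult'') simp
    also have "\<dots> \<le> ennreal L * emeasure (lp_unif p n) G"
      using PG by (intro mult_left_mono) (auto simp: emeasure_eq_measure intro: ennreal_leI)
    also have "\<dots> = (\<integral>\<^sup>+x. ennreal L * indicator G x \<partial>lp_unif p n)"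
      using G by (simp add: nn_integral_cmult_indicator)
    also have "\<dots> \<le> (\<integral>\<^sup>+x. neg_log (tukey_depth n (lp_unif p n) x) \<partial>lp_unif p n)"
    proof (intro nn_integral_mono)
      fix x
      show "ennreal L * indicator G x \<le> neg_log (tukey_depth n (lp_unif p n) x)"
      proof (cases "x \<in> G")
        case x: True
        define q where "q = tukey_depth n (lp_unif p n) x"
        obtain H where H: "H \<in> halfspaces n" "x \<in> H"
          "measure (lp_unif p n) H \<le> exp (p * 4 * n) * (cap_const p / sqrt n) ^ n"
          using typical_halfspace[OF p n, of 4 x] x by (auto simp: G_def)
        have "q \<le> exp (p * 4 * n) * (cap_const p / sqrt n) ^ n"
          using tukey_depth_le[OF H(1,2), of "lp_unif p n"] H(3) unfolding q_def by linarith
        also have "\<dots> = exp (- L)" unfolding depth_bound_exp[OF p n] L_def A_def by simp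
        finally have q: "q \<le> exp (- L)" .
        have q0: "0 \<le> q" unfolding q_def by (rule tukey_depth_nonneg[OF H(1,2)])
        have "L \<le> - ln q" if "q \<noteq> 0"
        proof -
          have "ln q \<le> ln (exp (- L))" using q q0 that by (intro ln_mono) auto
          then show ?thesis by simp
        qed
        then show ?thesis
          using x by (auto simp: neg_log_def q_def[symmetric] intro: ennreal_leI)
      qed simp
    qed
    finally show "ennreal (1 / 8 * real n * ln (real n) - c * real n)
      \<le> (\<integral>\<^sup>+x. neg_log (tukey_depth n (lp_unif p n) x) \<partial>(lp_unif p n))" .
  qed
  moreover have "0 < c" by (simp add: c_def add_pos_nonneg)
  ultimately show ?thesis by (intro exI[of _ "1 / 8"] exI[of _ c] conjI) auto
qed

text \<open>
  The hypothesis on \<open>r\<close> says that \<open>exp r\<close> times the depth bound of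
  \<open>typical_halfspace\<close> is at most \<open>exp (- n)\<close>.
\<close>

lemma few_points_hull:
  assumes p: "1 < p" and n: "2 \<le> n" and K: "1 \<le> K" "K < real n" and N: "1 \<le> N"
    and Nr: "real N \<le> exp r" and r: "r + (p * K + ln (cap_const p) + 1) * n \<le> n / 2 * ln n"
  shows "expected_hull_measure n (lp_unif p n) N \<le> atypical_bound K n + exp (- real n)"
proof -
  have n1: "1 \<le> n" using n by simp
  define s where "s = exp (p * K * n) * (cap_const p / sqrt n) ^ n"
  have s: "0 \<le> s" using cap_const_pos[OF p] by (simp add: s_def)
  have pr: "prob_space (lp_unif p n)" using p n1 by (intro prob_space_lp_unif) auto
  have "expected_hull_measure n (lp_unif p n) N
     \<le> measure (lp_unif p n) (space (lp_unif p n) - typical_set p K n) + real N * s"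
  proof (rule expected_hull_measure_le[OF pr sets_lp_unif N _ s])
    show "typical_set p K n \<in> sets (lp_unif p n)" by (simp add: sets_lp_unif typical_set_sets)
    show "\<exists>H\<in>halfspaces n. y \<in> H \<and> measure (lp_unif p n) H \<le> s" if "y \<in> typical_set p K n" for y
      unfolding s_def by (rule typical_halfspace[OF p n1 K(1) that])
  qed
  also have "\<dots> \<le> atypical_bound K n + exp r * s"
    unfolding atypical_bound_def using Nr s by (intro add_mono mult_right_mono typical_set_measure p n K)
  also have "exp r * s = exp (r - (n / 2 * ln n - (p * K + ln (cap_const p)) * n))"
    unfolding s_def depth_bound_exp[OF p n1] by (simp add: exp_add[symmetric])
  also have "\<dots> \<le> exp (- real n)" using r by (simp add: algebra_simps)
  finally show ?thesis by simp
qed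

text \<open>
  The hypothesis on \<open>r\<close> makes the expected number \<open>m * N\<close> of sample
  points in a region of measure \<open>m\<close> at least \<open>exp n\<close>.  The
  probability \<open>exp (- m * N)\<close> of missing a given region then beats the number
  \<open>(17 * n) ^ n\<close> of regions.
\<close>

lemma many_points_hull:
  assumes p: "1 < p" and n: "2 \<le> n" and K: "1 \<le> K" "K < real n" and N: "1 \<le> N"
    and Nr: "exp r \<le> real N"
    and r: "n / 2 * ln n + (ln (region_const p * K) + ln 4 + 1) * n \<le> r"
    and n': "n * ln (17 * n) + n \<le> exp (real n)"
  shows "1 - (atypical_bound K n + exp (- real n)) \<le> expected_hull_measure n (lp_unif p n) N"
proof -
  have n1: "1 \<le> n" using n by simp
  define m where "m = 1 / 4 * (1 / (region_const p * K * sqrt n)) ^ n"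
  define \<eta> where "\<eta> = (17 * real n) ^ n * \<bar>1 - m\<bar> ^ N"
  have pr: "prob_space (lp_unif p n)" using p n1 by (intro prob_space_lp_unif) auto
  have Rp: "0 < region_const p" by (rule region_const_pos[OF p])
  have "measure (lp_unif p n) (typical_set p K n) - \<eta> \<le> expected_hull_measure n (lp_unif p n) N"
  proof (rule expected_hull_measure_ge[OF pr sets_lp_unif N])
    show "typical_set p K n \<in> sets (lp_unif p n)" by (simp add: sets_lp_unif typical_set_sets)
    show "0 \<le> \<eta>" by (simp add: \<eta>_def)
    fix y assume "y \<in> typical_set p K n"
    from typical_hull_miss[OF p n1 K(1) this N]
    have "measure (PiM {..<N} (\<lambda>_. lp_unif p n))
        {X \<in> space (PiM {..<N} (\<lambda>_. lp_unif p n)). y \<notin> convex_Rn n hull (X ` {..<N})}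
       \<le> (17 * real n) ^ n * (1 - m) ^ N" by (simp only: m_def)
    also have "\<dots> \<le> \<eta>" unfolding \<eta>_def
      by (intro mult_left_mono) (simp_all flip: power_abs)
    finally show "measure (PiM {..<N} (\<lambda>_. lp_unif p n))
        {X \<in> space (PiM {..<N} (\<lambda>_. lp_unif p n)). y \<notin> convex_Rn n hull (X ` {..<N})} \<le> \<eta>" .
  qed
  moreover have "1 - atypical_bound K n \<le> measure (lp_unif p n) (typical_set p K n)"
    by (rule typical_probability[OF p n K])
  moreover have "\<eta> \<le> exp (- real n)"
  proof -
    have RK: "0 < region_const p * K" using Rp K by simp
    have mexp: "m = exp (- ln 4 - n * (ln (region_const p * K) + ln n / 2))"
    proof -
      have "(1 / (region_const p * K * sqrt n)) ^ n = exp (ln (1 / (region_const p * K * sqrt n))) ^ n"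
        using RK n by simp
      also have "\<dots> = exp (n * ln (1 / (region_const p * K * sqrt n)))" by (rule exp_of_nat_mult[symmetric])
      also have "ln (1 / (region_const p * K * sqrt n)) = - (ln (region_const p * K) + ln n / 2)"
        using Rp K RK n ln_mult[of "region_const p * K" "sqrt n"] by (simp add: ln_div ln_sqrt)
      finally have "m = exp (- ln 4) * exp (n * - (ln (region_const p * K) + ln n / 2))"
        by (simp only: m_def) (simp add: exp_minus)
      then show ?thesis by (simp only: exp_add[symmetric]) (simp add: algebra_simps)
    qed
    have "real n \<le> - ln 4 - n * (ln (region_const p * K) + ln n / 2) + r"
    proof -
      have "ln 4 \<le> ln 4 * real n" using n mult_left_mono[of 1 "real n" "ln 4"] by simp
      moreover have "n / 2 * ln n + ln (region_const p * K) * n + ln 4 * real n + real n \<le> r"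
        using r by (simp add: algebra_simps)
      moreover have "- ln 4 - n * (ln (region_const p * K) + ln n / 2) + r
          = r - (n / 2 * ln n + ln (region_const p * K) * n) - ln 4" by (simp add: algebra_simps)
      ultimately show ?thesis by linarith
    qed
    then have "exp (real n) \<le> m * exp r" unfolding mexp by (simp add: exp_add[symmetric])
    also have "\<dots> \<le> m * N" using Nr by (intro mult_left_mono) (simp_all add: mexp)
    finally have mN: "n * ln (17 * n) + n \<le> m * N" using n' by simp
    have m1: "m \<le> 1"
    proof -
      have "1 \<le> region_const p * K * sqrt n" by (rule region_scale_ge_1[OF p n1 K(1)])
      then have "(1 / (region_const p * K * sqrt n)) ^ n \<le> 1" by (intro power_le_one) auto
      then show ?thesis by (simp add: m_def)
    qed
    then have "\<bar>1 - m\<bar> \<le> exp (- m)" using exp_ge_add_one_self[of "- m"] by simp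
    then have "\<bar>1 - m\<bar> ^ N \<le> exp (- m) ^ N" by (intro power_mono) auto
    also have "\<dots> = exp (- (m * N))" using exp_of_nat_mult[of N "- m"] by (simp add: mult_ac)
    finally have "\<eta> \<le> (17 * real n) ^ n * exp (- (m * N))"
      unfolding \<eta>_def by (intro mult_left_mono) auto
    also have "(17 * real n) ^ n = exp (n * ln (17 * n))"
      using n exp_of_nat_mult[of n "ln (17 * real n)"] by simp
    also have "\<dots> * exp (- (m * N)) = exp (n * ln (17 * n) - m * N)" by (simp add: exp_add[symmetric])
    also have "\<dots> \<le> exp (- real n)" using mN by simp
    finally show ?thesis .
  qed
  ultimately show ?thesis by linarith
qed

lemma rho1_ge:
  assumes "0 < r" "\<And>N. 1 \<le> N \<Longrightarrow> real N \<le> exp r \<Longrightarrow> expected_hull_measure n \<mu> N \<le> \<delta>"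
  shows "ereal r \<le> rho1 n \<mu> \<delta>"
  unfolding rho1_def using assms by (intro Sup_upper imageI) auto

lemma rho2_le:
  assumes "0 < r" "\<And>N. 1 \<le> N \<Longrightarrow> exp r \<le> real N \<Longrightarrow> 1 - \<delta> \<le> expected_hull_measure n \<mu> N"
  shows "rho2 n \<mu> \<delta> \<le> ereal r"
  unfolding rho2_def using assms by (intro Inf_lower imageI) auto

text \<open>
  The threshold is around \<open>n / 2 * ln n\<close>.  The parameter \<open>K\<close> has
  to tend to infinity, for the typical set to have measure tending to 1, but
  \<open>K n = o(n * ln n)\<close> and \<open>n * ln K = o(n * ln n)\<close> are
  needed to keep the errors below \<open>\<epsilon> * n * ln n\<close>;
  \<open>K = sqrt (ln n)\<close> does this.  A single sequence \<open>\<delta>\<close>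
  serves all \<open>\<epsilon>\<close>.
\<close>

lemma lp_ball_sharp_threshold:
  assumes p: "1 < p"
  shows "sharp_threshold (\<lambda>n. lp_unif p n)"
proof -
  \<comment> \<open>The maximum only makes \<open>T\<close> positive for small
    \<open>n\<close>.\<close>
  define T where "T n = max 1 (real n / 2 * ln (real n))" for n :: nat
  define K where "K n = sqrt (ln (real n))" for n :: nat
  define \<delta> where "\<delta> n = atypical_bound (K n) n + exp (- real n)" for n :: nat
  have Tpos: "0 < T n" for n by (simp add: T_def)
  have K0: "0 \<le> K n" for n by (cases "n = 0") (simp_all add: K_def)
  have \<delta>pos: "0 < \<delta> n" for n
  proof -
    have "0 < exp (- K n)" "0 \<le> 1 / K n" "0 \<le> (1 / 2 :: real) ^ n" "0 < exp (- real n)" using K0[of n] by simp_all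
    then show ?thesis unfolding \<delta>_def atypical_bound_def by linarith
  qed
  have \<delta>0: "\<delta> \<longlonglongrightarrow> 0"
    unfolding \<delta>_def atypical_bound_def K_def by real_asymp
  have main: "\<exists>n0. \<forall>n\<ge>n0. ereal ((1 - \<epsilon>) * T n) \<le> rho1 n (lp_unif p n) (\<delta> n) \<and>
     rho2 n (lp_unif p n) (\<delta> n) \<le> ereal ((1 + \<epsilon>) * T n)"
    if \<epsilon>: "0 < \<epsilon>" "\<epsilon> < 1" for \<epsilon> :: real
  proof -
    define A where "A = ln (cap_const p)"
    define R where "R = region_const p"
    have R: "0 < R" unfolding R_def by (rule region_const_pos[OF p])
    have p0: "0 < p" using p by simp
    have "\<forall>\<^sub>F n in sequentially. 2 \<le> n" by (rule eventually_ge_at_top)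
    moreover have "\<forall>\<^sub>F n in sequentially. 1 \<le> sqrt (ln (real n))" by real_asymp
    moreover have "\<forall>\<^sub>F n in sequentially. sqrt (ln (real n)) < real n" by real_asymp
    moreover have "\<forall>\<^sub>F n in sequentially. 1 \<le> real n / 2 * ln (real n)" by real_asymp
    moreover have "\<forall>\<^sub>F n in sequentially. p * sqrt (ln (real n)) + A + 1 \<le> \<epsilon> / 2 * ln (real n)"
      using \<epsilon> p0 by real_asymp
    moreover have "\<forall>\<^sub>F n in sequentially. ln (R * sqrt (ln (real n))) + ln 4 + 1 \<le> \<epsilon> / 2 * ln (real n)"
      using \<epsilon> R by real_asymp
    moreover have "\<forall>\<^sub>F n in sequentially. real n * ln (17 * real n) + real n \<le> exp (real n)"
      by real_asymp
    ultimately have "\<forall>\<^sub>F n in sequentially. ereal ((1 - \<epsilon>) * T n) \<le> rho1 n (lp_unif p n) (\<delta> n) \<and>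
     rho2 n (lp_unif p n) (\<delta> n) \<le> ereal ((1 + \<epsilon>) * T n)"
    proof eventually_elim
      case (elim n)
      have Tn: "T n = real n / 2 * ln (real n)" using elim(4) by (simp add: T_def)
      have Kn: "1 \<le> K n" "K n < real n" using elim(2,3) by (simp_all add: K_def)
      show ?case
      proof
        show "ereal ((1 - \<epsilon>) * T n) \<le> rho1 n (lp_unif p n) (\<delta> n)"
        proof (rule rho1_ge)
          show "0 < (1 - \<epsilon>) * T n" using \<epsilon> Tpos by simp
          fix N :: nat assume N: "1 \<le> N" "real N \<le> exp ((1 - \<epsilon>) * T n)"
          have "(p * K n + ln (cap_const p) + 1) * real n \<le> \<epsilon> / 2 * ln (real n) * real n"
            using elim(5) unfolding K_def A_def by (intro mult_right_mono) auto
          moreover have "\<epsilon> / 2 * ln (real n) * real n = real n / 2 * ln (real n) - (1 - \<epsilon>) * T n"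
            unfolding Tn by (simp add: field_simps)
          ultimately have "(1 - \<epsilon>) * T n + (p * K n + ln (cap_const p) + 1) * real n \<le> real n / 2 * ln (real n)"
            by linarith
          then show "expected_hull_measure n (lp_unif p n) N \<le> \<delta> n"
            unfolding \<delta>_def by (rule few_points_hull[OF p elim(1) Kn N])
        qed
        show "rho2 n (lp_unif p n) (\<delta> n) \<le> ereal ((1 + \<epsilon>) * T n)"
        proof (rule rho2_le)
          show "0 < (1 + \<epsilon>) * T n" using \<epsilon> Tpos by simp
          fix N :: nat assume N: "1 \<le> N" "exp ((1 + \<epsilon>) * T n) \<le> real N"
          have "(ln (region_const p * K n) + ln 4 + 1) * real n \<le> \<epsilon> / 2 * ln (real n) * real n"
            using elim(6) unfolding K_def R_def by (intro mult_right_mono) auto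
          moreover have "\<epsilon> / 2 * ln (real n) * real n = (1 + \<epsilon>) * T n - real n / 2 * ln (real n)"
            unfolding Tn by (simp add: field_simps)
          ultimately have "real n / 2 * ln (real n) + (ln (region_const p * K n) + ln 4 + 1) * real n \<le> (1 + \<epsilon>) * T n"
            by linarith
          from many_points_hull[OF p elim(1) Kn N this elim(7)]
          show "1 - \<delta> n \<le> expected_hull_measure n (lp_unif p n) N" unfolding \<delta>_def .
        qed
      qed
    qed
    then show ?thesis by (simp add: eventually_sequentially)
  qed
  show ?thesis
    unfolding sharp_threshold_def sharp_threshold_around_def
    using Tpos \<delta>pos \<delta>0 main by blast
qed

theorem theorem1p7:
  fixes p :: real
  assumes "1 < p"
  shows "(\<exists>C>0. \<exists>c>0. \<forall>n\<ge>1.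
            enn2ereal (\<integral>\<^sup>+x. neg_log (tukey_depth n (lp_unif p n) x) \<partial>(lp_unif p n))
              \<ge> ereal (C * real n * ln (real n) - c * real n))
         \<and> sharp_threshold (\<lambda>n. lp_unif p n)"
  using expected_neg_log_depth[OF assms] lp_ball_sharp_threshold[OF assms] by (rule conjI)

end
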